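(* The function $R\to\mathcal{D}'_c(R^3)$ given by $t\mapsto\frac{1}{4\pi}\cdot t\cdot S^t$ is a solution of the wave equation $\ddot Q(t)=\Delta(Q(t))$ (for all $t\in R$) in dimension 3; its initial value and initial speed are, respectively, $0$ and $\delta(0)$. The function $R\to\mathcal{D}'_c(R^3)$ given by $t\mapsto\frac{1}{4\pi}\cdot(S^t+t^2\cdot\Delta(B^t))$ is a solution of the same wave equation; its initial value and initial speed are, respectively, $\delta(0)$ and $0$.
   Context: Setting: synthetic differential geometry. $R$ is the number line (a commutative ring object containing $\mathbb{Q}$ satisfying the Kock–Lawvere axiom, with the integration axiom: every $f$ has a unique antiderivative with given value at a point) in a well-adapted model; statements are read in the internal logic. $D=\{d\in R:d^2=0\}$. $\mathcal{D}'_c(R^n)$, the distributions of compact support on $R^n$, is the $R$-module of $R$-linear maps $R^{(R^n)}\to R$; evaluation is written $\langle\mu,\psi\rangle$. $\delta(0)$ is the Dirac distribution $\psi\mapsto\psi(0)$. The Laplace operator $\Delta=\sum\partial^2/\partial x_i^2$ acts on distributions by $\langle\Delta(\mu),\psi\rangle=\langle\mu,\Delta\psi\rangle$. For $Q:R\to\mathcal{D}'_c(R^n)$, $\dot Q=\frac{d}{dt}Q$ is determined by $Q(t+d)=Q(t)+d\cdot\dot Q(t)$ for all $d\in D$, i.e. $\langle\dot Q(t),\psi\rangle=\frac{d}{dt}\langle Q(t),\psi\rangle$. The initial value is $Q(0)$ and the initial speed is $\dot Q(0)$. In dimension 3, for every $t\in R$: $$\langle S^t,\psi\rangle=\int_0^{\pi}\int_0^{2\pi}\psi(t\cos\theta\sin\phi,t\sin\theta\sin\phi,t\cos\phi)\sin\phi\,d\theta\,d\phi,$$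 $$\langle B^t,\psi\rangle=\int_0^1\int_0^{\pi}\int_0^{2\pi}\psi(ts\cos\theta\sin\phi,ts\sin\theta\sin\phi,ts\cos\phi)\,s^2\sin\phi\,d\theta\,d\phi\,ds.$$ *)

theory Defs
  imports "HOL-Analysis.Analysis"
begin

section \<open>Categories and elementary toposes\<close>

record ('o, 'a) cat =
  Obj :: "'o set"
  Arr :: "'a set"
  Src :: "'a \<Rightarrow> 'o"
  Tgt :: "'a \<Rightarrow> 'o"
  Idt :: "'o \<Rightarrow> 'a"
  Cmp :: "'a \<Rightarrow> 'a \<Rightarrow> 'a"  (infixr "\<cdot>\<index>" 75)

definition Hom :: "('o, 'a, 'z) cat_scheme \<Rightarrow> 'o \<Rightarrow> 'o \<Rightarrow> 'a set" where
  "Hom C X Y = {f \<in> Arr C. Src C f = X \<and> Tgt C f = Y}"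

locale category =
  fixes C :: "('o, 'a, 'z) cat_scheme" (structure)
  assumes Src_Obj: "f \<in> Arr C \<Longrightarrow> Src C f \<in> Obj C"
    and Tgt_Obj: "f \<in> Arr C \<Longrightarrow> Tgt C f \<in> Obj C"
    and Idt_Hom: "X \<in> Obj C \<Longrightarrow> Idt C X \<in> Hom C X X"
    and Cmp_Hom: "f \<in> Hom C X Y \<Longrightarrow> g \<in> Hom C Y Z \<Longrightarrow> g \<cdot> f \<in> Hom C X Z"
    and Cmp_assoc: "f \<in> Hom C W X \<Longrightarrow> g \<in> Hom C X Y \<Longrightarrow> h \<in> Hom C Y Z
      \<Longrightarrow> h \<cdot> (g \<cdot> f) = (h \<cdot> g) \<cdot> f"
    and Idt_left: "f \<in> Hom C X Y \<Longrightarrow> Idt C Y \<cdot> f = f"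
    and Idt_right: "f \<in> Hom C X Y \<Longrightarrow> f \<cdot> Idt C X = f"

context
  fixes C :: "('o, 'a, 'z) cat_scheme" (structure)
begin

definition is_terminal :: "'o \<Rightarrow> bool" where
  "is_terminal T \<longleftrightarrow> T \<in> Obj C \<and> (\<forall>X\<in>Obj C. \<exists>!f. f \<in> Hom C X T)"

definition is_product :: "'o \<Rightarrow> 'a \<Rightarrow> 'a \<Rightarrow> 'o \<Rightarrow> 'o \<Rightarrow> bool" where
  "is_product P p q X Y \<longleftrightarrow> P \<in> Obj C \<and> p \<in> Hom C P X \<and> q \<in> Hom C P Y \<and>
     (\<forall>Z\<in>Obj C. \<forall>u\<in>Hom C Z X. \<forall>v\<in>Hom C Z Y.
        \<exists>!h. h \<in> Hom C Z P \<and> p \<cdot> h = u \<and> q \<cdot> h = v)"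

definition is_equalizer :: "'a \<Rightarrow> 'a \<Rightarrow> 'a \<Rightarrow> bool" where
  "is_equalizer e f g \<longleftrightarrow> e \<in> Arr C \<and> f \<in> Arr C \<and> g \<in> Hom C (Src C f) (Tgt C f) \<and>
     Tgt C e = Src C f \<and> f \<cdot> e = g \<cdot> e \<and>
     (\<forall>u\<in>Arr C. Tgt C u = Src C f \<and> f \<cdot> u = g \<cdot> u \<longrightarrow>
        (\<exists>!h. h \<in> Hom C (Src C u) (Src C e) \<and> e \<cdot> h = u))"

definition is_pullback :: "'a \<Rightarrow> 'a \<Rightarrow> 'a \<Rightarrow> 'a \<Rightarrow> bool" where
  "is_pullback p q f g \<longleftrightarrow> f \<in> Arr C \<and> g \<in> Arr C \<and> Tgt C f = Tgt C g \<and>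
     p \<in> Arr C \<and> q \<in> Arr C \<and> Src C p = Src C q \<and> Tgt C p = Src C f \<and> Tgt C q = Src C g \<and>
     f \<cdot> p = g \<cdot> q \<and>
     (\<forall>u\<in>Arr C. \<forall>v\<in>Arr C.
        Src C u = Src C v \<and> Tgt C u = Src C f \<and> Tgt C v = Src C g \<and> f \<cdot> u = g \<cdot> v \<longrightarrow>
        (\<exists>!h. h \<in> Hom C (Src C u) (Src C p) \<and> p \<cdot> h = u \<and> q \<cdot> h = v))"

definition is_mono :: "'a \<Rightarrow> bool" where
  "is_mono m \<longleftrightarrow> m \<in> Arr C \<and>
     (\<forall>Z\<in>Obj C. \<forall>u\<in>Hom C Z (Src C m). \<forall>v\<in>Hom C Z (Src C m). m \<cdot> u = m \<cdot> v \<longrightarrow> u = v)"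

definition is_subobject_classifier :: "'o \<Rightarrow> 'a \<Rightarrow> bool" where
  "is_subobject_classifier W t \<longleftrightarrow> t \<in> Arr C \<and> Tgt C t = W \<and> is_terminal (Src C t) \<and>
     (\<forall>m. is_mono m \<longrightarrow>
        (\<exists>!c. c \<in> Hom C (Tgt C m) W \<and>
              (\<forall>b\<in>Hom C (Src C m) (Src C t). is_pullback m b c t)))"

end

record ('o, 'a) topos_data = "('o, 'a) cat" +
  Pt :: 'o
  Prd :: "'o \<Rightarrow> 'o \<Rightarrow> 'o"
  Pr1 :: "'o \<Rightarrow> 'o \<Rightarrow> 'a"
  Pr2 :: "'o \<Rightarrow> 'o \<Rightarrow> 'a"
  Expo :: "'o \<Rightarrow> 'o \<Rightarrow> 'o"
  Ev :: "'o \<Rightarrow> 'o \<Rightarrow> 'a"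

text \<open>\<open>Expo E A B\<close> is the exponential of functions from \<open>A\<close> to \<open>B\<close>, with evaluation
  \<open>Ev E A B\<close> defined on \<open>Prd E (Expo E A B) A\<close>.\<close>

definition pair :: "('o, 'a, 'z) topos_data_scheme \<Rightarrow> 'a \<Rightarrow> 'a \<Rightarrow> 'a" where
  "pair E f g = (THE h. h \<in> Hom E (Src E f) (Prd E (Tgt E f) (Tgt E g)) \<and>
     Pr1 E (Tgt E f) (Tgt E g) \<cdot>\<^bsub>E\<^esub> h = f \<and> Pr2 E (Tgt E f) (Tgt E g) \<cdot>\<^bsub>E\<^esub> h = g)"

definition is_transpose ::
    "('o, 'a, 'z) topos_data_scheme \<Rightarrow> 'o \<Rightarrow> 'o \<Rightarrow> 'o \<Rightarrow> 'a \<Rightarrow> 'a \<Rightarrow> bool" where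
  "is_transpose E X A B f h \<longleftrightarrow> h \<in> Hom E X (Expo E A B) \<and>
     Ev E A B \<cdot>\<^bsub>E\<^esub> pair E (h \<cdot>\<^bsub>E\<^esub> Pr1 E X A) (Pr2 E X A) = f"

locale elementary_topos = category E
  for E :: "('o, 'a, 'z) topos_data_scheme" (structure) +
  assumes Pt_terminal: "is_terminal E (Pt E)"
    and Prd_product: "X \<in> Obj E \<Longrightarrow> Y \<in> Obj E
      \<Longrightarrow> is_product E (Prd E X Y) (Pr1 E X Y) (Pr2 E X Y) X Y"
    and ex_equalizer: "f \<in> Hom E X Y \<Longrightarrow> g \<in> Hom E X Y \<Longrightarrow> \<exists>e. is_equalizer E e f g"
    and Expo_Obj: "A \<in> Obj E \<Longrightarrow> B \<in> Obj E \<Longrightarrow> Expo E A B \<in> Obj E"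
    and Ev_Hom: "A \<in> Obj E \<Longrightarrow> B \<in> Obj E \<Longrightarrow> Ev E A B \<in> Hom E (Prd E (Expo E A B) A) B"
    and ex1_transpose: "X \<in> Obj E \<Longrightarrow> A \<in> Obj E \<Longrightarrow> B \<in> Obj E \<Longrightarrow> f \<in> Hom E (Prd E X A) B
      \<Longrightarrow> \<exists>!h. is_transpose E X A B f h"
    and ex_subobject_classifier: "\<exists>W t. is_subobject_classifier E W t"


section \<open>The category of smooth manifolds\<close>

text \<open>By Whitney's embedding theorem, the category of (second countable, Hausdorff) smooth
  manifolds is equivalent to that of manifolds embedded in some Euclidean space, which is the one
  used here. All Euclidean spaces live in the type of real sequences, whose product topology
  induces the usual topology on \<open>eucl n\<close>.\<close>

type_synonym vec = "nat \<Rightarrow> real"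

definition eucl :: "nat \<Rightarrow> vec set" where
  "eucl n = {x. \<forall>i\<ge>n. x i = 0}"

definition sc :: "real \<Rightarrow> vec" where
  "sc c = (\<lambda>i. if i = 0 then c else 0)"

text \<open>For \<open>U\<close> open in \<open>eucl n\<close>: all iterated partial derivatives of \<open>f\<close> exist and are continuous
  on \<open>U\<close>. The set \<open>F\<close> is one that contains \<open>f\<close> and is closed under partial derivatives.\<close>

definition smooth_on :: "nat \<Rightarrow> vec set \<Rightarrow> (vec \<Rightarrow> real) \<Rightarrow> bool" where
  "smooth_on n U f \<longleftrightarrow> (\<exists>F. f \<in> F \<and> (\<forall>g\<in>F. continuous_on U g \<and>
     (\<forall>i<n. \<exists>h\<in>F. \<forall>x\<in>U. ((\<lambda>s. g (x(i := s))) has_real_derivative h x) (at (x i)))))"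

definition smooth_map :: "vec set \<Rightarrow> vec set \<Rightarrow> (vec \<Rightarrow> vec) \<Rightarrow> bool" where
  "smooth_map A B f \<longleftrightarrow> f ` A \<subseteq> B \<and>
     (\<exists>n. A \<subseteq> eucl n \<and>
        (\<forall>p\<in>A. \<exists>U g. p \<in> U \<and> openin (top_of_set (eucl n)) U \<and>
           (\<forall>j. smooth_on n U (\<lambda>x. g x j)) \<and> (\<forall>x\<in>U \<inter> A. g x = f x)))"

definition is_manifold :: "vec set \<Rightarrow> bool" where
  "is_manifold A \<longleftrightarrow> (\<exists>n k. A \<subseteq> eucl n \<and>
     (\<forall>p\<in>A. \<exists>U V a b. p \<in> U \<and> openin (top_of_set A) U \<and> openin (top_of_set (eucl k)) V \<and>
        smooth_map U V a \<and> smooth_map V U b \<and>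
        (\<forall>x\<in>U. b (a x) = x) \<and> (\<forall>y\<in>V. a (b y) = y)))"

type_synonym mfarr = "vec set \<times> vec set \<times> (vec \<Rightarrow> vec)"

definition mfmap :: "vec set \<Rightarrow> vec set \<Rightarrow> (vec \<Rightarrow> vec) \<Rightarrow> mfarr" where
  "mfmap A B f = (A, B, restrict f A)"

definition Mf :: "(vec set, mfarr) cat" where
  "Mf = \<lparr>Obj = Collect is_manifold,
         Arr = {(A, B, f). is_manifold A \<and> is_manifold B \<and> smooth_map A B f \<and> f \<in> extensional A},
         Src = (\<lambda>(A, B, f). A),
         Tgt = (\<lambda>(A, B, f). B),
         Idt = (\<lambda>A. mfmap A A (\<lambda>x. x)),
         Cmp = (\<lambda>(B', C, g) (A, B, f). mfmap A C (g \<circ> f))\<rparr>"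

text \<open>Tangent vectors are velocities of smooth curves.\<close>

definition smooth_curve :: "vec set \<Rightarrow> (real \<Rightarrow> vec) \<Rightarrow> bool" where
  "smooth_curve A c \<longleftrightarrow> smooth_map (eucl 1) A (\<lambda>z. c (z 0))"

definition velocity :: "(real \<Rightarrow> vec) \<Rightarrow> vec \<Rightarrow> bool" where
  "velocity c v \<longleftrightarrow> (\<forall>i. ((\<lambda>s. c s i) has_real_derivative v i) (at 0))"

definition transversal :: "mfarr \<Rightarrow> mfarr \<Rightarrow> bool" where
  "transversal = (\<lambda>(A, K, f) (B, K', g).
     \<forall>x\<in>A. \<forall>y\<in>B. f x = g y \<longrightarrow>
       (\<forall>c w. smooth_curve K c \<and> c 0 = f x \<and> velocity c w \<longrightarrow>
         (\<exists>a b u v. smooth_curve A a \<and> a 0 = x \<and> velocity (f \<circ> a) u \<and>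
                    smooth_curve B b \<and> b 0 = y \<and> velocity (g \<circ> b) v \<and>
                    w = (\<lambda>i. u i + v i))))"


section \<open>The line and its internal calculus\<close>

text \<open>A topos together with the object part \<open>\<iota>o\<close> and the arrow part \<open>\<iota>a\<close> of a functor from \<open>Mf\<close>.\<close>

record ('o, 'a) sdg_data = "('o, 'a) topos_data" +
  \<iota>o :: "vec set \<Rightarrow> 'o"
  \<iota>a :: "mfarr \<Rightarrow> 'a"

text \<open>The internal language is read by Kripke-Joyal semantics: an element of an object \<open>A\<close> at
  stage \<open>X\<close> is an arrow from \<open>X\<close> to \<open>A\<close>, its restriction along an arrow \<open>x\<close> into \<open>X\<close> is the
  composite with \<open>x\<close>, and universal quantifiers range over all later stages. A term with a free
  variable of type \<open>A\<close> over stage \<open>X\<close> is a meta-level function taking a restriction arrow into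
  \<open>X\<close> and an element of \<open>A\<close> at the source of this arrow; internal abstraction over the
  variable evaluates it at the generic element, i.e. at the two projections of \<open>Prd M X A\<close>.\<close>

context
  fixes M :: "('o, 'a, 'z) sdg_data_scheme" (structure)
begin

definition line :: 'o where
  "line = \<iota>o M (eucl 1)"

text \<open>A smooth function of finitely many real variables acts on elements of the line; the
  functor is required below to preserve finite products of Euclidean spaces, so that the list of
  elements amounts to an element of the image of \<open>eucl n\<close>. The ring structure of the line and
  the inclusion of the rationals are instances of this.\<close>

definition tuple :: "'o \<Rightarrow> 'a list \<Rightarrow> 'a" where
  "tuple X as = (THE u. u \<in> Hom M X (\<iota>o M (eucl (length as))) \<and>
     (\<forall>k<length as. \<iota>a M (mfmap (eucl (length as)) (eucl 1) (\<lambda>v. sc (v k))) \<cdot> u = as ! k))"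

definition smooth_op :: "'o \<Rightarrow> (vec \<Rightarrow> real) \<Rightarrow> 'a list \<Rightarrow> 'a" where
  "smooth_op X h as =
     \<iota>a M (mfmap (eucl (length as)) (eucl 1) (\<lambda>v. sc (h v))) \<cdot> tuple X as"

definition rconst :: "'o \<Rightarrow> real \<Rightarrow> 'a" where
  "rconst X c = smooth_op X (\<lambda>_. c) []"

definition radd :: "'a \<Rightarrow> 'a \<Rightarrow> 'a"  (infixl "\<oplus>" 65) where
  "a \<oplus> b = smooth_op (Src M a) (\<lambda>v. v 0 + v 1) [a, b]"

definition rmult :: "'a \<Rightarrow> 'a \<Rightarrow> 'a"  (infixl "\<otimes>" 70) where
  "a \<otimes> b = smooth_op (Src M a) (\<lambda>v. v 0 * v 1) [a, b]"

definition rcos :: "'a \<Rightarrow> 'a" where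
  "rcos a = smooth_op (Src M a) (\<lambda>v. cos (v 0)) [a]"

definition rsin :: "'a \<Rightarrow> 'a" where
  "rsin a = smooth_op (Src M a) (\<lambda>v. sin (v 0)) [a]"

text \<open>The elements at stage \<open>X\<close> of the subobject of the line given by \<open>d\<^sup>2 = 0\<close>.\<close>

definition infinitesimals :: "'o \<Rightarrow> 'a set" where
  "infinitesimals X = {d \<in> Hom M X line. d \<otimes> d = rconst X 0}"

definition kock_lawvere :: bool where
  "kock_lawvere \<longleftrightarrow>
     (\<forall>e. is_equalizer M e (Idt M line \<otimes> Idt M line) (rconst line 0) \<longrightarrow>
        (\<forall>X\<in>Obj M. \<forall>f\<in>Hom M (Prd M X (Src M e)) line.
           \<exists>!(a, b). a \<in> Hom M X line \<and> b \<in> Hom M X line \<and>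
              f = (a \<cdot> Pr1 M X (Src M e)) \<oplus>
                  ((e \<cdot> Pr2 M X (Src M e)) \<otimes> (b \<cdot> Pr1 M X (Src M e)))))"

definition is_derivative :: "'o \<Rightarrow> 'a \<Rightarrow> 'a \<Rightarrow> bool" where
  "is_derivative X f f' \<longleftrightarrow> f' \<in> Hom M (Prd M X line) line \<and>
     (\<forall>Y\<in>Obj M. \<forall>x\<in>Hom M Y X. \<forall>r\<in>Hom M Y line. \<forall>d\<in>infinitesimals Y.
        f \<cdot> pair M x (r \<oplus> d) = (f \<cdot> pair M x r) \<oplus> (d \<otimes> (f' \<cdot> pair M x r)))"

definition is_antiderivative :: "'o \<Rightarrow> 'a \<Rightarrow> 'a \<Rightarrow> 'a \<Rightarrow> 'a \<Rightarrow> bool" where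
  "is_antiderivative X f a c g \<longleftrightarrow> g \<in> Hom M (Prd M X line) line \<and>
     is_derivative X g f \<and> g \<cdot> pair M (Idt M X) a = c"

definition integration_axiom :: bool where
  "integration_axiom \<longleftrightarrow>
     (\<forall>X\<in>Obj M. \<forall>f\<in>Hom M (Prd M X line) line. \<forall>a\<in>Hom M X line. \<forall>c\<in>Hom M X line.
        \<exists>!g. is_antiderivative X f a c g)"

text \<open>\<open>integral_op X a b F\<close> is the integral from \<open>a\<close> to \<open>b\<close> of the internal function given by
  the term \<open>F\<close>: the value at \<open>b\<close> of the antiderivative that vanishes at \<open>a\<close>.\<close>

definition integral_op :: "'o \<Rightarrow> 'a \<Rightarrow> 'a \<Rightarrow> ('a \<Rightarrow> 'a \<Rightarrow> 'a) \<Rightarrow> 'a" where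
  "integral_op X a b F =
     (THE g. is_antiderivative X (F (Pr1 M X line) (Pr2 M X line)) a (rconst X 0) g)
       \<cdot> pair M (Idt M X) b"

end

notation radd (infixl "\<oplus>\<index>" 65)
notation rmult (infixl "\<otimes>\<index>" 70)

locale well_adapted_model = elementary_topos M
  for M :: "('o, 'a, 'z) sdg_data_scheme" (structure) +
  assumes \<iota>_Obj: "A \<in> Obj Mf \<Longrightarrow> \<iota>o M A \<in> Obj M"
    and \<iota>_Idt: "A \<in> Obj Mf \<Longrightarrow> \<iota>a M (Idt Mf A) = Idt M (\<iota>o M A)"
    and \<iota>_Cmp: "f \<in> Hom Mf A B \<Longrightarrow> g \<in> Hom Mf B C
      \<Longrightarrow> \<iota>a M (g \<cdot>\<^bsub>Mf\<^esub> f) = \<iota>a M g \<cdot> \<iota>a M f"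
    and \<iota>_full_faithful: "A \<in> Obj Mf \<Longrightarrow> B \<in> Obj Mf
      \<Longrightarrow> bij_betw (\<iota>a M) (Hom Mf A B) (Hom M (\<iota>o M A) (\<iota>o M B))"
    and \<iota>_terminal: "is_terminal M (\<iota>o M (eucl 0))"
    and \<iota>_transversal: "is_pullback Mf p q f g \<Longrightarrow> transversal f g
      \<Longrightarrow> is_pullback M (\<iota>a M p) (\<iota>a M q) (\<iota>a M f) (\<iota>a M g)"
    and \<iota>_open_cover: "A \<in> Obj Mf \<Longrightarrow> (\<forall>U\<in>\<U>. openin (top_of_set A) U) \<Longrightarrow> \<Union>\<U> = A
      \<Longrightarrow> Z \<in> Obj M \<Longrightarrow> u \<in> Hom M (\<iota>o M A) Z \<Longrightarrow> v \<in> Hom M (\<iota>o M A) Z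
      \<Longrightarrow> (\<forall>U\<in>\<U>. u \<cdot> \<iota>a M (mfmap U A (\<lambda>x. x)) = v \<cdot> \<iota>a M (mfmap U A (\<lambda>x. x)))
      \<Longrightarrow> u = v"
    and kock_lawvere: "kock_lawvere M"
    and integration_axiom: "integration_axiom M"


section \<open>Distributions of compact support in dimension 3\<close>

context
  fixes M :: "('o, 'a, 'z) sdg_data_scheme" (structure)
begin

definition space3 :: 'o where
  "space3 = Prd M (line M) (Prd M (line M) (line M))"

definition point3 :: "'a \<Rightarrow> 'a \<Rightarrow> 'a \<Rightarrow> 'a" where
  "point3 x y z = pair M x (pair M y z)"

definition coord3 :: "nat \<Rightarrow> 'a \<Rightarrow> 'a" where
  "coord3 i p =
     (if i = 0 then Pr1 M (line M) (Prd M (line M) (line M)) \<cdot> p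
      else if i = 1 then Pr1 M (line M) (line M) \<cdot> Pr2 M (line M) (Prd M (line M) (line M)) \<cdot> p
      else Pr2 M (line M) (line M) \<cdot> Pr2 M (line M) (Prd M (line M) (line M)) \<cdot> p)"

definition shift3 :: "nat \<Rightarrow> 'a \<Rightarrow> 'a \<Rightarrow> 'a" where
  "shift3 i d p = point3
     (if i = 0 then coord3 0 p \<oplus> d else coord3 0 p)
     (if i = 1 then coord3 1 p \<oplus> d else coord3 1 p)
     (if i = 2 then coord3 2 p \<oplus> d else coord3 2 p)"

definition testfun :: 'o where
  "testfun = Expo M space3 (line M)"

definition tapp :: "'a \<Rightarrow> 'a \<Rightarrow> 'a" where
  "tapp \<psi> p = Ev M space3 (line M) \<cdot> pair M \<psi> p"

definition tabs :: "'o \<Rightarrow> ('a \<Rightarrow> 'a \<Rightarrow> 'a) \<Rightarrow> 'a" where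
  "tabs X F = (THE h. is_transpose M X space3 (line M) (F (Pr1 M X space3) (Pr2 M X space3)) h)"

definition tadd :: "'a \<Rightarrow> 'a \<Rightarrow> 'a" where
  "tadd \<psi> \<xi> = tabs (Src M \<psi>) (\<lambda>x p. tapp (\<psi> \<cdot> x) p \<oplus> tapp (\<xi> \<cdot> x) p)"

definition tscale :: "'a \<Rightarrow> 'a \<Rightarrow> 'a" where
  "tscale a \<psi> = tabs (Src M \<psi>) (\<lambda>x p. (a \<cdot> x) \<otimes> tapp (\<psi> \<cdot> x) p)"

definition partial :: "nat \<Rightarrow> 'a \<Rightarrow> 'a" where
  "partial i \<psi> = (THE \<xi>. \<xi> \<in> Hom M (Src M \<psi>) testfun \<and>
     (\<forall>Y\<in>Obj M. \<forall>x\<in>Hom M Y (Src M \<psi>). \<forall>p\<in>Hom M Y space3. \<forall>d\<in>infinitesimals M Y.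
        tapp (\<psi> \<cdot> x) (shift3 i d p) = tapp (\<psi> \<cdot> x) p \<oplus> (d \<otimes> tapp (\<xi> \<cdot> x) p)))"

definition laplace :: "'a \<Rightarrow> 'a" where
  "laplace \<psi> = tadd (tadd (partial 0 (partial 0 \<psi>)) (partial 1 (partial 1 \<psi>)))
                   (partial 2 (partial 2 \<psi>))"

text \<open>\<open>dapp \<mu> x \<psi>\<close> is the value at \<open>\<psi>\<close> of the restriction of \<open>\<mu>\<close> along \<open>x\<close>, for an element
  \<open>\<mu>\<close>, at some stage, of the object of functions from test functions to the line.\<close>

definition dapp :: "'a \<Rightarrow> 'a \<Rightarrow> 'a \<Rightarrow> 'a" where
  "dapp \<mu> x \<psi> = \<mu> \<cdot> pair M x \<psi>"

text \<open>The elements at stage \<open>X\<close> of the object of distributions. In particular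
  \<open>distributions (line M)\<close> is the set of functions from the line to distributions.\<close>

definition distributions :: "'o \<Rightarrow> 'a set" where
  "distributions X = {\<mu> \<in> Hom M (Prd M X testfun) (line M).
     \<forall>Y\<in>Obj M. \<forall>x\<in>Hom M Y X. \<forall>\<psi>\<in>Hom M Y testfun.
       (\<forall>\<xi>\<in>Hom M Y testfun. dapp \<mu> x (tadd \<psi> \<xi>) = dapp \<mu> x \<psi> \<oplus> dapp \<mu> x \<xi>) \<and>
       (\<forall>a\<in>Hom M Y (line M). dapp \<mu> x (tscale a \<psi>) = a \<otimes> dapp \<mu> x \<psi>)}"

definition dabs :: "'o \<Rightarrow> ('a \<Rightarrow> 'a \<Rightarrow> 'a) \<Rightarrow> 'a" where
  "dabs X F = F (Pr1 M X testfun) (Pr2 M X testfun)"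

definition dzero :: "'o \<Rightarrow> 'a" where
  "dzero X = dabs X (\<lambda>x \<psi>. rconst M (Src M \<psi>) 0)"

definition dadd :: "'o \<Rightarrow> 'a \<Rightarrow> 'a \<Rightarrow> 'a" where
  "dadd X \<mu> \<nu> = dabs X (\<lambda>x \<psi>. dapp \<mu> x \<psi> \<oplus> dapp \<nu> x \<psi>)"

definition dscale :: "'o \<Rightarrow> 'a \<Rightarrow> 'a \<Rightarrow> 'a" where
  "dscale X c \<mu> = dabs X (\<lambda>x \<psi>. (c \<cdot> x) \<otimes> dapp \<mu> x \<psi>)"

definition dlaplace :: "'o \<Rightarrow> 'a \<Rightarrow> 'a" where
  "dlaplace X \<mu> = dabs X (\<lambda>x \<psi>. dapp \<mu> x (laplace \<psi>))"

definition dirac0 :: "'o \<Rightarrow> 'a" where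
  "dirac0 X = dabs X (\<lambda>x \<psi>. let o0 = rconst M (Src M \<psi>) 0 in tapp \<psi> (point3 o0 o0 o0))"

definition at_time :: "'o \<Rightarrow> 'a \<Rightarrow> 'a \<Rightarrow> 'a" where
  "at_time X Q t = dabs X (\<lambda>x \<psi>. dapp Q (t \<cdot> x) \<psi>)"

text \<open>The function from the line to distributions given by a term in a time variable.\<close>

definition tfun :: "('o \<Rightarrow> 'a \<Rightarrow> 'a) \<Rightarrow> 'a" where
  "tfun F = F (line M) (Idt M (line M))"

definition time_derivative :: "'a \<Rightarrow> 'a \<Rightarrow> bool" where
  "time_derivative Q Q' \<longleftrightarrow> Q' \<in> distributions (line M) \<and>
     (\<forall>X\<in>Obj M. \<forall>t\<in>Hom M X (line M). \<forall>d\<in>infinitesimals M X.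
        at_time X Q (t \<oplus> d) = dadd X (at_time X Q t) (dscale X d (at_time X Q' t)))"

text \<open>By the Kock-Lawvere axiom a function has at most one time derivative, so the existential
  quantifiers below only name the first and second derivatives of \<open>Q\<close>.\<close>

definition solves_wave_equation :: "'a \<Rightarrow> bool" where
  "solves_wave_equation Q \<longleftrightarrow> Q \<in> distributions (line M) \<and>
     (\<exists>Q1 Q2. time_derivative Q Q1 \<and> time_derivative Q1 Q2 \<and>
        (\<forall>X\<in>Obj M. \<forall>t\<in>Hom M X (line M). at_time X Q2 t = dlaplace X (at_time X Q t)))"

definition has_initial_value :: "'a \<Rightarrow> 'a \<Rightarrow> bool" where
  "has_initial_value Q \<mu> \<longleftrightarrow> at_time (Pt M) Q (rconst M (Pt M) 0) = \<mu>"

definition has_initial_speed :: "'a \<Rightarrow> 'a \<Rightarrow> bool" where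
  "has_initial_speed Q \<mu> \<longleftrightarrow>
     (\<exists>Q1. time_derivative Q Q1 \<and> at_time (Pt M) Q1 (rconst M (Pt M) 0) = \<mu>)"

definition spherical :: "'a \<Rightarrow> 'a \<Rightarrow> 'a \<Rightarrow> 'a" where
  "spherical r \<theta> \<phi> = point3 (r \<otimes> rcos M \<theta> \<otimes> rsin M \<phi>) (r \<otimes> rsin M \<theta> \<otimes> rsin M \<phi>) (r \<otimes> rcos M \<phi>)"

definition sphere_dist :: "'o \<Rightarrow> 'a \<Rightarrow> 'a" where
  "sphere_dist X t = dabs X (\<lambda>x \<psi>. let Y = Src M \<psi> in
     integral_op M Y (rconst M Y 0) (rconst M Y pi) (\<lambda>y \<phi>. let Z = Src M \<phi> in
       integral_op M Z (rconst M Z 0) (rconst M Z (2 * pi)) (\<lambda>z \<theta>.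
         tapp (\<psi> \<cdot> y \<cdot> z) (spherical (t \<cdot> x \<cdot> y \<cdot> z) \<theta> (\<phi> \<cdot> z)) \<otimes> rsin M (\<phi> \<cdot> z))))"

definition ball_dist :: "'o \<Rightarrow> 'a \<Rightarrow> 'a" where
  "ball_dist X t = dabs X (\<lambda>x \<psi>. let W = Src M \<psi> in
     integral_op M W (rconst M W 0) (rconst M W 1) (\<lambda>w s. let Y = Src M s in
       integral_op M Y (rconst M Y 0) (rconst M Y pi) (\<lambda>y \<phi>. let Z = Src M \<phi> in
         integral_op M Z (rconst M Z 0) (rconst M Z (2 * pi)) (\<lambda>z \<theta>.
           tapp (\<psi> \<cdot> w \<cdot> y \<cdot> z)
                (spherical ((t \<cdot> x \<cdot> w \<cdot> y \<cdot> z) \<otimes> (s \<cdot> y \<cdot> z)) \<theta> (\<phi> \<cdot> z))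
             \<otimes> ((s \<cdot> y \<cdot> z) \<otimes> (s \<cdot> y \<cdot> z)) \<otimes> rsin M (\<phi> \<cdot> z)))))"

end

end

theory Submission
  imports Defs
begin

text \<open>
  Fix a test function \<open>\<psi>\<close> and write \<open>S t\<close> for the value of the sphere distribution on it, so that
  \<open>S t\<close> integrates \<open>\<psi> (t u) sin \<phi>\<close> over the angles \<open>\<theta>\<close> and \<open>\<phi>\<close> of the unit vector \<open>u\<close>. Its derivatives
  \<open>S'\<close> and \<open>S''\<close> integrate the first and second derivative of \<open>\<psi>\<close> in the direction \<open>u\<close>. Everything
  rests on one equation (lemma \<open>sphere_laplace\<close>),

    \<open>2 S' t + t S'' t = t S\<^sub>\<Delta> t\<close>,

  where \<open>S\<^sub>\<Delta>\<close> belongs to \<open>\<Delta> \<psi>\<close> in place of \<open>\<psi>\<close>. It is the integrated form of the Laplace operator in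
  spherical coordinates: \<open>sin \<phi>\<close> times \<open>r \<Delta>\<psi> - 2 \<psi>\<^sub>u - r \<psi>\<^sub>u\<^sub>u\<close> is the sum of the \<open>\<phi>\<close>-derivative of
  \<open>sin \<phi> \<nabla>\<psi> \<cdot> e\<^sub>\<phi>\<close> and the \<open>\<theta>\<close>-derivative of \<open>\<nabla>\<psi> \<cdot> e\<^sub>\<theta>\<close> (lemma \<open>spherical_laplacian\<close>). The second term
  integrates to zero by periodicity in \<open>\<theta>\<close>, the first because \<open>sin \<phi>\<close> vanishes at both poles.

  The equation says that \<open>t S t\<close> has the derivative \<open>S t + t S' t\<close> and that this one has the derivative
  \<open>t S\<^sub>\<Delta> t\<close>. Hence \<open>t S\<close> solves the wave equation. So does its time derivative, because \<open>\<Delta>\<close> is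
  applied to the test function and does not interfere with \<open>t\<close>. The ball only serves to
  express \<open>S'\<close>: by the same equation \<open>s\<^sup>2 S' (t s)\<close> has the \<open>s\<close>-derivative \<open>t s\<^sup>2 S\<^sub>\<Delta> (t s)\<close>, and
  integration from \<open>0\<close> to \<open>1\<close> gives \<open>S' t = t B\<^sub>\<Delta> t\<close> (lemma \<open>sphere_slope_ball\<close>). The initial values come
  from \<open>S 0 = 4 \<pi> \<psi> 0\<close>.

  The statement is about all stages of the topos at once, and the argument above is carried out
  stage by stage, for arbitrary elements and with all operations commuting with restriction. Three
  ingredients make the classical computation available there.

  Ring and trigonometric identities on the line are inherited from the real numbers: the line is the
  image of the real line under a functor that preserves finite products of Euclidean spaces, since
  these are transversal pullbacks over a point (lemma \<open>smooth_op_compose\<close>). That \<open>cos d = 1\<close> and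
  \<open>sin d = d\<close> when \<open>d\<^sup>2 = 0\<close> is inherited as well, from \<open>f d = f 0 + f' 0 d + d\<^sup>2 k d\<close> with \<open>k\<close>
  entire (lemma \<open>trig_infinitesimal\<close>).

  The Kock-Lawvere axiom gives existence and uniqueness of partial derivatives of test functions,
  and with it their naturality and linearity and the chain rule.

  The integration axiom gives the fundamental theorem of calculus (lemma \<open>integ_eq\<close>), from which
  naturality and linearity of the integral follow by exhibiting antiderivatives. Differentiation
  under the integral sign is then nothing but linearity, because a function of \<open>t + d\<close> is an exact
  affine function of \<open>d\<close>.
\<close>

section \<open>A class of smooth functions on Euclidean spaces\<close>

text \<open>The coefficients of a power series that converges on the whole real line.\<close>

definition entire :: "(nat \<Rightarrow> real) \<Rightarrow> bool" where
  "entire c \<longleftrightarrow> (\<forall>x. summable (\<lambda>n. c n * x ^ n))"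

text \<open>A class of smooth functions that is closed under partial derivatives by its very form, and yet
  large enough for the second-order Taylor remainders of sine and cosine. Membership thus replaces
  the differentiation of compositions of arbitrary smooth functions.\<close>

inductive elementary :: "(vec \<Rightarrow> real) \<Rightarrow> bool" where
  elementary_const: "elementary (\<lambda>v. c)"
| elementary_var: "elementary (\<lambda>v. v k)"
| elementary_add: "elementary f \<Longrightarrow> elementary g \<Longrightarrow> elementary (\<lambda>v. f v + g v)"
| elementary_mult: "elementary f \<Longrightarrow> elementary g \<Longrightarrow> elementary (\<lambda>v. f v * g v)"
| elementary_series: "entire c \<Longrightarrow> elementary f \<Longrightarrow> elementary (\<lambda>v. \<Sum>n. c n * f v ^ n)"

lemma entire_diffs: "entire c \<Longrightarrow> entire (diffs c)"
  unfolding entire_def using termdiff_converges_all by blast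

lemma entire_sin_coeff: "entire sin_coeff" and entire_cos_coeff: "entire cos_coeff"
  unfolding entire_def using summable_norm_sin[THEN summable_norm_cancel]
    summable_norm_cos[THEN summable_norm_cancel] by (auto simp flip: real_scaleR_def)

lemma sin_series: "sin x = (\<Sum>n. sin_coeff n * x ^ n)" for x :: real
  by (simp add: sin_def)

lemma cos_series: "cos x = (\<Sum>n. cos_coeff n * x ^ n)" for x :: real
  by (simp add: cos_def)

lemma elementary_sin: "elementary f \<Longrightarrow> elementary (\<lambda>v. sin (f v))"
  using elementary_series[OF entire_sin_coeff] by (simp add: sin_series)

lemma elementary_cos: "elementary f \<Longrightarrow> elementary (\<lambda>v. cos (f v))"
  using elementary_series[OF entire_cos_coeff] by (simp add: cos_series)

lemma elementary_uminus: "elementary f \<Longrightarrow> elementary (\<lambda>v. - f v)"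
  using elementary_mult[OF elementary_const[of "-1"]] by simp

lemma elementary_diff: "elementary f \<Longrightarrow> elementary g \<Longrightarrow> elementary (\<lambda>v. f v - g v)"
  using elementary_add[OF _ elementary_uminus] by fastforce

lemmas elementary_intros = elementary_const elementary_var elementary_add elementary_mult
  elementary_series elementary_sin elementary_cos elementary_uminus elementary_diff

lemma elementary_continuous: "elementary f \<Longrightarrow> continuous_on U f"
proof (induction rule: elementary.induct)
  case (elementary_var k)
  show ?case by (rule continuous_on_product_coordinates[THEN continuous_on_subset]) simp
next
  case (elementary_series c f)
  have "isCont (\<lambda>x. \<Sum>n. c n * x ^ n) y" for y
    by (rule DERIV_isCont[OF termdiffs_strong_converges_everywhere])
       (use elementary_series in \<open>simp add: entire_def\<close>)
  then have "continuous_on UNIV (\<lambda>x. \<Sum>n. c n * x ^ n)"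
    by (simp add: continuous_on_eq_continuous_at)
  from continuous_on_compose2[OF this elementary_series.IH] show ?case by simp
qed (auto intro: continuous_intros)

text \<open>Entire series are differentiated term by term, and the derived series is again entire; this is
  the only case that is not a rule of elementary calculus.\<close>

lemma elementary_partial:
  "elementary f \<Longrightarrow> \<exists>h. elementary h \<and> (\<forall>x. ((\<lambda>s. f (x(i := s))) has_real_derivative h x) (at (x i)))"
proof (induction rule: elementary.induct)
  case (elementary_const c)
  show ?case by (rule exI[of _ "\<lambda>_. 0"]) (auto intro: elementary_intros)
next
  case (elementary_var k)
  show ?case
    by (rule exI[of _ "\<lambda>_. if k = i then 1 else 0"]) (auto intro: elementary_intros)
next
  case (elementary_add f g)
  then obtain f' g' where "elementary f'" "elementary g'"
    "\<forall>x. ((\<lambda>s. f (x(i := s))) has_real_derivative f' x) (at (x i))"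
    "\<forall>x. ((\<lambda>s. g (x(i := s))) has_real_derivative g' x) (at (x i))" by blast
  then show ?case
    by (intro exI[of _ "\<lambda>v. f' v + g' v"]) (intro conjI allI elementary_intros DERIV_add; blast)
next
  case (elementary_mult f g)
  then obtain f' g' where "elementary f'" "elementary g'"
    "\<forall>x. ((\<lambda>s. f (x(i := s))) has_real_derivative f' x) (at (x i))"
    "\<forall>x. ((\<lambda>s. g (x(i := s))) has_real_derivative g' x) (at (x i))" by blast
  then have "((\<lambda>s. f (x(i := s)) * g (x(i := s))) has_real_derivative f' x * g x + g' x * f x)
      (at (x i))" for x
    using DERIV_mult[of "\<lambda>s. f (x(i := s))" "f' x" "x i" UNIV "\<lambda>s. g (x(i := s))" "g' x"] by simp
  with \<open>elementary f'\<close> \<open>elementary g'\<close> elementary_mult.hyps show ?case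
    by (intro exI[of _ "\<lambda>v. f' v * g v + g' v * f v"] conjI allI elementary_intros) assumption+
next
  case (elementary_series c f)
  then obtain f' where f': "elementary f'"
    "\<forall>x. ((\<lambda>s. f (x(i := s))) has_real_derivative f' x) (at (x i))" by blast
  have D: "((\<lambda>x. \<Sum>n. c n * x ^ n) has_real_derivative (\<Sum>n. diffs c n * y ^ n)) (at y)" for y
    by (rule termdiffs_strong_converges_everywhere)
       (use elementary_series in \<open>simp add: entire_def\<close>)
  have "((\<lambda>s. \<Sum>n. c n * f (x(i := s)) ^ n) has_real_derivative (\<Sum>n. diffs c n * f x ^ n) * f' x)
      (at (x i))" for x
    using DERIV_chain2[OF D, of "\<lambda>s. f (x(i := s))" "f' x" "x i"] f'(2) by simp
  then show ?case
    by (intro exI[of _ "\<lambda>v. (\<Sum>n. diffs c n * f v ^ n) * f' v"] conjI allI elementary_intros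
        entire_diffs f'(1) elementary_series.hyps)
qed

text \<open>The whole class serves as the set of functions closed under partial derivatives.\<close>

lemma elementary_smooth_on: "elementary f \<Longrightarrow> smooth_on n U f"
  unfolding smooth_on_def
  by (rule exI[of _ "Collect elementary"]) (use elementary_continuous elementary_partial in blast)

lemma entire_shift: "entire c \<Longrightarrow> entire (\<lambda>n. c (n + k))"
proof -
  assume c: "entire c"
  have "summable (\<lambda>n. c (n + k) * x ^ n)" for x
  proof (cases "x = 0")
    case True
    then show ?thesis
      using summable_finite[of "{0}" "\<lambda>n. c (n + k) * x ^ n"] by simp
  next
    case False
    have "summable (\<lambda>n. c (n + k) * x ^ (n + k))"
      using c summable_ignore_initial_segment[of "\<lambda>n. c n * x ^ n"] by (simp add: entire_def)
    then have "summable (\<lambda>n. inverse (x ^ k) * (c (n + k) * x ^ (n + k)))"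
      by (rule summable_mult)
    with False show ?thesis by (simp add: power_add field_simps)
  qed
  then show ?thesis by (simp add: entire_def)
qed

text \<open>Since the remainder is \<open>x\<^sup>2\<close> times an entire function, it dies on elements of square zero.\<close>

lemma series_second_order:
  assumes "entire c"
  shows "(\<Sum>n. c n * x ^ n) = c 0 + c 1 * x + x * x * (\<Sum>n. c (n + 2) * x ^ n)"
proof -
  have "summable (\<lambda>n. c (n + 2) * x ^ n)" using entire_shift[OF assms, of 2] by (simp add: entire_def)
  then have "x * x * (\<Sum>n. c (n + 2) * x ^ n) = (\<Sum>n. c (n + 2) * x ^ (n + 2))"
    by (subst suminf_mult[symmetric]) (auto simp: power2_eq_square power_add algebra_simps)
  moreover have "(\<Sum>n. c n * x ^ n) = (\<Sum>n. c (n + 2) * x ^ (n + 2)) + (\<Sum>n<2. c n * x ^ n)"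
    by (rule suminf_split_initial_segment) (use assms in \<open>simp add: entire_def\<close>)
  ultimately show ?thesis by (simp add: numeral_2_eq_2)
qed


section \<open>Euclidean spaces as products\<close>

lemma smooth_map_elementary:
  assumes "\<And>j. elementary (\<lambda>v. f v j)" "f ` eucl n \<subseteq> eucl m"
  shows "smooth_map (eucl n) (eucl m) f"
  unfolding smooth_map_def using assms
  by (intro conjI exI[of _ n] ballI exI[of _ "eucl n"] exI[of _ f])
     (auto intro: elementary_smooth_on)

lemma smooth_map_cong:
  "smooth_map A B f \<Longrightarrow> (\<And>x. x \<in> A \<Longrightarrow> f x = g x) \<Longrightarrow> smooth_map A B g"
  unfolding smooth_map_def by (simp cong: image_cong)

lemma eucl_manifold: "is_manifold (eucl n)"
proof -
  have "smooth_map (eucl n) (eucl n) (\<lambda>x. x)"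
    by (rule smooth_map_elementary) (auto intro: elementary_intros)
  then show ?thesis
    unfolding is_manifold_def
    by (intro exI[of _ n] exI[of _ n] conjI ballI exI[of _ "eucl n"] exI[of _ "\<lambda>x. x"]) auto
qed

lemma mfmap_Hom:
  "is_manifold A \<Longrightarrow> is_manifold B \<Longrightarrow> smooth_map A B f \<Longrightarrow> mfmap A B f \<in> Hom Mf A B"
  by (auto simp: Hom_def Mf_def mfmap_def intro: smooth_map_cong)

lemma mfmap_elementary_Hom:
  "(\<And>j. elementary (\<lambda>v. f v j)) \<Longrightarrow> f ` eucl n \<subseteq> eucl m \<Longrightarrow> mfmap (eucl n) (eucl m) f \<in> Hom Mf (eucl n) (eucl m)"
  by (intro mfmap_Hom eucl_manifold smooth_map_elementary) auto

lemma mfmap_cong: "(\<And>x. x \<in> A \<Longrightarrow> f x = g x) \<Longrightarrow> mfmap A B f = mfmap A B g"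
  by (auto simp: mfmap_def)

lemma mfmap_Cmp: "f ` A \<subseteq> B \<Longrightarrow> mfmap B C g \<cdot>\<^bsub>Mf\<^esub> mfmap A B f = mfmap A C (\<lambda>x. g (f x))"
  by (auto simp: Mf_def mfmap_def restrict_def fun_eq_iff image_subset_iff)

definition trunc :: "nat \<Rightarrow> vec \<Rightarrow> vec" where
  "trunc n v = (\<lambda>j. if j < n then v j else 0)"

lemma trunc_eucl: "trunc n v \<in> eucl n"
  by (simp add: trunc_def eucl_def)

lemma trunc_id: "v \<in> eucl n \<Longrightarrow> trunc n v = v"
  by (auto simp: trunc_def eucl_def)

lemma sc_eucl: "sc c \<in> eucl 1"
  by (simp add: sc_def eucl_def)

lemma eucl1_sc: "v \<in> eucl 1 \<Longrightarrow> sc (v 0) = v"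
  by (auto simp: sc_def eucl_def)

lemma elementary_trunc: "elementary (\<lambda>v. trunc n v j)"
  by (cases "j < n") (auto simp: trunc_def intro: elementary_intros)

lemma elementary_sc: "elementary f \<Longrightarrow> elementary (\<lambda>v. sc (f v) j)"
  by (cases "j = 0") (auto simp: sc_def intro: elementary_intros)

lemma continuous_trunc: "continuous_on S (trunc n)"
proof (rule continuous_on_coordinatewise_then_product)
  fix i show "continuous_on S (\<lambda>x. trunc n x i)"
    by (rule elementary_continuous[OF elementary_trunc])
qed

lemma smooth_on_subset: "smooth_on n U f \<Longrightarrow> V \<subseteq> U \<Longrightarrow> smooth_on n V f"
  unfolding smooth_on_def by (meson continuous_on_subset subsetD)

text \<open>For the directions that \<open>trunc n\<close> forgets, the derivative is zero; this is why the zero function is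
  adjoined to the set of iterated derivatives.\<close>

lemma smooth_on_trunc:
  assumes "smooth_on n U f"
  shows "smooth_on m {x. trunc n x \<in> U} (\<lambda>x. f (trunc n x))"
proof -
  from assms obtain F where F: "f \<in> F"
    and cont: "\<And>g. g \<in> F \<Longrightarrow> continuous_on U g"
    and der: "\<And>g i. g \<in> F \<Longrightarrow> i < n \<Longrightarrow>
      \<exists>h\<in>F. \<forall>x\<in>U. ((\<lambda>s. g (x(i := s))) has_real_derivative h x) (at (x i))"
    unfolding smooth_on_def by blast
  let ?F = "insert (\<lambda>_. 0) ((\<lambda>g x. g (trunc n x)) ` F)"
  let ?U = "{x. trunc n x \<in> U}"
  have "continuous_on ?U g" if "g \<in> ?F" for g
    using that
  proof (elim insertE imageE)
    fix k assume "g = (\<lambda>x. k (trunc n x))" "k \<in> F"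
    then show ?thesis
      using continuous_on_compose2[OF cont continuous_trunc[of ?U n]] by auto
  qed simp
  moreover have "\<exists>h\<in>?F. \<forall>x\<in>?U. ((\<lambda>s. g (x(i := s))) has_real_derivative h x) (at (x i))"
    if "g \<in> ?F" for g i
    using that
  proof (elim insertE imageE)
    fix k assume k: "g = (\<lambda>x. k (trunc n x))" "k \<in> F"
    show ?thesis
    proof (cases "i < n")
      case True
      from der[OF k(2) True] obtain h where h: "h \<in> F"
        "\<And>x. x \<in> U \<Longrightarrow> ((\<lambda>s. k (x(i := s))) has_real_derivative h x) (at (x i))" by blast
      have "trunc n (x(i := s)) = (trunc n x)(i := s)" "trunc n x i = x i" for x s
        using True by (auto simp: trunc_def)
      with h(2) have "((\<lambda>s. g (x(i := s))) has_real_derivative h (trunc n x)) (at (x i))"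
        if "x \<in> ?U" for x
        using that k(1) h(2)[of "trunc n x"] by simp
      with h(1) show ?thesis by auto
    next
      case False
      then have "trunc n (x(i := s)) = trunc n x" for x s by (auto simp: trunc_def)
      with k(1) show ?thesis by (auto intro!: bexI[of _ "\<lambda>_. 0"])
    qed
  qed (auto intro!: bexI[of _ "\<lambda>_. 0"])
  ultimately show ?thesis
    unfolding smooth_on_def using F by (intro exI[of _ ?F]) blast
qed

text \<open>The ambient dimension in the definition of smoothness may be enlarged, by precomposing the local
  extensions with the truncation.\<close>

lemma smooth_map_ambient:
  assumes "smooth_map A B f"
  shows "\<exists>n. \<forall>m\<ge>n. A \<subseteq> eucl m \<and> (\<forall>p\<in>A. \<exists>U g. p \<in> U \<and> openin (top_of_set (eucl m)) U \<and>
           (\<forall>j. smooth_on m U (\<lambda>x. g x j)) \<and> (\<forall>x\<in>U \<inter> A. g x = f x))"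
proof -
  from assms obtain n where n: "A \<subseteq> eucl n"
    and loc: "\<And>p. p \<in> A \<Longrightarrow> \<exists>U g. p \<in> U \<and> openin (top_of_set (eucl n)) U \<and>
           (\<forall>j. smooth_on n U (\<lambda>x. g x j)) \<and> (\<forall>x\<in>U \<inter> A. g x = f x)"
    unfolding smooth_map_def by blast
  have "\<exists>U g. p \<in> U \<and> openin (top_of_set (eucl m)) U \<and>
           (\<forall>j. smooth_on m U (\<lambda>x. g x j)) \<and> (\<forall>x\<in>U \<inter> A. g x = f x)"
    if m: "m \<ge> n" and p: "p \<in> A" for m p
  proof -
    from loc[OF p] obtain U g where U: "p \<in> U" "openin (top_of_set (eucl n)) U"
      "\<And>j. smooth_on n U (\<lambda>x. g x j)" "\<And>x. x \<in> U \<inter> A \<Longrightarrow> g x = f x" by blast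
    let ?V = "eucl m \<inter> trunc n -` U"
    have "openin (top_of_set (eucl m)) ?V"
      by (rule continuous_openin_preimage[OF continuous_trunc _ U(2)]) (auto simp: trunc_eucl)
    moreover have "p \<in> ?V"
      using n m p U(1) trunc_id[of p n] by (auto simp: eucl_def)
    moreover have "smooth_on m ?V (\<lambda>x. g (trunc n x) j)" for j
      using smooth_on_trunc[OF U(3)] by (rule smooth_on_subset) auto
    moreover have "g (trunc n x) = f x" if "x \<in> ?V \<inter> A" for x
      using U(4)[of x] that n trunc_id[of x n] by auto
    ultimately show ?thesis
      by (intro exI[of _ ?V] exI[of _ "\<lambda>x. g (trunc n x)"]) blast
  qed
  moreover have "A \<subseteq> eucl m" if "m \<ge> n" for m
    using n that by (force simp: eucl_def)
  ultimately show ?thesis by blast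
qed

text \<open>The two local extensions may live in different ambient dimensions; both are first moved into a
  common one.\<close>

lemma smooth_map_pair:
  assumes u: "smooth_map A (eucl n) u" and w: "smooth_map A (eucl 1) w"
  shows "smooth_map A (eucl (Suc n)) (\<lambda>x j. if j = n then w x 0 else u x j)"
proof -
  let ?h = "\<lambda>(u :: vec \<Rightarrow> vec) (w :: vec \<Rightarrow> vec) x j. if j = n then w x 0 else u x j"
  from smooth_map_ambient[OF u] smooth_map_ambient[OF w] obtain m where m: "A \<subseteq> eucl m"
    and lu: "\<And>p. p \<in> A \<Longrightarrow> \<exists>U g. p \<in> U \<and> openin (top_of_set (eucl m)) U \<and>
           (\<forall>j. smooth_on m U (\<lambda>x. g x j)) \<and> (\<forall>x\<in>U \<inter> A. g x = u x)"
    and lw: "\<And>p. p \<in> A \<Longrightarrow> \<exists>U g. p \<in> U \<and> openin (top_of_set (eucl m)) U \<and>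
           (\<forall>j. smooth_on m U (\<lambda>x. g x j)) \<and> (\<forall>x\<in>U \<inter> A. g x = w x)"
    by (metis nle_le)
  have "\<exists>U g. p \<in> U \<and> openin (top_of_set (eucl m)) U \<and>
           (\<forall>j. smooth_on m U (\<lambda>x. g x j)) \<and> (\<forall>x\<in>U \<inter> A. g x = ?h u w x)" if p: "p \<in> A" for p
  proof -
    from lu[OF p] obtain U g where U: "p \<in> U" "openin (top_of_set (eucl m)) U"
      "\<And>j. smooth_on m U (\<lambda>x. g x j)" "\<And>x. x \<in> U \<inter> A \<Longrightarrow> g x = u x" by blast
    from lw[OF p] obtain V k where V: "p \<in> V" "openin (top_of_set (eucl m)) V"
      "\<And>j. smooth_on m V (\<lambda>x. k x j)" "\<And>x. x \<in> V \<inter> A \<Longrightarrow> k x = w x" by blast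
    have "smooth_on m (U \<inter> V) (\<lambda>x. ?h g k x j)" for j
      using smooth_on_subset[OF U(3)] smooth_on_subset[OF V(3)] by (cases "j = n") auto
    with U V openin_Int[OF U(2) V(2)] show ?thesis
      by (intro exI[of _ "U \<inter> V"] exI[of _ "?h g k"]) (auto intro!: ext)
  qed
  moreover have "?h u w ` A \<subseteq> eucl (Suc n)"
    using u unfolding smooth_map_def eucl_def by auto
  ultimately show ?thesis
    unfolding smooth_map_def using m by blast
qed

definition to_point :: "nat \<Rightarrow> mfarr" where
  "to_point n = mfmap (eucl n) (eucl 0) (\<lambda>_ _. 0)"

definition first_coords :: "nat \<Rightarrow> mfarr" where
  "first_coords n = mfmap (eucl (Suc n)) (eucl n) (trunc n)"

definition coord :: "nat \<Rightarrow> nat \<Rightarrow> mfarr" where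
  "coord n k = mfmap (eucl n) (eucl 1) (\<lambda>v. sc (v k))"

lemma to_point_Hom: "to_point n \<in> Hom Mf (eucl n) (eucl 0)"
  unfolding to_point_def by (rule mfmap_elementary_Hom) (auto simp: eucl_def intro: elementary_intros)

lemma first_coords_Hom: "first_coords n \<in> Hom Mf (eucl (Suc n)) (eucl n)"
  unfolding first_coords_def by (rule mfmap_elementary_Hom) (auto simp: trunc_eucl elementary_trunc)

lemma coord_Hom: "coord n k \<in> Hom Mf (eucl n) (eucl 1)"
  unfolding coord_def
  by (rule mfmap_elementary_Hom) (use sc_eucl in \<open>auto intro: elementary_sc elementary_intros\<close>)

text \<open>A product is a pullback over the one-point space \<open>eucl 0\<close>. In this form the functor into the topos
  is known to respect it.\<close>

lemma eucl_Suc_pullback: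
  "is_pullback Mf (first_coords n) (coord (Suc n) n) (to_point n) (to_point 1)"
proof -
  have "\<exists>!h. h \<in> Hom Mf (Src Mf u) (eucl (Suc n)) \<and> first_coords n \<cdot>\<^bsub>Mf\<^esub> h = u \<and>
         coord (Suc n) n \<cdot>\<^bsub>Mf\<^esub> h = v"
    if uv: "u \<in> Arr Mf" "v \<in> Arr Mf" "Src Mf u = Src Mf v" "Tgt Mf u = eucl n" "Tgt Mf v = eucl 1"
    for u v
  proof -
    from uv obtain A u0 v0 where u: "u = (A, eucl n, u0)" and v: "v = (A, eucl 1, v0)"
      by (cases u; cases v) (auto simp: Mf_def)
    from uv u v have A: "is_manifold A" and su: "smooth_map A (eucl n) u0" "u0 \<in> extensional A"
      and sv: "smooth_map A (eucl 1) v0" "v0 \<in> extensional A" by (auto simp: Mf_def)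
    let ?h = "\<lambda>x j. if j = n then v0 x 0 else u0 x j"
    have im: "?h ` A \<subseteq> eucl (Suc n)" "u0 ` A \<subseteq> eucl n" "v0 ` A \<subseteq> eucl 1"
      using smooth_map_pair[OF su(1) sv(1)] su sv unfolding smooth_map_def by auto
    have hu: "trunc n (?h x) = u0 x" if "x \<in> A" for x
    proof -
      have "trunc n (u0 x) = u0 x" using im(2) that trunc_id by blast
      then show ?thesis by (simp add: trunc_def cong: if_cong)
    qed
    have hv: "sc (?h x n) = v0 x" if "x \<in> A" for x
      using im(3) that eucl1_sc[of "v0 x"] by auto
    show ?thesis
    proof (rule ex1I[of _ "mfmap A (eucl (Suc n)) ?h"], intro conjI)
      show "mfmap A (eucl (Suc n)) ?h \<in> Hom Mf (Src Mf u) (eucl (Suc n))"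
        using mfmap_Hom[OF A eucl_manifold smooth_map_pair[OF su(1) sv(1)]] u by (simp add: Mf_def)
      have "mfmap A (eucl n) (\<lambda>x. trunc n (?h x)) = mfmap A (eucl n) u0"
        by (rule mfmap_cong) (rule hu)
      then show "first_coords n \<cdot>\<^bsub>Mf\<^esub> mfmap A (eucl (Suc n)) ?h = u"
        unfolding first_coords_def mfmap_Cmp[OF im(1)] u
        using su(2) by (simp add: mfmap_def extensional_restrict)
      have "mfmap A (eucl 1) (\<lambda>x. sc (?h x n)) = mfmap A (eucl 1) v0"
        by (rule mfmap_cong) (rule hv)
      then show "coord (Suc n) n \<cdot>\<^bsub>Mf\<^esub> mfmap A (eucl (Suc n)) ?h = v"
        unfolding coord_def mfmap_Cmp[OF im(1)] v
        using sv(2) by (simp add: mfmap_def extensional_restrict)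
    next
      fix k assume k: "k \<in> Hom Mf (Src Mf u) (eucl (Suc n)) \<and> first_coords n \<cdot>\<^bsub>Mf\<^esub> k = u \<and>
         coord (Suc n) n \<cdot>\<^bsub>Mf\<^esub> k = v"
      then obtain k0 where k0: "k = (A, eucl (Suc n), k0)" "smooth_map A (eucl (Suc n)) k0"
        "k0 \<in> extensional A"
        using u by (cases k) (auto simp: Hom_def Mf_def)
      have imk: "k0 ` A \<subseteq> eucl (Suc n)" using k0(2) unfolding smooth_map_def by blast
      have km: "k = mfmap A (eucl (Suc n)) k0"
        using k0 by (simp add: mfmap_def extensional_restrict)
      have "u = mfmap A (eucl n) (\<lambda>x. trunc n (k0 x))" "v = mfmap A (eucl 1) (\<lambda>x. sc (k0 x n))"
        using k unfolding km first_coords_def coord_def mfmap_Cmp[OF imk] by auto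
      then have e: "u0 x = trunc n (k0 x)" "v0 x = sc (k0 x n)" if "x \<in> A" for x
        using that unfolding u v mfmap_def by (auto simp: restrict_def)
      have "k0 x = ?h x" if "x \<in> A" for x
      proof
        fix j
        have "k0 x \<in> eucl (Suc n)" using imk that by blast
        then show "k0 x j = ?h x j"
          using e[OF that] by (auto simp: trunc_def sc_def eucl_def)
      qed
      then show "k = mfmap A (eucl (Suc n)) ?h"
        unfolding km by (rule mfmap_cong)
    qed
  qed
  moreover have "to_point n \<cdot>\<^bsub>Mf\<^esub> first_coords n = to_point 1 \<cdot>\<^bsub>Mf\<^esub> coord (Suc n) n"
    unfolding to_point_def first_coords_def coord_def
    by (subst (1 2) mfmap_Cmp) (use trunc_eucl sc_eucl in auto)
  ultimately show ?thesis
    unfolding is_pullback_def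
    using to_point_Hom[of n] to_point_Hom[of 1] first_coords_Hom[of n] coord_Hom[of "Suc n" n]
    by (auto simp: Hom_def)
qed

text \<open>The only tangent vector of a point is zero, so constant curves decompose it.\<close>

lemma to_point_transversal: "transversal (to_point n) (to_point m)"
proof -
  have eucl0: "v = (\<lambda>_. 0)" if "v \<in> eucl 0" for v using that by (auto simp: eucl_def)
  have const: "smooth_curve (eucl k) (\<lambda>_. x)" if "x \<in> eucl k" for k x
    unfolding smooth_curve_def
    using that by (intro smooth_map_elementary) (auto intro: elementary_intros)
  have w0: "w = (\<lambda>_. 0)" if "smooth_curve (eucl 0) c" "velocity c w" for c w
  proof
    fix i
    have "c (z 0) \<in> eucl 0" if "z \<in> eucl 1" for z
      using \<open>smooth_curve (eucl 0) c\<close> that unfolding smooth_curve_def smooth_map_def by blast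
    from this[OF sc_eucl] have "c s = (\<lambda>_. 0)" for s using eucl0 by (simp add: sc_def)
    then have "((\<lambda>s. c s i) has_real_derivative 0) (at 0)" by simp
    with that(2) show "w i = 0" unfolding velocity_def using DERIV_unique by blast
  qed
  show ?thesis
    unfolding transversal_def to_point_def mfmap_def split
  proof (intro ballI allI impI, elim conjE)
    fix x y c w
    assume x: "x \<in> eucl n" and y: "y \<in> eucl m"
      and c: "smooth_curve (eucl 0) c" "velocity c w"
    show "\<exists>a b u v. smooth_curve (eucl n) a \<and> a 0 = x \<and>
        velocity ((\<lambda>_\<in>eucl n. \<lambda>_. 0) \<circ> a) u \<and> smooth_curve (eucl m) b \<and> b 0 = y \<and>
        velocity ((\<lambda>_\<in>eucl m. \<lambda>_. 0) \<circ> b) v \<and> w = (\<lambda>i. u i + v i)"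
      using const[OF x] const[OF y] w0[OF c]
      by (intro exI[of _ "\<lambda>_. x"] exI[of _ "\<lambda>_. y"] exI[of _ "\<lambda>_. 0"] exI[of _ "\<lambda>_. 0"])
         (auto simp: velocity_def)
  qed
qed


section \<open>Products and exponentials in the topos\<close>

context elementary_topos
begin

lemma Hom_iff: "f \<in> Hom E X Y \<longleftrightarrow> f \<in> Arr E \<and> Src E f = X \<and> Tgt E f = Y"
  by (auto simp: Hom_def)

text \<open>Typing is phrased through equations for source and target, not through hom-sets: the side
  conditions of all rewrite rules below then mention no object outside the rewritten term, and
  the simplifier evaluates them by computing sources and targets.\<close>

lemma cmp_simps [simp]:
  assumes "f \<in> Arr E" "g \<in> Arr E" "Tgt E f = Src E g"
  shows "g \<cdot> f \<in> Arr E" "Src E (g \<cdot> f) = Src E f" "Tgt E (g \<cdot> f) = Tgt E g"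
  using Cmp_Hom[of f "Src E f" "Src E g" g "Tgt E g"] assms by (auto simp: Hom_iff)

lemma assoc_simp [simp]:
  "f \<in> Arr E \<Longrightarrow> g \<in> Arr E \<Longrightarrow> h \<in> Arr E \<Longrightarrow> Tgt E f = Src E g \<Longrightarrow> Tgt E g = Src E h \<Longrightarrow>
    (h \<cdot> g) \<cdot> f = h \<cdot> (g \<cdot> f)"
  using Cmp_assoc[of f "Src E f" "Tgt E f" g "Tgt E g" h "Tgt E h"] by (simp add: Hom_iff)

lemma Idt_simps [simp]:
  assumes "X \<in> Obj E"
  shows "Idt E X \<in> Arr E" "Src E (Idt E X) = X" "Tgt E (Idt E X) = X"
  using Idt_Hom[OF assms] by (auto simp: Hom_iff)

lemma Idt_cmp [simp]: "f \<in> Arr E \<Longrightarrow> Tgt E f = X \<Longrightarrow> Idt E X \<cdot> f = f"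
  "f \<in> Arr E \<Longrightarrow> Src E f = X \<Longrightarrow> f \<cdot> Idt E X = f"
  using Idt_left[of f "Src E f" "Tgt E f"] Idt_right[of f "Src E f" "Tgt E f"] by (auto simp: Hom_iff)

lemma Src_Obj_simp [simp]: "f \<in> Arr E \<Longrightarrow> Src E f \<in> Obj E"
  and Tgt_Obj_simp [simp]: "f \<in> Arr E \<Longrightarrow> Tgt E f \<in> Obj E"
  by (rule Src_Obj Tgt_Obj; assumption)+

lemma Prd_simps [simp]:
  assumes "X \<in> Obj E" "Y \<in> Obj E"
  shows "Prd E X Y \<in> Obj E"
    "Pr1 E X Y \<in> Arr E" "Src E (Pr1 E X Y) = Prd E X Y" "Tgt E (Pr1 E X Y) = X"
    "Pr2 E X Y \<in> Arr E" "Src E (Pr2 E X Y) = Prd E X Y" "Tgt E (Pr2 E X Y) = Y"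
  using Prd_product[OF assms] by (auto simp: is_product_def Hom_iff)

lemma pair_unique:
  assumes "f \<in> Arr E" "g \<in> Arr E" "Src E g = Src E f" "Tgt E f = X" "Tgt E g = Y"
  shows "\<exists>!h. h \<in> Hom E (Src E f) (Prd E X Y) \<and> Pr1 E X Y \<cdot> h = f \<and> Pr2 E X Y \<cdot> h = g"
  using Prd_product[of X Y] assms unfolding is_product_def
  by (metis Hom_iff Src_Obj_simp Tgt_Obj_simp)

lemma pair_simps [simp]:
  assumes "f \<in> Arr E" "g \<in> Arr E" "Src E g = Src E f"
  shows "pair E f g \<in> Arr E" "Src E (pair E f g) = Src E f"
    "Tgt E (pair E f g) = Prd E (Tgt E f) (Tgt E g)"
  using theI'[OF pair_unique[OF assms refl refl]] by (auto simp: pair_def Hom_iff)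

lemma Pr_pair [simp]:
  assumes "f \<in> Arr E" "g \<in> Arr E" "Src E g = Src E f" "Tgt E f = X" "Tgt E g = Y"
  shows "Pr1 E X Y \<cdot> pair E f g = f" "Pr2 E X Y \<cdot> pair E f g = g"
  using theI'[OF pair_unique[OF assms(1-3) refl refl]] assms(4,5) by (auto simp: pair_def)

lemma prd_eqI:
  assumes "h \<in> Arr E" "k \<in> Arr E" "Src E k = Src E h" "Tgt E h = Prd E X Y" "Tgt E k = Prd E X Y"
    "X \<in> Obj E" "Y \<in> Obj E"
    "Pr1 E X Y \<cdot> h = Pr1 E X Y \<cdot> k" "Pr2 E X Y \<cdot> h = Pr2 E X Y \<cdot> k"
  shows "h = k"
  using pair_unique[of "Pr1 E X Y \<cdot> h" "Pr2 E X Y \<cdot> h" X Y] assms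
  by (auto simp: Hom_iff)

lemma pair_cmp [simp]:
  assumes "f \<in> Arr E" "g \<in> Arr E" "Src E g = Src E f" "z \<in> Arr E" "Tgt E z = Src E f"
  shows "pair E f g \<cdot> z = pair E (f \<cdot> z) (g \<cdot> z)"
proof (rule prd_eqI[of _ _ "Tgt E f" "Tgt E g"])
  have "(Pr1 E (Tgt E f) (Tgt E g) \<cdot> pair E f g) \<cdot> z = f \<cdot> z"
    "(Pr2 E (Tgt E f) (Tgt E g) \<cdot> pair E f g) \<cdot> z = g \<cdot> z"
    using assms by auto
  then show "Pr1 E (Tgt E f) (Tgt E g) \<cdot> pair E f g \<cdot> z = Pr1 E (Tgt E f) (Tgt E g) \<cdot> pair E (f \<cdot> z) (g \<cdot> z)"
    "Pr2 E (Tgt E f) (Tgt E g) \<cdot> pair E f g \<cdot> z = Pr2 E (Tgt E f) (Tgt E g) \<cdot> pair E (f \<cdot> z) (g \<cdot> z)"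
    using assms by (simp_all del: Pr_pair add: Pr_pair[of "f \<cdot> z" "g \<cdot> z"])
qed (use assms in auto)

lemma pair_eta [simp]:
  "h \<in> Arr E \<Longrightarrow> Tgt E h = Prd E X Y \<Longrightarrow> X \<in> Obj E \<Longrightarrow> Y \<in> Obj E \<Longrightarrow>
    pair E (Pr1 E X Y \<cdot> h) (Pr2 E X Y \<cdot> h) = h"
  by (rule prd_eqI[of _ _ X Y]) auto

lemma pair_Pr [simp]: "X \<in> Obj E \<Longrightarrow> Y \<in> Obj E \<Longrightarrow> pair E (Pr1 E X Y) (Pr2 E X Y) = Idt E (Prd E X Y)"
  by (rule prd_eqI[of _ _ X Y]) auto

lemma transpose_unique:
  assumes "f \<in> Arr E" "Src E f = Prd E X A" "Tgt E f = B" "X \<in> Obj E" "A \<in> Obj E"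
  shows "\<exists>!h. is_transpose E X A B f h"
  using ex1_transpose[of X A B f] assms by (auto simp: Hom_iff)

lemma Ev_simps [simp]:
  assumes "A \<in> Obj E" "B \<in> Obj E"
  shows "Expo E A B \<in> Obj E" "Ev E A B \<in> Arr E" "Src E (Ev E A B) = Prd E (Expo E A B) A"
    "Tgt E (Ev E A B) = B"
  using Expo_Obj[OF assms] Ev_Hom[OF assms] by (auto simp: Hom_iff)

end


section \<open>Smooth operations on the line\<close>

context well_adapted_model
begin

abbreviation R :: 'o where "R \<equiv> line M"

lemma \<iota>_simps:
  assumes "f \<in> Hom Mf A B"
  shows "\<iota>a M f \<in> Arr M" "Src M (\<iota>a M f) = \<iota>o M A" "Tgt M (\<iota>a M f) = \<iota>o M B"
proof -
  have "A \<in> Obj Mf" "B \<in> Obj Mf" using assms by (auto simp: Hom_def Mf_def)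
  then have "\<iota>a M f \<in> Hom M (\<iota>o M A) (\<iota>o M B)"
    using bij_betw_apply[OF \<iota>_full_faithful[of A B] assms] by blast
  then show "\<iota>a M f \<in> Arr M" "Src M (\<iota>a M f) = \<iota>o M A" "Tgt M (\<iota>a M f) = \<iota>o M B"
    by (auto simp: Hom_iff)
qed

lemma \<iota>_eucl [simp]: "\<iota>o M (eucl n) \<in> Obj M"
  by (rule \<iota>_Obj) (simp add: Mf_def eucl_manifold)

lemma R_eq: "R = \<iota>o M (eucl 1)" by (simp add: line_def)

lemma R_Obj [simp]: "R \<in> Obj M" by (simp add: line_def)

lemma \<iota>_coord [simp]:
  "\<iota>a M (coord n k) \<in> Arr M" "Src M (\<iota>a M (coord n k)) = \<iota>o M (eucl n)" "Tgt M (\<iota>a M (coord n k)) = R"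
  unfolding line_def by (rule \<iota>_simps[OF coord_Hom])+

lemma \<iota>_first_coords [simp]:
  "\<iota>a M (first_coords n) \<in> Arr M" "Src M (\<iota>a M (first_coords n)) = \<iota>o M (eucl (Suc n))"
  "Tgt M (\<iota>a M (first_coords n)) = \<iota>o M (eucl n)"
  by (rule \<iota>_simps[OF first_coords_Hom])+

lemma \<iota>_to_point [simp]:
  "\<iota>a M (to_point n) \<in> Arr M" "Src M (\<iota>a M (to_point n)) = \<iota>o M (eucl n)"
  "Tgt M (\<iota>a M (to_point n)) = \<iota>o M (eucl 0)"
  by (rule \<iota>_simps[OF to_point_Hom])+

lemma point_eq:
  "u \<in> Arr M \<Longrightarrow> v \<in> Arr M \<Longrightarrow> Src M v = Src M u \<Longrightarrow> Tgt M u = \<iota>o M (eucl 0) \<Longrightarrow>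
    Tgt M v = \<iota>o M (eucl 0) \<Longrightarrow> u = v"
proof -
  assume uv: "u \<in> Arr M" "v \<in> Arr M" "Src M v = Src M u" "Tgt M u = \<iota>o M (eucl 0)"
    "Tgt M v = \<iota>o M (eucl 0)"
  then have "\<exists>!f. f \<in> Hom M (Src M u) (\<iota>o M (eucl 0))"
    using \<iota>_terminal by (simp add: is_terminal_def)
  moreover have "u \<in> Hom M (Src M u) (\<iota>o M (eucl 0))" "v \<in> Hom M (Src M u) (\<iota>o M (eucl 0))"
    using uv by (simp_all add: Hom_iff)
  ultimately show "u = v" by blast
qed

text \<open>In the topos, too, \<open>eucl (Suc n)\<close> is the product of \<open>eucl n\<close> and the line, because the square over the
  point is a transversal pullback.\<close>

lemma extend_tuple:
  assumes "u \<in> Arr M" "a \<in> Arr M" "Src M a = Src M u" "Tgt M u = \<iota>o M (eucl n)" "Tgt M a = R"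
  shows "\<exists>!h. h \<in> Hom M (Src M u) (\<iota>o M (eucl (Suc n))) \<and> \<iota>a M (first_coords n) \<cdot> h = u \<and>
    \<iota>a M (coord (Suc n) n) \<cdot> h = a"
proof -
  have "\<iota>a M (to_point n) \<cdot> u = \<iota>a M (to_point 1) \<cdot> a"
    by (rule point_eq) (use assms in \<open>auto simp: line_def\<close>)
  with \<iota>_transversal[OF eucl_Suc_pullback to_point_transversal, of n] assms
  have "\<exists>!h. h \<in> Hom M (Src M u) (Src M (\<iota>a M (first_coords n))) \<and> \<iota>a M (first_coords n) \<cdot> h = u \<and>
      \<iota>a M (coord (Suc n) n) \<cdot> h = a"
    unfolding is_pullback_def R_eq \<iota>_to_point by metis
  then show ?thesis by simp
qed

lemma coord_first_coords:
  assumes "k < n" shows "\<iota>a M (coord (Suc n) k) = \<iota>a M (coord n k) \<cdot> \<iota>a M (first_coords n)"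
proof -
  have "coord (Suc n) k = coord n k \<cdot>\<^bsub>Mf\<^esub> first_coords n"
    unfolding coord_def first_coords_def
    by (subst mfmap_Cmp) (use assms trunc_eucl in \<open>auto simp: trunc_def\<close>)
  then show ?thesis using \<iota>_Cmp[OF first_coords_Hom coord_Hom] by simp
qed

text \<open>Joint injectivity of the coordinates, by induction on the dimension along the pullback squares.\<close>

lemma tuple_eqI:
  assumes "u \<in> Arr M" "v \<in> Arr M" "Src M v = Src M u"
    "Tgt M u = \<iota>o M (eucl n)" "Tgt M v = \<iota>o M (eucl n)"
    "\<And>k. k < n \<Longrightarrow> \<iota>a M (coord n k) \<cdot> u = \<iota>a M (coord n k) \<cdot> v"
  shows "u = v"
  using assms
proof (induction n arbitrary: u v)
  case 0
  then show ?case using point_eq by blast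
next
  case (Suc n)
  have "\<iota>a M (first_coords n) \<cdot> u = \<iota>a M (first_coords n) \<cdot> v"
  proof (rule Suc.IH)
    fix k assume "k < n"
    then show "\<iota>a M (coord n k) \<cdot> \<iota>a M (first_coords n) \<cdot> u = \<iota>a M (coord n k) \<cdot> \<iota>a M (first_coords n) \<cdot> v"
      using Suc.prems(6)[of k] Suc.prems(1-5) by (simp add: coord_first_coords)
  qed (use Suc.prems in auto)
  moreover have "\<iota>a M (coord (Suc n) n) \<cdot> u = \<iota>a M (coord (Suc n) n) \<cdot> v"
    by (rule Suc.prems(6)) simp
  ultimately show ?case
    using extend_tuple[of "\<iota>a M (first_coords n) \<cdot> u" "\<iota>a M (coord (Suc n) n) \<cdot> u" n] Suc.prems(1-5)
    by (auto simp: Hom_iff)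
qed

text \<open>The stage is required explicitly because the list may be empty.\<close>

definition args :: "'o \<Rightarrow> 'a list \<Rightarrow> bool" where
  "args X as \<longleftrightarrow> X \<in> Obj M \<and> set as \<subseteq> Hom M X R"

lemma tuple_ex:
  "args X as \<Longrightarrow> \<exists>u. u \<in> Hom M X (\<iota>o M (eucl (length as))) \<and>
     (\<forall>k<length as. \<iota>a M (coord (length as) k) \<cdot> u = as ! k)"
proof (induction as rule: rev_induct)
  case Nil
  then show ?case using \<iota>_terminal by (auto simp: args_def is_terminal_def)
next
  case (snoc a as)
  then obtain u where u: "u \<in> Hom M X (\<iota>o M (eucl (length as)))"
    "\<And>k. k < length as \<Longrightarrow> \<iota>a M (coord (length as) k) \<cdot> u = as ! k" by (auto simp: args_def)
  with extend_tuple[of u a "length as"] snoc.prems obtain h where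
    h: "h \<in> Hom M X (\<iota>o M (eucl (Suc (length as))))" "\<iota>a M (first_coords (length as)) \<cdot> h = u"
    "\<iota>a M (coord (Suc (length as)) (length as)) \<cdot> h = a" by (auto simp: args_def Hom_iff)
  have "\<iota>a M (coord (Suc (length as)) k) \<cdot> h = (as @ [a]) ! k" if "k < Suc (length as)" for k
  proof (cases "k = length as")
    case False
    with that have "k < length as" by simp
    then show ?thesis using u(2)[of k] h by (auto simp: coord_first_coords nth_append Hom_iff)
  qed (use h in simp)
  with h(1) show ?case by auto
qed

lemma tuple_spec:
  assumes "args X as"
  shows "tuple M X as \<in> Arr M" "Src M (tuple M X as) = X"
    "Tgt M (tuple M X as) = \<iota>o M (eucl (length as))"
    "k < length as \<Longrightarrow> \<iota>a M (coord (length as) k) \<cdot> tuple M X as = as ! k"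
proof -
  have "\<exists>!u. u \<in> Hom M X (\<iota>o M (eucl (length as))) \<and>
     (\<forall>k<length as. \<iota>a M (coord (length as) k) \<cdot> u = as ! k)"
    using tuple_ex[OF assms] by (rule ex_ex1I) (auto simp: Hom_iff intro: tuple_eqI)
  from theI'[OF this] show "tuple M X as \<in> Arr M" "Src M (tuple M X as) = X"
    "Tgt M (tuple M X as) = \<iota>o M (eucl (length as))"
    "k < length as \<Longrightarrow> \<iota>a M (coord (length as) k) \<cdot> tuple M X as = as ! k"
    unfolding tuple_def coord_def by (auto simp: Hom_iff)
qed

definition smooth_arr :: "nat \<Rightarrow> nat \<Rightarrow> (vec \<Rightarrow> vec) \<Rightarrow> 'a" where
  "smooth_arr n m f = \<iota>a M (mfmap (eucl n) (eucl m) f)"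

lemma smooth_arr_simps [simp]:
  assumes "\<And>j. elementary (\<lambda>v. f v j)" "\<And>v. f v \<in> eucl m"
  shows "smooth_arr n m f \<in> Arr M" "Src M (smooth_arr n m f) = \<iota>o M (eucl n)"
    "Tgt M (smooth_arr n m f) = \<iota>o M (eucl m)"
  using \<iota>_simps[OF mfmap_elementary_Hom[of f n m]] assms
  unfolding smooth_arr_def by auto

lemma smooth_arr_cmp:
  assumes "\<And>j. elementary (\<lambda>v. f v j)" "\<And>v. f v \<in> eucl m" "\<And>j. elementary (\<lambda>v. g v j)" "\<And>v. g v \<in> eucl k"
  shows "smooth_arr m k g \<cdot> smooth_arr n m f = smooth_arr n k (\<lambda>v. g (f v))"
proof -
  have "mfmap (eucl m) (eucl k) g \<cdot>\<^bsub>Mf\<^esub> mfmap (eucl n) (eucl m) f = mfmap (eucl n) (eucl k) (\<lambda>v. g (f v))"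
    by (rule mfmap_Cmp) (use assms in auto)
  moreover have "mfmap (eucl n) (eucl m) f \<in> Hom Mf (eucl n) (eucl m)"
    "mfmap (eucl m) (eucl k) g \<in> Hom Mf (eucl m) (eucl k)"
    by (rule mfmap_elementary_Hom; use assms in auto)+
  ultimately show ?thesis unfolding smooth_arr_def using \<iota>_Cmp by metis
qed

lemma smooth_op_arr: "smooth_op M X h as = smooth_arr (length as) 1 (\<lambda>v. sc (h v)) \<cdot> tuple M X as"
  by (simp add: smooth_op_def smooth_arr_def)

lemma coord_arr: "\<iota>a M (coord n k) = smooth_arr n 1 (\<lambda>v. sc (v k))"
  by (simp add: coord_def smooth_arr_def)

lemma smooth_op_simps:
  assumes "args X as" "elementary h"
  shows "smooth_op M X h as \<in> Arr M" "Src M (smooth_op M X h as) = X" "Tgt M (smooth_op M X h as) = R"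
  using assms by (auto simp: smooth_op_arr tuple_spec elementary_sc sc_eucl[simplified] line_def)

lemma smooth_op_var: "args X as \<Longrightarrow> k < length as \<Longrightarrow> smooth_op M X (\<lambda>v. v k) as = as ! k"
  using tuple_spec(4)[of X as k] by (simp add: smooth_op_arr coord_arr)

lemma args_map:
  "args X as \<Longrightarrow> (\<And>h. h \<in> set hs \<Longrightarrow> elementary h) \<Longrightarrow> args X (map (\<lambda>h. smooth_op M X h as) hs)"
  by (auto simp: args_def Hom_iff smooth_op_simps)

text \<open>This carries identities between real functions over to elements of the line: an expression in
  the elements \<open>as\<close> built from smooth operations is the single operation given by the corresponding
  real expression.\<close>

lemma smooth_op_compose:
  assumes as: "args X as" and "list_all elementary hs" and g: "elementary g"
  shows "smooth_op M X g (map (\<lambda>h. smooth_op M X h as) hs) =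
    smooth_op M X (\<lambda>v. g (\<lambda>j. if j < length hs then (hs ! j) v else 0)) as"
proof -
  have hs: "\<And>h. h \<in> set hs \<Longrightarrow> elementary h" using assms(2) by (simp add: list_all_iff)
  let ?m = "length hs" and ?n = "length as"
  let ?H = "\<lambda>v j. if j < ?m then (hs ! j) v else 0"
  have H: "elementary (\<lambda>v. ?H v j)" "?H v \<in> eucl ?m" for j v
    using hs by (cases "j < ?m") (auto simp: eucl_def intro: elementary_intros)
  have sc: "elementary (\<lambda>v. sc (f v) j)" "sc (f v) \<in> eucl 1" if "elementary f" for f j v
    using that elementary_sc sc_eucl by auto
  have tup: "tuple M X (map (\<lambda>h. smooth_op M X h as) hs) = smooth_arr ?n ?m ?H \<cdot> tuple M X as"
  proof (rule tuple_eqI[where n = ?m])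
    fix k assume k: "k < ?m"
    have "\<iota>a M (coord ?m k) \<cdot> smooth_arr ?n ?m ?H = smooth_arr ?n 1 (\<lambda>v. sc (?H v k))"
      unfolding coord_arr by (rule smooth_arr_cmp) (use H sc sc[OF elementary_var] elementary_var in auto)
    then have "\<iota>a M (coord ?m k) \<cdot> smooth_arr ?n ?m ?H \<cdot> tuple M X as = smooth_op M X (hs ! k) as"
      using k H tuple_spec[OF as]
      by (simp add: smooth_op_arr flip: assoc_simp)
    then show "\<iota>a M (coord ?m k) \<cdot> tuple M X (map (\<lambda>h. smooth_op M X h as) hs) =
        \<iota>a M (coord ?m k) \<cdot> smooth_arr ?n ?m ?H \<cdot> tuple M X as"
      using tuple_spec(4)[OF args_map[OF as hs], of hs k] k by simp
  qed (use H tuple_spec[OF as] tuple_spec[OF args_map[OF as hs], of hs] in auto)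
  have "smooth_arr ?m 1 (\<lambda>v. sc (g v)) \<cdot> smooth_arr ?n ?m ?H = smooth_arr ?n 1 (\<lambda>v. sc (g (?H v)))"
    by (rule smooth_arr_cmp) (use H sc g in auto)
  then have "smooth_arr ?m 1 (\<lambda>v. sc (g v)) \<cdot> smooth_arr ?n ?m ?H \<cdot> tuple M X as =
      smooth_op M X (\<lambda>v. g (?H v)) as"
    unfolding smooth_op_arr using H sc[OF g] tuple_spec[OF as] by (simp flip: assoc_simp)
  then show ?thesis by (simp only: smooth_op_arr[of X g] tup length_map)
qed

lemma smooth_op_cmp:
  assumes as: "args X as" and h: "elementary h" and z: "z \<in> Arr M" "Tgt M z = X"
  shows "smooth_op M X h as \<cdot> z = smooth_op M (Src M z) h (map (\<lambda>a. a \<cdot> z) as)"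
proof -
  have args: "args (Src M z) (map (\<lambda>a. a \<cdot> z) as)"
    using as z by (auto simp: args_def Hom_iff)
  have "tuple M X as \<cdot> z = tuple M (Src M z) (map (\<lambda>a. a \<cdot> z) as)"
  proof (rule tuple_eqI[where n = "length as"])
    fix k assume k: "k < length as"
    have "(\<iota>a M (coord (length as) k) \<cdot> tuple M X as) \<cdot> z = as ! k \<cdot> z"
      using tuple_spec(4)[OF as k] by simp
    then show "\<iota>a M (coord (length as) k) \<cdot> tuple M X as \<cdot> z =
        \<iota>a M (coord (length as) k) \<cdot> tuple M (Src M z) (map (\<lambda>a. a \<cdot> z) as)"
      using tuple_spec(4)[OF args] tuple_spec(1-3)[OF as] k z by simp
  qed (use tuple_spec[OF as] tuple_spec[OF args] z in auto)
  then show ?thesis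
    using tuple_spec[OF as] z elementary_sc[OF h] sc_eucl by (simp add: smooth_op_arr)
qed

lemma smooth_op_cong: "(\<And>v. f v = g v) \<Longrightarrow> smooth_op M X f as = smooth_op M X g as"
  by presburger

definition rneg :: "'a \<Rightarrow> 'a" where
  "rneg a = smooth_op M (Src M a) (\<lambda>v. - v 0) [a]"

text \<open>Taken together, the rules \<open>ops\<close> contract any expression in elements of the line at one stage to a
  single smooth operation on the list of these elements.\<close>

lemma rconst_op: "args X as \<Longrightarrow> rconst M X c = smooth_op M X (\<lambda>_. c) as"
  using smooth_op_compose[of X as "[]" "\<lambda>_. c"] by (simp add: rconst_def elementary_const)

lemma radd_op:
  "args X as \<Longrightarrow> elementary f \<Longrightarrow> elementary g \<Longrightarrow>
    smooth_op M X f as \<oplus> smooth_op M X g as = smooth_op M X (\<lambda>v. f v + g v) as"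
  using smooth_op_compose[OF _ _ elementary_add[OF elementary_var elementary_var], of X as "[f, g]" 0 1]
  by (simp add: radd_def smooth_op_simps)

lemma rmult_op:
  "args X as \<Longrightarrow> elementary f \<Longrightarrow> elementary g \<Longrightarrow>
    smooth_op M X f as \<otimes> smooth_op M X g as = smooth_op M X (\<lambda>v. f v * g v) as"
  using smooth_op_compose[OF _ _ elementary_mult[OF elementary_var elementary_var], of X as "[f, g]" 0 1]
  by (simp add: rmult_def smooth_op_simps)

lemma rneg_op: "args X as \<Longrightarrow> elementary f \<Longrightarrow> rneg (smooth_op M X f as) = smooth_op M X (\<lambda>v. - f v) as"
  using smooth_op_compose[OF _ _ elementary_uminus[OF elementary_var], of X as "[f]" 0]
  by (simp add: rneg_def smooth_op_simps)

lemma rcos_op: "args X as \<Longrightarrow> elementary f \<Longrightarrow> rcos M (smooth_op M X f as) = smooth_op M X (\<lambda>v. cos (f v)) as"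
  using smooth_op_compose[OF _ _ elementary_cos[OF elementary_var], of X as "[f]" 0]
  by (simp add: rcos_def smooth_op_simps)

lemma rsin_op: "args X as \<Longrightarrow> elementary f \<Longrightarrow> rsin M (smooth_op M X f as) = smooth_op M X (\<lambda>v. sin (f v)) as"
  using smooth_op_compose[OF _ _ elementary_sin[OF elementary_var], of X as "[f]" 0]
  by (simp add: rsin_def smooth_op_simps)

lemmas ops = rconst_op radd_op rmult_op rneg_op rcos_op rsin_op

end


text \<open>Coordinates are indexed by the literals \<open>0\<close>, \<open>1\<close>, \<open>2\<close>; rewriting \<open>1\<close> to \<open>Suc 0\<close> would keep the rules for
  the middle one from matching.\<close>

declare One_nat_def [simp del]

context well_adapted_model
begin

lemma args_single: "a \<in> Arr M \<Longrightarrow> Tgt M a = R \<Longrightarrow> args (Src M a) [a]"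
  by (simp add: args_def Hom_iff)

lemma args_two: "a \<in> Arr M \<Longrightarrow> Tgt M a = R \<Longrightarrow> b \<in> Arr M \<Longrightarrow> Tgt M b = R \<Longrightarrow> Src M b = Src M a \<Longrightarrow>
  args (Src M a) [a, b]"
  by (simp add: args_def Hom_iff)

lemma rconst_simps [simp]:
  assumes "X \<in> Obj M"
  shows "rconst M X c \<in> Arr M" "Src M (rconst M X c) = X" "Tgt M (rconst M X c) = R"
    "z \<in> Arr M \<Longrightarrow> Tgt M z = X \<Longrightarrow> rconst M X c \<cdot> z = rconst M (Src M z) c"
  using smooth_op_simps[of X "[]" "\<lambda>_. c"] smooth_op_cmp[of X "[]" "\<lambda>_. c" z] assms
  by (auto simp: rconst_def args_def elementary_const)

lemma binop_simps [simp]: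
  assumes "a \<in> Arr M" "Tgt M a = R" "b \<in> Arr M" "Tgt M b = R" "Src M b = Src M a"
  shows "a \<oplus> b \<in> Arr M" "Src M (a \<oplus> b) = Src M a" "Tgt M (a \<oplus> b) = R"
    "z \<in> Arr M \<Longrightarrow> Tgt M z = Src M a \<Longrightarrow> (a \<oplus> b) \<cdot> z = (a \<cdot> z) \<oplus> (b \<cdot> z)"
    "a \<otimes> b \<in> Arr M" "Src M (a \<otimes> b) = Src M a" "Tgt M (a \<otimes> b) = R"
    "z \<in> Arr M \<Longrightarrow> Tgt M z = Src M a \<Longrightarrow> (a \<otimes> b) \<cdot> z = (a \<cdot> z) \<otimes> (b \<cdot> z)"
  using smooth_op_simps[OF args_two[OF assms] elementary_add[OF elementary_var elementary_var], of 0 1]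
    smooth_op_cmp[OF args_two[OF assms] elementary_add[OF elementary_var elementary_var], of z 0 1]
    smooth_op_simps[OF args_two[OF assms] elementary_mult[OF elementary_var elementary_var], of 0 1]
    smooth_op_cmp[OF args_two[OF assms] elementary_mult[OF elementary_var elementary_var], of z 0 1] assms
  unfolding radd_def rmult_def by auto

lemma unop_simps [simp]:
  assumes "a \<in> Arr M" "Tgt M a = R"
  shows "rneg a \<in> Arr M" "Src M (rneg a) = Src M a" "Tgt M (rneg a) = R"
    "z \<in> Arr M \<Longrightarrow> Tgt M z = Src M a \<Longrightarrow> rneg a \<cdot> z = rneg (a \<cdot> z)"
    "rcos M a \<in> Arr M" "Src M (rcos M a) = Src M a" "Tgt M (rcos M a) = R"
    "z \<in> Arr M \<Longrightarrow> Tgt M z = Src M a \<Longrightarrow> rcos M a \<cdot> z = rcos M (a \<cdot> z)"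
    "rsin M a \<in> Arr M" "Src M (rsin M a) = Src M a" "Tgt M (rsin M a) = R"
    "z \<in> Arr M \<Longrightarrow> Tgt M z = Src M a \<Longrightarrow> rsin M a \<cdot> z = rsin M (a \<cdot> z)"
  using smooth_op_simps[OF args_single[OF assms] elementary_uminus[OF elementary_var], of 0]
    smooth_op_cmp[OF args_single[OF assms] elementary_uminus[OF elementary_var], of z 0]
    smooth_op_simps[OF args_single[OF assms] elementary_cos[OF elementary_var], of 0]
    smooth_op_cmp[OF args_single[OF assms] elementary_cos[OF elementary_var], of z 0]
    smooth_op_simps[OF args_single[OF assms] elementary_sin[OF elementary_var], of 0]
    smooth_op_cmp[OF args_single[OF assms] elementary_sin[OF elementary_var], of z 0] assms
  unfolding rneg_def rcos_def rsin_def by auto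

text \<open>Writing elements as coordinates of an opaque list \<open>as\<close> prepares an identity for contraction by
  \<open>ops\<close>; after that it is an identity between real functions.\<close>

lemma reify3:
  assumes "a \<in> Arr M" "Tgt M a = R" "b \<in> Arr M" "Tgt M b = R" "c \<in> Arr M" "Tgt M c = R"
    "Src M a = X" "Src M b = X" "Src M c = X"
  obtains as where "args X as" "a = smooth_op M X (\<lambda>v. v 0) as" "b = smooth_op M X (\<lambda>v. v 1) as"
    "c = smooth_op M X (\<lambda>v. v 2) as"
proof -
  have "args X [a, b, c]" using assms by (auto simp: args_def Hom_iff)
  from smooth_op_var[OF this, of 0] smooth_op_var[OF this, of 1] smooth_op_var[OF this, of 2] this that
  show ?thesis by simp
qed

lemma ring_laws:
  assumes "a \<in> Arr M" "Tgt M a = R" "b \<in> Arr M" "Tgt M b = R" "c \<in> Arr M" "Tgt M c = R"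
    "Src M b = Src M a" "Src M c = Src M a"
  shows "(a \<oplus> b) \<oplus> c = a \<oplus> (b \<oplus> c)" "a \<oplus> (b \<oplus> c) = b \<oplus> (a \<oplus> c)"
    "(a \<otimes> b) \<otimes> c = a \<otimes> (b \<otimes> c)" "a \<otimes> (b \<otimes> c) = b \<otimes> (a \<otimes> c)"
    "(a \<oplus> b) \<otimes> c = (a \<otimes> c) \<oplus> (b \<otimes> c)" "c \<otimes> (a \<oplus> b) = (c \<otimes> a) \<oplus> (c \<otimes> b)"
proof -
  define X where "X = Src M a"
  have X: "Src M a = X" "Src M b = X" "Src M c = X" using assms by (simp_all add: X_def)
  obtain as where as: "args X as" "a = smooth_op M X (\<lambda>v. v 0) as"
    "b = smooth_op M X (\<lambda>v. v 1) as" "c = smooth_op M X (\<lambda>v. v 2) as"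
    by (rule reify3[OF assms(1-6) X])
  show "(a \<oplus> b) \<oplus> c = a \<oplus> (b \<oplus> c)" "a \<oplus> (b \<oplus> c) = b \<oplus> (a \<oplus> c)"
    "(a \<otimes> b) \<otimes> c = a \<otimes> (b \<otimes> c)" "a \<otimes> (b \<otimes> c) = b \<otimes> (a \<otimes> c)"
    "(a \<oplus> b) \<otimes> c = (a \<otimes> c) \<oplus> (b \<otimes> c)" "c \<otimes> (a \<oplus> b) = (c \<otimes> a) \<oplus> (c \<otimes> b)"
    unfolding as(2-4)
    by (simp_all only: ops[OF as(1)] elementary_intros) (rule smooth_op_cong, simp add: algebra_simps)+
qed

lemma ring_comm:
  assumes "a \<in> Arr M" "Tgt M a = R" "b \<in> Arr M" "Tgt M b = R" "Src M b = Src M a"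
  shows "a \<oplus> b = b \<oplus> a" "a \<otimes> b = b \<otimes> a" "rneg a \<otimes> b = rneg (a \<otimes> b)" "a \<otimes> rneg b = rneg (a \<otimes> b)"
    "rneg (a \<oplus> b) = rneg a \<oplus> rneg b" "a \<oplus> (rneg a \<oplus> b) = b" "rneg a \<oplus> (a \<oplus> b) = b"
proof -
  define X where "X = Src M a"
  have X: "Src M a = X" "Src M b = X" using assms by (simp_all add: X_def)
  obtain as where as: "args X as" "a = smooth_op M X (\<lambda>v. v 0) as"
    "b = smooth_op M X (\<lambda>v. v 1) as"
    by (rule reify3[OF assms(1-4) assms(3,4) X X(2)])
  show "a \<oplus> b = b \<oplus> a" "a \<otimes> b = b \<otimes> a" "rneg a \<otimes> b = rneg (a \<otimes> b)" "a \<otimes> rneg b = rneg (a \<otimes> b)"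
    "rneg (a \<oplus> b) = rneg a \<oplus> rneg b" "a \<oplus> (rneg a \<oplus> b) = b" "rneg a \<oplus> (a \<oplus> b) = b"
    unfolding as(2,3)
    by (simp_all only: ops[OF as(1)] elementary_intros) (rule smooth_op_cong, simp add: algebra_simps)+
qed

lemma ring_unit [simp]:
  assumes "a \<in> Arr M" "Tgt M a = R" "Src M a = X"
  shows "a \<oplus> rconst M X 0 = a" "rconst M X 0 \<oplus> a = a" "a \<oplus> rneg a = rconst M X 0"
    "rneg a \<oplus> a = rconst M X 0" "rconst M X 0 \<otimes> a = rconst M X 0"
    "a \<otimes> rconst M X 0 = rconst M X 0" "rconst M X 1 \<otimes> a = a" "a \<otimes> rconst M X 1 = a"
    "rneg (rneg a) = a"
proof -
  obtain as where as: "args X as" "a = smooth_op M X (\<lambda>v. v 0) as"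
    by (rule reify3[OF assms(1,2) assms(1,2) assms(1,2) assms(3) assms(3) assms(3)])
  show "a \<oplus> rconst M X 0 = a" "rconst M X 0 \<oplus> a = a" "a \<oplus> rneg a = rconst M X 0"
    "rneg a \<oplus> a = rconst M X 0" "rconst M X 0 \<otimes> a = rconst M X 0"
    "a \<otimes> rconst M X 0 = rconst M X 0" "rconst M X 1 \<otimes> a = a" "a \<otimes> rconst M X 1 = a"
    "rneg (rneg a) = a"
    unfolding as(2)
    by (simp_all only: ops[OF as(1)] elementary_intros) (rule smooth_op_cong, simp add: algebra_simps)+
qed

lemma rconst_laws [simp]:
  assumes "X \<in> Obj M"
  shows "rconst M X c \<oplus> rconst M X d = rconst M X (c + d)"
    "rconst M X c \<otimes> rconst M X d = rconst M X (c * d)" "rneg (rconst M X c) = rconst M X (- c)"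
    "rcos M (rconst M X c) = rconst M X (cos c)" "rsin M (rconst M X c) = rconst M X (sin c)"
proof -
  have as: "args X []" using assms by (simp add: args_def)
  show "rconst M X c \<oplus> rconst M X d = rconst M X (c + d)"
    "rconst M X c \<otimes> rconst M X d = rconst M X (c * d)" "rneg (rconst M X c) = rconst M X (- c)"
    "rcos M (rconst M X c) = rconst M X (cos c)" "rsin M (rconst M X c) = rconst M X (sin c)"
    by (simp_all only: ops[OF as] elementary_intros)
qed

lemmas rsimps = ring_laws ring_comm


section \<open>Infinitesimals\<close>

abbreviation infinitesimal :: "'a \<Rightarrow> bool" where
  "infinitesimal d \<equiv> d \<in> Arr M \<and> Tgt M d = R \<and> d \<otimes> d = rconst M (Src M d) 0"

lemma infinitesimals_iff: "d \<in> infinitesimals M X \<longleftrightarrow> infinitesimal d \<and> Src M d = X"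
  by (auto simp: infinitesimals_def Hom_iff)

lemma infinitesimal_cmp: 
  "infinitesimal d \<Longrightarrow> z \<in> Arr M \<Longrightarrow> Tgt M z = Src M d \<Longrightarrow> infinitesimal (d \<cdot> z)"
  using binop_simps(8)[of d d z] by auto

lemma infinitesimal_mult:
  assumes "infinitesimal d" "a \<in> Arr M" "Tgt M a = R" "Src M a = Src M d"
  shows "infinitesimal (d \<otimes> a)"
proof -
  have "(d \<otimes> a) \<otimes> (d \<otimes> a) = (d \<otimes> d) \<otimes> (a \<otimes> a)"
    using assms by (simp add: rsimps del: ring_unit)
  also have "\<dots> = rconst M (Src M d) 0" using assms by simp
  finally show ?thesis using assms by simp
qed

lemma infinitesimal_square:
  assumes "infinitesimal d" "a \<in> Arr M" "Tgt M a = R" "Src M a = Src M d"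
  shows "d \<otimes> (d \<otimes> a) = rconst M (Src M d) 0"
  using assms ring_laws(3)[of d d a] by simp

text \<open>The addition theorems and the second-order expansions of \<open>sin d\<close> and \<open>cos d\<close> combine to a real
  identity with a remainder of the form \<open>d\<^sup>2\<close> times an elementary function of \<open>a\<close> and \<open>d\<close>.\<close>

lemma trig_infinitesimal:
  assumes d: "infinitesimal d" and a: "a \<in> Arr M" "Tgt M a = R" "Src M d = Src M a"
  shows "rsin M (a \<oplus> d) = rsin M a \<oplus> (d \<otimes> rcos M a)"
    "rcos M (a \<oplus> d) = rcos M a \<oplus> (d \<otimes> rneg (rsin M a))"
proof -
  define X where "X = Src M a"
  have dA: "d \<in> Arr M" "Tgt M d = R" using d by auto
  have X: "Src M a = X" "Src M d = X" using assms by (simp_all add: X_def)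
  obtain as where as: "args X as" "a = smooth_op M X (\<lambda>v. v 0) as"
    "d = smooth_op M X (\<lambda>v. v 1) as"
    by (rule reify3[OF a(1,2) dA dA X X(2)])
  let ?s = "\<lambda>y :: real. \<Sum>n. sin_coeff (n + 2) * y ^ n" and ?c = "\<lambda>y :: real. \<Sum>n. cos_coeff (n + 2) * y ^ n"
  have s: "elementary (\<lambda>v. ?s (v 1))" and c: "elementary (\<lambda>v. ?c (v 1))"
    by (intro elementary_intros entire_shift entire_sin_coeff entire_cos_coeff)+
  have sd: "sin y = y + y * y * ?s y" for y
    using series_second_order[OF entire_sin_coeff, of y] by (simp add: sin_series sin_coeff_def)
  have cd: "cos y = 1 + y * y * ?c y" for y
    using series_second_order[OF entire_cos_coeff, of y] by (simp add: cos_series cos_coeff_def)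
  have sin': "sin (x + y) = (sin x + y * cos x) + y * y * (sin x * ?c y + cos x * ?s y)"
    and cos': "cos (x + y) = (cos x + y * - sin x) + y * y * (cos x * ?c y - sin x * ?s y)" for x y
    unfolding sin_add cos_add by (subst sd[of y], subst cd[of y], simp add: algebra_simps)+
  define U V where "U = smooth_op M X (\<lambda>v. sin (v 0) * ?c (v 1) + cos (v 0) * ?s (v 1)) as"
    and "V = smooth_op M X (\<lambda>v. cos (v 0) * ?c (v 1) - sin (v 0) * ?s (v 1)) as"
  have UV: "U \<in> Arr M" "Src M U = X" "Tgt M U = R" "V \<in> Arr M" "Src M V = X" "Tgt M V = R"
    unfolding U_def V_def by (intro smooth_op_simps as elementary_intros s c)+
  have "rsin M (a \<oplus> d) = (rsin M a \<oplus> (d \<otimes> rcos M a)) \<oplus> ((d \<otimes> d) \<otimes> U)"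
    unfolding as(2,3) U_def
    by (simp only: ops[OF as(1)] elementary_intros s c)
       (rule smooth_op_cong, rule sin')
  then show "rsin M (a \<oplus> d) = rsin M a \<oplus> (d \<otimes> rcos M a)"
    using d a UV by (simp add: X_def)
  have "rcos M (a \<oplus> d) = (rcos M a \<oplus> (d \<otimes> rneg (rsin M a))) \<oplus> ((d \<otimes> d) \<otimes> V)"
    unfolding as(2,3) V_def
    by (simp only: ops[OF as(1)] elementary_intros s c)
       (rule smooth_op_cong, rule cos')
  then show "rcos M (a \<oplus> d) = rcos M a \<oplus> (d \<otimes> rneg (rsin M a))"
    using d a UV by (simp add: X_def)
qed

text \<open>Cancellation is tested on the generic infinitesimal, the inclusion of \<open>D\<close> at the stage \<open>Src b \<times> D\<close>; there
  the Kock-Lawvere axiom makes the slope of an affine function of \<open>d\<close> unique.\<close>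

lemma kl_cancel:
  assumes b: "b \<in> Arr M" "Tgt M b = R" and b': "b' \<in> Arr M" "Tgt M b' = R" "Src M b' = Src M b"
    and eq: "\<And>w d. w \<in> Arr M \<Longrightarrow> Tgt M w = Src M b \<Longrightarrow> infinitesimal d \<Longrightarrow> Src M d = Src M w \<Longrightarrow>
      d \<otimes> (b \<cdot> w) = d \<otimes> (b' \<cdot> w)"
  shows "b = b'"
proof -
  let ?W = "Src M b"
  obtain e where e: "is_equalizer M e (Idt M R \<otimes> Idt M R) (rconst M R 0)"
    using ex_equalizer[of "Idt M R \<otimes> Idt M R" R R "rconst M R 0"] by (auto simp: Hom_iff)
  let ?D = "Src M e"
  have eA: "e \<in> Arr M" "Tgt M e = R" "(Idt M R \<otimes> Idt M R) \<cdot> e = rconst M R 0 \<cdot> e"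
    using e by (auto simp: is_equalizer_def)
  then have inf: "infinitesimal e" by auto
  let ?w = "Pr1 M ?W ?D" and ?d = "e \<cdot> Pr2 M ?W ?D"
  let ?f = "?d \<otimes> (b \<cdot> ?w)"
  have d: "infinitesimal ?d" using eA b by (intro infinitesimal_cmp inf) auto
  define P where "P = (\<lambda>(a, c). a \<in> Hom M ?W R \<and> c \<in> Hom M ?W R \<and> ?f = (a \<cdot> ?w) \<oplus> (?d \<otimes> (c \<cdot> ?w)))"
  have "\<exists>!q. P q"
    using kock_lawvere e b eA unfolding kock_lawvere_def P_def by (simp add: Hom_iff)
  moreover have "P (rconst M ?W 0, b)" using b eA by (simp add: P_def Hom_iff)
  moreover have "P (rconst M ?W 0, b')"
    using eq[of ?w ?d] b b' d eA by (simp add: P_def Hom_iff)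
  ultimately have "(rconst M ?W 0, b) = (rconst M ?W 0, b')" by blast
  then show ?thesis by simp
qed


lemma radd_cancel:
  assumes "a \<oplus> b = a \<oplus> c" "a \<in> Arr M" "Tgt M a = R" "b \<in> Arr M" "Tgt M b = R" "Src M b = Src M a"
    "c \<in> Arr M" "Tgt M c = R" "Src M c = Src M a"
  shows "b = c"
proof -
  have "b = rneg a \<oplus> (a \<oplus> b)" using ring_comm(7)[OF assms(2-6)] by (rule sym)
  also have "\<dots> = rneg a \<oplus> (a \<oplus> c)" by (simp only: assms(1))
  also have "\<dots> = c" by (rule ring_comm(7)[OF assms(2,3,7-9)])
  finally show ?thesis .
qed

section \<open>Points and test functions\<close>

lemma space3_Obj [simp]: "space3 M \<in> Obj M" by (simp add: space3_def)

lemma testfun_Obj [simp]: "testfun M \<in> Obj M" by (simp add: testfun_def)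

lemma point3_simps [simp]:
  assumes "a \<in> Arr M" "Tgt M a = R" "b \<in> Arr M" "Tgt M b = R" "c \<in> Arr M" "Tgt M c = R"
    "Src M b = Src M a" "Src M c = Src M a"
  shows "point3 M a b c \<in> Arr M" "Src M (point3 M a b c) = Src M a" "Tgt M (point3 M a b c) = space3 M"
    "z \<in> Arr M \<Longrightarrow> Tgt M z = Src M a \<Longrightarrow> point3 M a b c \<cdot> z = point3 M (a \<cdot> z) (b \<cdot> z) (c \<cdot> z)"
    "coord3 M 0 (point3 M a b c) = a" "coord3 M 1 (point3 M a b c) = b"
    "coord3 M 2 (point3 M a b c) = c"
  using assms by (simp_all add: point3_def space3_def coord3_def)

lemma coord3_simps [simp]:
  assumes "p \<in> Arr M" "Tgt M p = space3 M"
  shows "coord3 M i p \<in> Arr M" "Src M (coord3 M i p) = Src M p" "Tgt M (coord3 M i p) = R"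
    "z \<in> Arr M \<Longrightarrow> Tgt M z = Src M p \<Longrightarrow> coord3 M i p \<cdot> z = coord3 M i (p \<cdot> z)"
  using assms by (simp_all add: space3_def coord3_def)

lemma point3_eta [simp]:
  assumes "p \<in> Arr M" "Tgt M p = space3 M"
  shows "point3 M (coord3 M 0 p) (coord3 M 1 p) (coord3 M 2 p) = p"
  using assms by (simp add: space3_def coord3_def point3_def)

lemma shift3_simps [simp]:
  assumes "p \<in> Arr M" "Tgt M p = space3 M" "d \<in> Arr M" "Tgt M d = R" "Src M d = Src M p"
  shows "shift3 M i d p \<in> Arr M" "Src M (shift3 M i d p) = Src M p" "Tgt M (shift3 M i d p) = space3 M"
    "z \<in> Arr M \<Longrightarrow> Tgt M z = Src M p \<Longrightarrow> shift3 M i d p \<cdot> z = shift3 M i (d \<cdot> z) (p \<cdot> z)"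
  using assms by (simp_all add: shift3_def)

lemma shift3_zero [simp]:
  "p \<in> Arr M \<Longrightarrow> Tgt M p = space3 M \<Longrightarrow> Src M p = X \<Longrightarrow> shift3 M i (rconst M X 0) p = p"
  by (auto simp: shift3_def)

lemma shift3_point3:
  assumes "a \<in> Arr M" "Tgt M a = R" "b \<in> Arr M" "Tgt M b = R" "c \<in> Arr M" "Tgt M c = R"
    "Src M b = Src M a" "Src M c = Src M a"
  shows "shift3 M 0 d (point3 M a b c) = point3 M (a \<oplus> d) b c"
    "shift3 M 1 d (point3 M a b c) = point3 M a (b \<oplus> d) c"
    "shift3 M 2 d (point3 M a b c) = point3 M a b (c \<oplus> d)"
  using assms by (simp_all add: shift3_def)

lemma tapp_simps [simp]:
  assumes "\<psi> \<in> Arr M" "Tgt M \<psi> = testfun M" "p \<in> Arr M" "Tgt M p = space3 M" "Src M p = Src M \<psi>"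
  shows "tapp M \<psi> p \<in> Arr M" "Src M (tapp M \<psi> p) = Src M \<psi>" "Tgt M (tapp M \<psi> p) = R"
    "z \<in> Arr M \<Longrightarrow> Tgt M z = Src M \<psi> \<Longrightarrow> tapp M \<psi> p \<cdot> z = tapp M (\<psi> \<cdot> z) (p \<cdot> z)"
  using assms by (simp_all add: tapp_def testfun_def)

lemma is_transpose_iff:
  "is_transpose M X (space3 M) R f h \<longleftrightarrow>
    h \<in> Hom M X (testfun M) \<and> tapp M (h \<cdot> Pr1 M X (space3 M)) (Pr2 M X (space3 M)) = f"
  by (simp add: is_transpose_def tapp_def testfun_def)

text \<open>Extensionality of test functions: both are transposes of the same arrow.\<close>

lemma testfun_eqI:
  assumes "\<psi> \<in> Arr M" "Tgt M \<psi> = testfun M" "\<xi> \<in> Arr M" "Tgt M \<xi> = testfun M" "Src M \<xi> = Src M \<psi>"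
    and "\<And>x p. x \<in> Arr M \<Longrightarrow> Tgt M x = Src M \<psi> \<Longrightarrow> p \<in> Arr M \<Longrightarrow> Tgt M p = space3 M \<Longrightarrow>
      Src M p = Src M x \<Longrightarrow> tapp M (\<psi> \<cdot> x) p = tapp M (\<xi> \<cdot> x) p"
  shows "\<psi> = \<xi>"
proof -
  let ?X = "Src M \<psi>"
  let ?f = "tapp M (\<psi> \<cdot> Pr1 M ?X (space3 M)) (Pr2 M ?X (space3 M))"
  have "\<exists>!h. is_transpose M ?X (space3 M) R ?f h"
    by (rule transpose_unique) (use assms in auto)
  moreover have "is_transpose M ?X (space3 M) R ?f \<psi>" using assms by (simp add: is_transpose_iff Hom_iff)
  moreover have "is_transpose M ?X (space3 M) R ?f \<xi>"
    using assms(1-5) assms(6)[of "Pr1 M ?X (space3 M)" "Pr2 M ?X (space3 M)"]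
    by (simp add: is_transpose_iff Hom_iff)
  ultimately show ?thesis by blast
qed

text \<open>The beta rule for internal abstraction, whose value at any later stage is determined by that at the
  generic element.\<close>

lemma tabs_simps:
  assumes "X \<in> Obj M" "F (Pr1 M X (space3 M)) (Pr2 M X (space3 M)) = f"
    and f: "f \<in> Arr M" "Src M f = Prd M X (space3 M)" "Tgt M f = R"
  shows "tabs M X F \<in> Arr M" "Src M (tabs M X F) = X" "Tgt M (tabs M X F) = testfun M"
    "x \<in> Arr M \<Longrightarrow> Tgt M x = X \<Longrightarrow> p \<in> Arr M \<Longrightarrow> Tgt M p = space3 M \<Longrightarrow> Src M p = Src M x \<Longrightarrow>
      tapp M (tabs M X F \<cdot> x) p = f \<cdot> pair M x p"
proof -
  have "is_transpose M X (space3 M) R f (tabs M X F)"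
    unfolding tabs_def assms(2)
    by (rule theI') (rule transpose_unique; use assms in auto)
  then have h: "tabs M X F \<in> Arr M" "Src M (tabs M X F) = X" "Tgt M (tabs M X F) = testfun M"
    and e: "tapp M (tabs M X F \<cdot> Pr1 M X (space3 M)) (Pr2 M X (space3 M)) = f"
    by (auto simp: is_transpose_iff Hom_iff)
  show "tapp M (tabs M X F \<cdot> x) p = f \<cdot> pair M x p"
    if "x \<in> Arr M" "Tgt M x = X" "p \<in> Arr M" "Tgt M p = space3 M" "Src M p = Src M x"
    using that h assms(1) by (simp flip: e)
  show "tabs M X F \<in> Arr M" "Src M (tabs M X F) = X" "Tgt M (tabs M X F) = testfun M"
    by (fact h)+
qed

lemma tadd_simps [simp]:
  assumes "\<psi> \<in> Arr M" "Tgt M \<psi> = testfun M" "\<xi> \<in> Arr M" "Tgt M \<xi> = testfun M" "Src M \<xi> = Src M \<psi>"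
  shows "tadd M \<psi> \<xi> \<in> Arr M" "Src M (tadd M \<psi> \<xi>) = Src M \<psi>" "Tgt M (tadd M \<psi> \<xi>) = testfun M"
    "x \<in> Arr M \<Longrightarrow> Tgt M x = Src M \<psi> \<Longrightarrow> tadd M \<psi> \<xi> \<cdot> x = tadd M (\<psi> \<cdot> x) (\<xi> \<cdot> x)"
    "p \<in> Arr M \<Longrightarrow> Tgt M p = space3 M \<Longrightarrow> Src M p = Src M \<psi> \<Longrightarrow>
      tapp M (tadd M \<psi> \<xi>) p = tapp M \<psi> p \<oplus> tapp M \<xi> p"
proof -
  \<comment> \<open>Naturality needs the computation rule for the restricted test functions too, so typing is
    bundled and both rules are proved for all arguments.\<close>
  define D where "D \<psi> \<xi> \<longleftrightarrow> \<psi> \<in> Arr M \<and> Tgt M \<psi> = testfun M \<and> \<xi> \<in> Arr M \<and> Tgt M \<xi> = testfun M \<and> Src M \<xi> = Src M \<psi>"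
    for \<psi> \<xi>
  have ty: "tadd M \<psi> \<xi> \<in> Arr M" "Src M (tadd M \<psi> \<xi>) = Src M \<psi>" "Tgt M (tadd M \<psi> \<xi>) = testfun M"
    and ap: "x \<in> Arr M \<Longrightarrow> Tgt M x = Src M \<psi> \<Longrightarrow> p \<in> Arr M \<Longrightarrow> Tgt M p = space3 M \<Longrightarrow> Src M p = Src M x \<Longrightarrow>
      tapp M (tadd M \<psi> \<xi> \<cdot> x) p = tapp M (\<psi> \<cdot> x) p \<oplus> tapp M (\<xi> \<cdot> x) p"
    if "D \<psi> \<xi>" for \<psi> \<xi> x p
    using that tabs_simps(1-3)[of "Src M \<psi>" "\<lambda>x p. tapp M (\<psi> \<cdot> x) p \<oplus> tapp M (\<xi> \<cdot> x) p", OF _ refl]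
      tabs_simps(4)[of "Src M \<psi>" "\<lambda>x p. tapp M (\<psi> \<cdot> x) p \<oplus> tapp M (\<xi> \<cdot> x) p" _ x p, OF _ refl]
    by (auto simp: tadd_def D_def)
  have D: "D \<psi> \<xi>" using assms by (simp add: D_def)
  show "tadd M \<psi> \<xi> \<in> Arr M" "Src M (tadd M \<psi> \<xi>) = Src M \<psi>" "Tgt M (tadd M \<psi> \<xi>) = testfun M"
    using ty[OF D] by auto
  show "tapp M (tadd M \<psi> \<xi>) p = tapp M \<psi> p \<oplus> tapp M \<xi> p"
    if "p \<in> Arr M" "Tgt M p = space3 M" "Src M p = Src M \<psi>"
    using ap[OF D, of "Idt M (Src M \<psi>)" p] assms ty[OF D] that by simp
  show "tadd M \<psi> \<xi> \<cdot> x = tadd M (\<psi> \<cdot> x) (\<xi> \<cdot> x)" if x: "x \<in> Arr M" "Tgt M x = Src M \<psi>"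
  proof -
    have D': "D (\<psi> \<cdot> x) (\<xi> \<cdot> x)" using assms x by (simp add: D_def)
    show ?thesis
      by (rule testfun_eqI) (use ty[OF D] ty[OF D'] ap[OF D] ap[OF D'] x assms in auto)
  qed
qed

lemma tscale_simps [simp]:
  assumes "\<psi> \<in> Arr M" "Tgt M \<psi> = testfun M" "a \<in> Arr M" "Tgt M a = R" "Src M a = Src M \<psi>"
  shows "tscale M a \<psi> \<in> Arr M" "Src M (tscale M a \<psi>) = Src M \<psi>" "Tgt M (tscale M a \<psi>) = testfun M"
    "x \<in> Arr M \<Longrightarrow> Tgt M x = Src M \<psi> \<Longrightarrow> tscale M a \<psi> \<cdot> x = tscale M (a \<cdot> x) (\<psi> \<cdot> x)"
    "p \<in> Arr M \<Longrightarrow> Tgt M p = space3 M \<Longrightarrow> Src M p = Src M \<psi> \<Longrightarrow>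
      tapp M (tscale M a \<psi>) p = a \<otimes> tapp M \<psi> p"
proof -
  define D where "D a \<psi> \<longleftrightarrow> \<psi> \<in> Arr M \<and> Tgt M \<psi> = testfun M \<and> a \<in> Arr M \<and> Tgt M a = R \<and> Src M a = Src M \<psi>"
    for \<psi> a
  have ty: "tscale M a \<psi> \<in> Arr M" "Src M (tscale M a \<psi>) = Src M \<psi>" "Tgt M (tscale M a \<psi>) = testfun M"
    and ap: "x \<in> Arr M \<Longrightarrow> Tgt M x = Src M \<psi> \<Longrightarrow> p \<in> Arr M \<Longrightarrow> Tgt M p = space3 M \<Longrightarrow> Src M p = Src M x \<Longrightarrow>
      tapp M (tscale M a \<psi> \<cdot> x) p = (a \<cdot> x) \<otimes> tapp M (\<psi> \<cdot> x) p"
    if "D a \<psi>" for \<psi> a x p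
    using that tabs_simps(1-3)[of "Src M \<psi>" "\<lambda>x p. (a \<cdot> x) \<otimes> tapp M (\<psi> \<cdot> x) p", OF _ refl]
      tabs_simps(4)[of "Src M \<psi>" "\<lambda>x p. (a \<cdot> x) \<otimes> tapp M (\<psi> \<cdot> x) p" _ x p, OF _ refl]
    by (auto simp: tscale_def D_def)
  have D: "D a \<psi>" using assms by (simp add: D_def)
  show "tscale M a \<psi> \<in> Arr M" "Src M (tscale M a \<psi>) = Src M \<psi>" "Tgt M (tscale M a \<psi>) = testfun M"
    using ty[OF D] by auto
  show "tapp M (tscale M a \<psi>) p = a \<otimes> tapp M \<psi> p"
    if "p \<in> Arr M" "Tgt M p = space3 M" "Src M p = Src M \<psi>"
    using ap[OF D, of "Idt M (Src M \<psi>)" p] assms ty[OF D] that by simp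
  show "tscale M a \<psi> \<cdot> x = tscale M (a \<cdot> x) (\<psi> \<cdot> x)" if x: "x \<in> Arr M" "Tgt M x = Src M \<psi>"
  proof -
    have D': "D (a \<cdot> x) (\<psi> \<cdot> x)" using assms x by (simp add: D_def)
    show ?thesis
      by (rule testfun_eqI) (use ty[OF D] ty[OF D'] ap[OF D] ap[OF D'] x assms in auto)
  qed
qed


section \<open>Partial derivatives and the chain rule\<close>

text \<open>The property that characterises \<open>partial M i \<psi>\<close>, with stages read off from sources.\<close>

definition is_partial :: "nat \<Rightarrow> 'a \<Rightarrow> 'a \<Rightarrow> bool" where
  "is_partial i \<psi> \<xi> \<longleftrightarrow> \<xi> \<in> Arr M \<and> Src M \<xi> = Src M \<psi> \<and> Tgt M \<xi> = testfun M \<and>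
     (\<forall>x p d. x \<in> Arr M \<and> Tgt M x = Src M \<psi> \<and> p \<in> Arr M \<and> Tgt M p = space3 M \<and> Src M p = Src M x \<and>
        infinitesimal d \<and> Src M d = Src M x \<longrightarrow>
        tapp M (\<psi> \<cdot> x) (shift3 M i d p) = tapp M (\<psi> \<cdot> x) p \<oplus> (d \<otimes> tapp M (\<xi> \<cdot> x) p))"

lemma partial_alt: "partial M i \<psi> = (THE \<xi>. is_partial i \<psi> \<xi>)"
proof -
  have "(\<xi> \<in> Hom M (Src M \<psi>) (testfun M) \<and>
     (\<forall>Y\<in>Obj M. \<forall>x\<in>Hom M Y (Src M \<psi>). \<forall>p\<in>Hom M Y (space3 M). \<forall>d\<in>infinitesimals M Y.
        tapp M (\<psi> \<cdot> x) (shift3 M i d p) = tapp M (\<psi> \<cdot> x) p \<oplus> (d \<otimes> tapp M (\<xi> \<cdot> x) p)))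
    \<longleftrightarrow> is_partial i \<psi> \<xi>" (is "?L \<longleftrightarrow> ?P") for \<xi>
  proof
    assume L: ?L
    show ?P
      unfolding is_partial_def
    proof (intro conjI allI impI)
      fix x p d assume "x \<in> Arr M \<and> Tgt M x = Src M \<psi> \<and> p \<in> Arr M \<and> Tgt M p = space3 M \<and>
        Src M p = Src M x \<and> infinitesimal d \<and> Src M d = Src M x"
      with L show "tapp M (\<psi> \<cdot> x) (shift3 M i d p) = tapp M (\<psi> \<cdot> x) p \<oplus> (d \<otimes> tapp M (\<xi> \<cdot> x) p)"
        by (elim conjE ballE[of _ _ "Src M x"] ballE[of _ _ x] ballE[of _ _ p] ballE[of _ _ d])
           (auto simp: Hom_iff infinitesimals_iff)
    qed (use L in \<open>auto simp: Hom_iff\<close>)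
  qed (auto simp: is_partial_def Hom_iff infinitesimals_iff)
  then show ?thesis by (simp add: partial_def)
qed

lemma is_partial_unique:
  assumes \<psi>: "\<psi> \<in> Arr M" "Tgt M \<psi> = testfun M" and "is_partial i \<psi> \<xi>" "is_partial i \<psi> \<xi>'"
  shows "\<xi> = \<xi>'"
proof -
  let ?X = "Src M \<psi>"
  have t: "\<xi> \<in> Arr M" "Src M \<xi> = ?X" "Tgt M \<xi> = testfun M" "\<xi>' \<in> Arr M" "Src M \<xi>' = ?X" "Tgt M \<xi>' = testfun M"
    using assms by (auto simp: is_partial_def)
  show ?thesis
  proof (rule testfun_eqI)
    fix x p assume x: "x \<in> Arr M" "Tgt M x = Src M \<xi>" and p: "p \<in> Arr M" "Tgt M p = space3 M" "Src M p = Src M x"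
    show "tapp M (\<xi> \<cdot> x) p = tapp M (\<xi>' \<cdot> x) p"
    proof (rule kl_cancel)
      fix w d assume w: "w \<in> Arr M" "Tgt M w = Src M (tapp M (\<xi> \<cdot> x) p)" and d: "infinitesimal d" "Src M d = Src M w"
      then have w': "Tgt M w = Src M x" using x p t by simp
      have "tapp M (\<psi> \<cdot> (x \<cdot> w)) (p \<cdot> w) \<oplus> (d \<otimes> tapp M (\<xi> \<cdot> (x \<cdot> w)) (p \<cdot> w)) =
          tapp M (\<psi> \<cdot> (x \<cdot> w)) (p \<cdot> w) \<oplus> (d \<otimes> tapp M (\<xi>' \<cdot> (x \<cdot> w)) (p \<cdot> w))"
        using assms(3,4) x p d w(1) w' t unfolding is_partial_def by fastforce
      from radd_cancel[OF this] show "d \<otimes> (tapp M (\<xi> \<cdot> x) p \<cdot> w) = d \<otimes> (tapp M (\<xi>' \<cdot> x) p \<cdot> w)"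
        using x p d w(1) w' t \<psi> by simp
    qed (use t x p in auto)
  qed (use t in auto)
qed

text \<open>At the stage of a generic point \<open>p\<close>, the function \<open>d \<mapsto> \<psi> (p + d e\<^sub>i)\<close> on \<open>D\<close> is affine by the
  Kock-Lawvere axiom. Its slope is an element of the line that depends on \<open>p\<close>, and abstracting over \<open>p\<close>
  gives the derivative.\<close>

lemma is_partial_ex:
  assumes \<psi>: "\<psi> \<in> Arr M" "Tgt M \<psi> = testfun M"
  shows "\<exists>\<xi>. is_partial i \<psi> \<xi>"
proof -
  let ?X = "Src M \<psi>" and ?S = "space3 M"
  let ?W = "Prd M ?X ?S"
  obtain e where e: "is_equalizer M e (Idt M R \<otimes> Idt M R) (rconst M R 0)"
    using ex_equalizer[of "Idt M R \<otimes> Idt M R" R R "rconst M R 0"] by (auto simp: Hom_iff)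
  let ?D = "Src M e"
  have eA: "e \<in> Arr M" "Tgt M e = R" "(Idt M R \<otimes> Idt M R) \<cdot> e = rconst M R 0 \<cdot> e"
    using e by (auto simp: is_equalizer_def)
  \<comment> \<open>By the universal property of \<open>e\<close>, infinitesimals at any stage are elements of \<open>D\<close>.\<close>
  have lift: "\<exists>\<delta>. \<delta> \<in> Arr M \<and> Src M \<delta> = Src M d \<and> Tgt M \<delta> = ?D \<and> e \<cdot> \<delta> = d" if "infinitesimal d" for d
  proof -
    have "(Idt M R \<otimes> Idt M R) \<cdot> d = rconst M R 0 \<cdot> d" using that by simp
    with that e have "\<exists>!h. h \<in> Hom M (Src M d) ?D \<and> e \<cdot> h = d"
      unfolding is_equalizer_def by simp
    then show ?thesis by (auto simp: Hom_iff)
  qed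
  \<comment> \<open>The stage \<open>X \<times> space3\<close> of the generic point is extended by the generic infinitesimal.\<close>
  let ?w = "Pr1 M ?W ?D" and ?d = "e \<cdot> Pr2 M ?W ?D"
  define f where "f = tapp M (\<psi> \<cdot> Pr1 M ?X ?S \<cdot> ?w) (shift3 M i ?d (Pr2 M ?X ?S \<cdot> ?w))"
  have f: "f \<in> Arr M" "Src M f = Prd M ?W ?D" "Tgt M f = R" using \<psi> eA by (auto simp: f_def)
  then have "\<exists>!(a, b). a \<in> Hom M ?W R \<and> b \<in> Hom M ?W R \<and> f = (a \<cdot> ?w) \<oplus> (?d \<otimes> (b \<cdot> ?w))"
    using kock_lawvere e \<psi> unfolding kock_lawvere_def by (simp add: Hom_iff)
  then obtain a b where ab: "a \<in> Arr M" "Src M a = ?W" "Tgt M a = R" "b \<in> Arr M" "Src M b = ?W" "Tgt M b = R"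
    and fab: "f = (a \<cdot> ?w) \<oplus> (?d \<otimes> (b \<cdot> ?w))" by (auto simp: Hom_iff)
  have main: "tapp M (\<psi> \<cdot> x) (shift3 M i d p) = (a \<cdot> pair M x p) \<oplus> (d \<otimes> (b \<cdot> pair M x p))"
    if x: "x \<in> Arr M" "Tgt M x = ?X" and p: "p \<in> Arr M" "Tgt M p = ?S" "Src M p = Src M x"
      and d: "infinitesimal d" "Src M d = Src M x" for x p d
  proof -
    from lift[OF d(1)] obtain \<delta> where \<delta>: "\<delta> \<in> Arr M" "Src M \<delta> = Src M d" "Tgt M \<delta> = ?D" "e \<cdot> \<delta> = d" by blast
    have "f \<cdot> pair M (pair M x p) \<delta> = tapp M (\<psi> \<cdot> x) (shift3 M i d p)"
      using x p d \<delta> \<psi> eA by (simp add: f_def)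
    moreover have "f \<cdot> pair M (pair M x p) \<delta> = (a \<cdot> pair M x p) \<oplus> (d \<otimes> (b \<cdot> pair M x p))"
      unfolding fab using x p d \<delta> \<psi> eA ab by simp
    ultimately show ?thesis by simp
  qed
  define \<xi> where "\<xi> = tabs M ?X (\<lambda>x p. b \<cdot> pair M x p)"
  have \<xi>: "tapp M (\<xi> \<cdot> x) p = b \<cdot> pair M x p"
    if "x \<in> Arr M" "Tgt M x = ?X" "p \<in> Arr M" "Tgt M p = ?S" "Src M p = Src M x" for x p
    using tabs_simps(1-3)[of ?X "\<lambda>x p. b \<cdot> pair M x p" b] tabs_simps(4)[of ?X "\<lambda>x p. b \<cdot> pair M x p" b x p] \<psi> ab that by (auto simp: \<xi>_def)
  have \<xi>t: "\<xi> \<in> Arr M" "Src M \<xi> = ?X" "Tgt M \<xi> = testfun M"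
    using tabs_simps(1-3)[of ?X "\<lambda>x p. b \<cdot> pair M x p" b] \<psi> ab by (auto simp: \<xi>_def)
  have "is_partial i \<psi> \<xi>"
    unfolding is_partial_def
  proof (intro conjI allI impI \<xi>t)
    fix x p d assume as: "x \<in> Arr M \<and> Tgt M x = Src M \<psi> \<and> p \<in> Arr M \<and> Tgt M p = space3 M \<and> Src M p = Src M x \<and>
        infinitesimal d \<and> Src M d = Src M x"
    \<comment> \<open>The constant term is found by taking \<open>d = 0\<close>.\<close>
    have "tapp M (\<psi> \<cdot> x) p = a \<cdot> pair M x p"
      using main[of x p "rconst M (Src M x) 0"] as \<psi> ab by simp
    then show "tapp M (\<psi> \<cdot> x) (shift3 M i d p) = tapp M (\<psi> \<cdot> x) p \<oplus> (d \<otimes> tapp M (\<xi> \<cdot> x) p)"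
      using main[of x p d] \<xi>[of x p] as by simp
  qed
  then show ?thesis ..
qed

lemma partial_is_partial:
  assumes "\<psi> \<in> Arr M" "Tgt M \<psi> = testfun M"
  shows "is_partial i \<psi> (partial M i \<psi>)"
  unfolding partial_alt
  by (rule theI') (use is_partial_ex[OF assms] is_partial_unique[OF assms] in blast)

lemma partial_eqI:
  "\<psi> \<in> Arr M \<Longrightarrow> Tgt M \<psi> = testfun M \<Longrightarrow> is_partial i \<psi> \<xi> \<Longrightarrow> partial M i \<psi> = \<xi>"
  using is_partial_unique partial_is_partial by blast

lemma partial_typing [simp]:
  assumes "\<psi> \<in> Arr M" "Tgt M \<psi> = testfun M"
  shows "partial M i \<psi> \<in> Arr M" "Src M (partial M i \<psi>) = Src M \<psi>" "Tgt M (partial M i \<psi>) = testfun M"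
  using partial_is_partial[OF assms] by (auto simp: is_partial_def)

lemma partial_shift_cmp:
  assumes "\<psi> \<in> Arr M" "Tgt M \<psi> = testfun M" "x \<in> Arr M" "Tgt M x = Src M \<psi>"
    "p \<in> Arr M" "Tgt M p = space3 M" "Src M p = Src M x" "infinitesimal d" "Src M d = Src M x"
  shows "tapp M (\<psi> \<cdot> x) (shift3 M i d p) = tapp M (\<psi> \<cdot> x) p \<oplus> (d \<otimes> tapp M (partial M i \<psi> \<cdot> x) p)"
  using partial_is_partial[OF assms(1,2), of i] assms(3-) unfolding is_partial_def by simp

lemma partial_cmp [simp]:
  assumes "\<psi> \<in> Arr M" "Tgt M \<psi> = testfun M" "z \<in> Arr M" "Tgt M z = Src M \<psi>"
  shows "partial M i \<psi> \<cdot> z = partial M i (\<psi> \<cdot> z)"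
proof (rule partial_eqI[symmetric])
  show "is_partial i (\<psi> \<cdot> z) (partial M i \<psi> \<cdot> z)"
    unfolding is_partial_def
    using assms partial_shift_cmp[of \<psi> "z \<cdot> _"] by auto
qed (use assms in auto)

lemma partial_shift:
  assumes "\<psi> \<in> Arr M" "Tgt M \<psi> = testfun M"
    "p \<in> Arr M" "Tgt M p = space3 M" "Src M p = Src M \<psi>" "infinitesimal d" "Src M d = Src M \<psi>"
  shows "tapp M \<psi> (shift3 M i d p) = tapp M \<psi> p \<oplus> (d \<otimes> tapp M (partial M i \<psi>) p)"
  using partial_shift_cmp[of \<psi> "Idt M (Src M \<psi>)" p d i] assms by simp

lemma partial_tadd [simp]:
  assumes "\<psi> \<in> Arr M" "Tgt M \<psi> = testfun M" "\<xi> \<in> Arr M" "Tgt M \<xi> = testfun M" "Src M \<xi> = Src M \<psi>"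
  shows "partial M i (tadd M \<psi> \<xi>) = tadd M (partial M i \<psi>) (partial M i \<xi>)"
proof (rule partial_eqI)
  show "is_partial i (tadd M \<psi> \<xi>) (tadd M (partial M i \<psi>) (partial M i \<xi>))"
    unfolding is_partial_def using assms by (auto simp: partial_shift[of "\<psi> \<cdot> _"] partial_shift[of "\<xi> \<cdot> _"] rsimps)
qed (use assms in auto)

lemma partial_tscale [simp]:
  assumes "\<psi> \<in> Arr M" "Tgt M \<psi> = testfun M" "a \<in> Arr M" "Tgt M a = R" "Src M a = Src M \<psi>"
  shows "partial M i (tscale M a \<psi>) = tscale M a (partial M i \<psi>)"
proof (rule partial_eqI)
  show "is_partial i (tscale M a \<psi>) (tscale M a (partial M i \<psi>))"
    unfolding is_partial_def using assms by (auto simp: partial_shift[of "\<psi> \<cdot> _"] rsimps)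
qed (use assms in auto)

lemma laplace_simps [simp]:
  assumes "\<psi> \<in> Arr M" "Tgt M \<psi> = testfun M"
  shows "laplace M \<psi> \<in> Arr M" "Src M (laplace M \<psi>) = Src M \<psi>" "Tgt M (laplace M \<psi>) = testfun M"
    "z \<in> Arr M \<Longrightarrow> Tgt M z = Src M \<psi> \<Longrightarrow> laplace M \<psi> \<cdot> z = laplace M (\<psi> \<cdot> z)"
  using assms by (simp_all add: laplace_def)

lemma tapp_laplace:
  assumes "\<psi> \<in> Arr M" "Tgt M \<psi> = testfun M" "p \<in> Arr M" "Tgt M p = space3 M" "Src M p = Src M \<psi>"
  shows "tapp M (laplace M \<psi>) p = tapp M (partial M 0 (partial M 0 \<psi>)) p \<oplus>
    (tapp M (partial M 1 (partial M 1 \<psi>)) p \<oplus> tapp M (partial M 2 (partial M 2 \<psi>)) p)"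
  using assms by (simp add: laplace_def rsimps)

lemma laplace_tadd:
  assumes "\<psi> \<in> Arr M" "Tgt M \<psi> = testfun M" "\<xi> \<in> Arr M" "Tgt M \<xi> = testfun M" "Src M \<xi> = Src M \<psi>"
  shows "laplace M (tadd M \<psi> \<xi>) = tadd M (laplace M \<psi>) (laplace M \<xi>)"
  by (rule testfun_eqI) (use assms in \<open>auto simp: tapp_laplace rsimps\<close>)

lemma laplace_tscale:
  assumes "\<psi> \<in> Arr M" "Tgt M \<psi> = testfun M" "a \<in> Arr M" "Tgt M a = R" "Src M a = Src M \<psi>"
  shows "laplace M (tscale M a \<psi>) = tscale M a (laplace M \<psi>)"
  by (rule testfun_eqI) (use assms in \<open>auto simp: tapp_laplace rsimps\<close>)

text \<open>The point is moved one coordinate at a time. Moving the other coordinates inside a partial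
  derivative changes it by a multiple of \<open>d\<close>, which the factor \<open>d\<close> in front annihilates.\<close>

lemma chain_rule:
  assumes \<psi>: "\<psi> \<in> Arr M" "Tgt M \<psi> = testfun M"
    and a: "a \<in> Arr M" "Tgt M a = R" "Src M a = Src M \<psi>"
    and b: "b \<in> Arr M" "Tgt M b = R" "Src M b = Src M \<psi>"
    and c: "c \<in> Arr M" "Tgt M c = R" "Src M c = Src M \<psi>"
    and u: "u \<in> Arr M" "Tgt M u = R" "Src M u = Src M \<psi>"
    and v: "v \<in> Arr M" "Tgt M v = R" "Src M v = Src M \<psi>"
    and w: "w \<in> Arr M" "Tgt M w = R" "Src M w = Src M \<psi>"
    and d: "infinitesimal d" "Src M d = Src M \<psi>"
  shows "tapp M \<psi> (point3 M (a \<oplus> (d \<otimes> u)) (b \<oplus> (d \<otimes> v)) (c \<oplus> (d \<otimes> w))) =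
    tapp M \<psi> (point3 M a b c) \<oplus> (d \<otimes> ((u \<otimes> tapp M (partial M 0 \<psi>) (point3 M a b c)) \<oplus>
      ((v \<otimes> tapp M (partial M 1 \<psi>) (point3 M a b c)) \<oplus> (w \<otimes> tapp M (partial M 2 \<psi>) (point3 M a b c)))))"
proof -
  have du: "infinitesimal (d \<otimes> u)" "infinitesimal (d \<otimes> v)" "infinitesimal (d \<otimes> w)"
    using infinitesimal_mult[of d] d u v w by auto
  have inf: "(d \<otimes> u) \<otimes> (d \<otimes> u) = rconst M (Src M \<psi>) 0" "(d \<otimes> v) \<otimes> (d \<otimes> v) = rconst M (Src M \<psi>) 0"
    "(d \<otimes> w) \<otimes> (d \<otimes> w) = rconst M (Src M \<psi>) 0" using du d u v w by auto
  have s0: "tapp M \<eta> (point3 M (a \<oplus> (d \<otimes> u)) y z) =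
      tapp M \<eta> (point3 M a y z) \<oplus> ((d \<otimes> u) \<otimes> tapp M (partial M 0 \<eta>) (point3 M a y z))"
    if "\<eta> \<in> Arr M" "Tgt M \<eta> = testfun M" "Src M \<eta> = Src M \<psi>" "y \<in> Arr M" "Tgt M y = R" "Src M y = Src M \<psi>"
      "z \<in> Arr M" "Tgt M z = R" "Src M z = Src M \<psi>" for \<eta> y z
    using partial_shift[of \<eta> "point3 M a y z" "d \<otimes> u" 0] that a d u du by (simp add: shift3_point3)
  have s1: "tapp M \<eta> (point3 M x (b \<oplus> (d \<otimes> v)) z) =
      tapp M \<eta> (point3 M x b z) \<oplus> ((d \<otimes> v) \<otimes> tapp M (partial M 1 \<eta>) (point3 M x b z))"
    if "\<eta> \<in> Arr M" "Tgt M \<eta> = testfun M" "Src M \<eta> = Src M \<psi>" "x \<in> Arr M" "Tgt M x = R" "Src M x = Src M \<psi>"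
      "z \<in> Arr M" "Tgt M z = R" "Src M z = Src M \<psi>" for \<eta> x z
    using partial_shift[of \<eta> "point3 M x b z" "d \<otimes> v" 1] that b d v du by (simp add: shift3_point3)
  have s2: "tapp M \<eta> (point3 M x y (c \<oplus> (d \<otimes> w))) =
      tapp M \<eta> (point3 M x y c) \<oplus> ((d \<otimes> w) \<otimes> tapp M (partial M 2 \<eta>) (point3 M x y c))"
    if "\<eta> \<in> Arr M" "Tgt M \<eta> = testfun M" "Src M \<eta> = Src M \<psi>" "x \<in> Arr M" "Tgt M x = R" "Src M x = Src M \<psi>"
      "y \<in> Arr M" "Tgt M y = R" "Src M y = Src M \<psi>" for \<eta> x y
    using partial_shift[of \<eta> "point3 M x y c" "d \<otimes> w" 2] that c d w du by (simp add: shift3_point3)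
  show ?thesis
    using \<psi> a b c u v w d
    by (simp add: s0 s1 s2 rsimps infinitesimal_square)
qed


section \<open>The integral and the fundamental theorem\<close>

definition has_deriv :: "'o \<Rightarrow> 'a \<Rightarrow> 'a \<Rightarrow> bool" where
  "has_deriv X g f \<longleftrightarrow> X \<in> Obj M \<and> g \<in> Arr M \<and> Src M g = Prd M X R \<and> Tgt M g = R \<and>
     f \<in> Arr M \<and> Src M f = Prd M X R \<and> Tgt M f = R \<and>
     (\<forall>x r d. x \<in> Arr M \<and> Tgt M x = X \<and> r \<in> Arr M \<and> Tgt M r = R \<and> Src M r = Src M x \<and>
        infinitesimal d \<and> Src M d = Src M x \<longrightarrow>
        g \<cdot> pair M x (r \<oplus> d) = (g \<cdot> pair M x r) \<oplus> (d \<otimes> (f \<cdot> pair M x r)))"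

lemma has_derivI:
  assumes "X \<in> Obj M" "g \<in> Arr M" "Src M g = Prd M X R" "Tgt M g = R"
    "f \<in> Arr M" "Src M f = Prd M X R" "Tgt M f = R"
    "\<And>x r d. x \<in> Arr M \<Longrightarrow> Tgt M x = X \<Longrightarrow> r \<in> Arr M \<Longrightarrow> Tgt M r = R \<Longrightarrow> Src M r = Src M x \<Longrightarrow>
        infinitesimal d \<Longrightarrow> Src M d = Src M x \<Longrightarrow>
        g \<cdot> pair M x (r \<oplus> d) = (g \<cdot> pair M x r) \<oplus> (d \<otimes> (f \<cdot> pair M x r))"
  shows "has_deriv X g f"
  unfolding has_deriv_def using assms by blast

lemma has_derivD:
  assumes "has_deriv X g f"
  shows "X \<in> Obj M" "g \<in> Arr M" "Src M g = Prd M X R" "Tgt M g = R"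
    "f \<in> Arr M" "Src M f = Prd M X R" "Tgt M f = R"
    "\<And>x r d. x \<in> Arr M \<Longrightarrow> Tgt M x = X \<Longrightarrow> r \<in> Arr M \<Longrightarrow> Tgt M r = R \<Longrightarrow> Src M r = Src M x \<Longrightarrow>
        infinitesimal d \<Longrightarrow> Src M d = Src M x \<Longrightarrow>
        g \<cdot> pair M x (r \<oplus> d) = (g \<cdot> pair M x r) \<oplus> (d \<otimes> (f \<cdot> pair M x r))"
  using assms unfolding has_deriv_def by blast+

lemma is_derivative_iff:
  assumes "X \<in> Obj M" "g \<in> Hom M (Prd M X R) R"
  shows "is_derivative M X g f \<longleftrightarrow> has_deriv X g f"
proof
  assume L: "is_derivative M X g f"
  show "has_deriv X g f"
  proof (rule has_derivI)
    fix x r d assume "x \<in> Arr M" "Tgt M x = X" "r \<in> Arr M" "Tgt M r = R" "Src M r = Src M x"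
        "infinitesimal d" "Src M d = Src M x"
    then have "Src M x \<in> Obj M" "x \<in> Hom M (Src M x) X" "r \<in> Hom M (Src M x) R"
      "d \<in> infinitesimals M (Src M x)" by (auto simp: Hom_iff infinitesimals_iff)
    with L show "g \<cdot> pair M x (r \<oplus> d) = (g \<cdot> pair M x r) \<oplus> (d \<otimes> (f \<cdot> pair M x r))"
      unfolding is_derivative_def by blast
  qed (use L assms in \<open>auto simp: is_derivative_def Hom_iff\<close>)
next
  assume "has_deriv X g f"
  then show "is_derivative M X g f"
    by (auto simp: is_derivative_def has_deriv_def Hom_iff infinitesimals_iff)
qed

lemma is_antiderivative_iff:
  assumes "X \<in> Obj M"
  shows "is_antiderivative M X f a c g \<longleftrightarrow> has_deriv X g f \<and> g \<cdot> pair M (Idt M X) a = c"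
  using is_derivative_iff[OF assms, of g f]
  by (auto simp: is_antiderivative_def has_deriv_def Hom_iff)

text \<open>The integral of an arrow out of \<open>X \<times> R\<close>, that is, of a function of one variable at stage \<open>X\<close>
  given by its value at the generic element.\<close>

definition integ :: "'o \<Rightarrow> 'a \<Rightarrow> 'a \<Rightarrow> 'a \<Rightarrow> 'a" where
  "integ X a b f = (THE g. is_antiderivative M X f a (rconst M X 0) g) \<cdot> pair M (Idt M X) b"

lemma integral_op_integ: "integral_op M X a b F = integ X a b (F (Pr1 M X R) (Pr2 M X R))"
  by (simp add: integral_op_def integ_def)

definition integrand :: "'o \<Rightarrow> 'a \<Rightarrow> 'a \<Rightarrow> 'a \<Rightarrow> bool" where
  "integrand X a b f \<longleftrightarrow> X \<in> Obj M \<and> a \<in> Arr M \<and> Src M a = X \<and> Tgt M a = R \<and>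
     b \<in> Arr M \<and> Src M b = X \<and> Tgt M b = R \<and> f \<in> Arr M \<and> Src M f = Prd M X R \<and> Tgt M f = R"

lemma ex1_primitive:
  assumes "integrand X a b f"
  shows "\<exists>!g. has_deriv X g f \<and> g \<cdot> pair M (Idt M X) a = rconst M X 0"
proof -
  have X: "X \<in> Obj M" using assms by (simp add: integrand_def)
  have "f \<in> Hom M (Prd M X R) R" "a \<in> Hom M X R" "rconst M X 0 \<in> Hom M X R"
    using assms by (auto simp: integrand_def Hom_iff)
  with X integration_axiom have "\<exists>!g. is_antiderivative M X f a (rconst M X 0) g"
    unfolding integration_axiom_def by blast
  then show ?thesis by (simp add: is_antiderivative_iff[OF X])
qed

lemma has_deriv_primitive:
  assumes "integrand X a b f"
  obtains g where "has_deriv X g f"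
  using ex1_primitive[OF assms] by blast

text \<open>The fundamental theorem of calculus: subtracting the constant \<open>g a\<close> from an antiderivative \<open>g\<close>
  gives the one that vanishes at \<open>a\<close>, which is unique.\<close>

lemma integ_eq:
  assumes "has_deriv X g f" and a: "a \<in> Arr M" "Src M a = X" "Tgt M a = R"
    and b: "b \<in> Arr M" "Src M b = X" "Tgt M b = R"
  shows "integ X a b f = (g \<cdot> pair M (Idt M X) b) \<oplus> rneg (g \<cdot> pair M (Idt M X) a)"
proof -
  note g = has_derivD[OF assms(1)]
  define ga where "ga = rneg (g \<cdot> pair M (Idt M X) a)"
  define h where "h = g \<oplus> (ga \<cdot> Pr1 M X R)"
  have ga: "ga \<in> Arr M" "Src M ga = X" "Tgt M ga = R" using g a by (simp_all add: ga_def)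
  have "integrand X a b f" using g a b by (simp add: integrand_def)
  from ex1_primitive[OF this] have ex1: "\<exists>!g. is_antiderivative M X f a (rconst M X 0) g"
    using g(1) by (simp add: is_antiderivative_iff)
  have "has_deriv X h f"
  proof (rule has_derivI)
    fix x r d assume "x \<in> Arr M" "Tgt M x = X" "r \<in> Arr M" "Tgt M r = R" "Src M r = Src M x"
        "infinitesimal d" "Src M d = Src M x"
    then show "h \<cdot> pair M x (r \<oplus> d) = (h \<cdot> pair M x r) \<oplus> (d \<otimes> (f \<cdot> pair M x r))"
      using g(1-7) g(8)[of x r d] ga by (simp add: h_def rsimps)
  qed (use g(1-7) ga in \<open>simp_all add: h_def\<close>)
  moreover have "h \<cdot> pair M (Idt M X) a = rconst M X 0"
    using g(1-7) a ga by (simp add: h_def) (simp add: ga_def)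
  ultimately have "is_antiderivative M X f a (rconst M X 0) h"
    using g(1) by (simp add: is_antiderivative_iff)
  with ex1 have "(THE g. is_antiderivative M X f a (rconst M X 0) g) = h" by (rule the1_equality)
  then show ?thesis using g(1-7) b ga by (simp add: integ_def h_def) (simp add: ga_def)
qed

lemma integ_typing [simp]:
  assumes "X \<in> Obj M" "a \<in> Arr M" "Src M a = X" "Tgt M a = R" "b \<in> Arr M" "Src M b = X" "Tgt M b = R"
    "f \<in> Arr M" "Src M f = Prd M X R" "Tgt M f = R"
  shows "integ X a b f \<in> Arr M" "Src M (integ X a b f) = X" "Tgt M (integ X a b f) = R"
proof -
  have "integrand X a b f" using assms by (simp add: integrand_def)
  then obtain g where g: "has_deriv X g f" by (rule has_deriv_primitive)
  then show "integ X a b f \<in> Arr M" "Src M (integ X a b f) = X" "Tgt M (integ X a b f) = R"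
    using has_derivD(1-7)[OF g] assms by (simp_all add: integ_eq[OF g])
qed

text \<open>An antiderivative restricts to an antiderivative at any later stage.\<close>

lemma integ_cmp [simp]:
  assumes "X \<in> Obj M" "a \<in> Arr M" "Src M a = X" "Tgt M a = R" "b \<in> Arr M" "Src M b = X" "Tgt M b = R"
    "f \<in> Arr M" "Src M f = Prd M X R" "Tgt M f = R" and z: "z \<in> Arr M" "Tgt M z = X"
  shows "integ X a b f \<cdot> z =
    integ (Src M z) (a \<cdot> z) (b \<cdot> z) (f \<cdot> pair M (z \<cdot> Pr1 M (Src M z) R) (Pr2 M (Src M z) R))"
proof -
  let ?z = "pair M (z \<cdot> Pr1 M (Src M z) R) (Pr2 M (Src M z) R)"
  have "integrand X a b f" using assms by (simp add: integrand_def)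
  then obtain g where g: "has_deriv X g f" by (rule has_deriv_primitive)
  note g' = has_derivD[OF g]
  have gz: "has_deriv (Src M z) (g \<cdot> ?z) (f \<cdot> ?z)"
    by (rule has_derivI) (use g' assms in simp_all)
  show ?thesis
    using g'(1-7) assms by (simp add: integ_eq[OF g] integ_eq[OF gz])
qed

lemma integ_add:
  assumes "X \<in> Obj M" "a \<in> Arr M" "Src M a = X" "Tgt M a = R" "b \<in> Arr M" "Src M b = X" "Tgt M b = R"
    "f \<in> Arr M" "Src M f = Prd M X R" "Tgt M f = R" "f' \<in> Arr M" "Src M f' = Prd M X R" "Tgt M f' = R"
  shows "integ X a b (f \<oplus> f') = integ X a b f \<oplus> integ X a b f'"
proof -
  have "integrand X a b f" "integrand X a b f'" using assms by (simp_all add: integrand_def)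
  then obtain g h where g: "has_deriv X g f" and h: "has_deriv X h f'"
    using has_deriv_primitive by metis
  note g' = has_derivD[OF g] and h' = has_derivD[OF h]
  have gh: "has_deriv X (g \<oplus> h) (f \<oplus> f')"
    by (rule has_derivI) (use g' h' assms in \<open>simp_all add: rsimps\<close>)
  show ?thesis
    using g'(1-7) h'(1-7) assms by (simp add: integ_eq[OF g] integ_eq[OF h] integ_eq[OF gh] rsimps)
qed

lemma integ_scale:
  assumes "X \<in> Obj M" "a \<in> Arr M" "Src M a = X" "Tgt M a = R" "b \<in> Arr M" "Src M b = X" "Tgt M b = R"
    "f \<in> Arr M" "Src M f = Prd M X R" "Tgt M f = R" and c: "c \<in> Arr M" "Src M c = X" "Tgt M c = R"
  shows "integ X a b ((c \<cdot> Pr1 M X R) \<otimes> f) = c \<otimes> integ X a b f"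
proof -
  have "integrand X a b f" using assms by (simp_all add: integrand_def)
  then obtain g where g: "has_deriv X g f" by (rule has_deriv_primitive)
  note g' = has_derivD[OF g]
  have gh: "has_deriv X ((c \<cdot> Pr1 M X R) \<otimes> g) ((c \<cdot> Pr1 M X R) \<otimes> f)"
    by (rule has_derivI) (use g' assms in \<open>simp_all add: rsimps\<close>)
  show ?thesis
    unfolding integ_eq[OF g assms(2-7)] integ_eq[OF gh assms(2-7)]
    using g'(1-7) assms by (simp add: rsimps)
qed

lemma integ_zero [simp]:
  assumes "X \<in> Obj M" "a \<in> Arr M" "Src M a = X" "Tgt M a = R" "b \<in> Arr M" "Src M b = X" "Tgt M b = R"
    "Y = Prd M X R"
  shows "integ X a b (rconst M Y 0) = rconst M X 0"
proof -
  have "has_deriv X (rconst M Y 0) (rconst M Y 0)"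
    by (rule has_derivI) (use assms in simp_all)
  from integ_eq[OF this] show ?thesis using assms by simp
qed


section \<open>Integrals over the sphere\<close>

lemma infinitesimal_cmp_square [simp]:
  "d \<otimes> d = rconst M (Src M d) 0 \<Longrightarrow> d \<in> Arr M \<Longrightarrow> Tgt M d = R \<Longrightarrow> z \<in> Arr M \<Longrightarrow> Tgt M z = Src M d \<Longrightarrow>
    (d \<cdot> z) \<otimes> (d \<cdot> z) = rconst M (Src M z) 0"
  using infinitesimal_cmp[of d z] by simp

abbreviation test :: "'a \<Rightarrow> bool" where
  "test \<psi> \<equiv> \<psi> \<in> Arr M \<and> Tgt M \<psi> = testfun M"

abbreviation real_at :: "'o \<Rightarrow> 'a \<Rightarrow> bool" where
  "real_at X a \<equiv> a \<in> Arr M \<and> Tgt M a = R \<and> Src M a = X"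

definition double_integral :: "'o \<Rightarrow> 'a \<Rightarrow> 'a" where
  "double_integral Y k = integ Y (rconst M Y 0) (rconst M Y pi)
     (integ (Prd M Y R) (rconst M (Prd M Y R) 0) (rconst M (Prd M Y R) (2 * pi)) k)"

text \<open>The stage \<open>(Y \<times> R) \<times> R\<close> carries the generic pair of angles, with the polar angle \<open>\<phi>\<close> in the inner factor
  because it is the outer variable of integration.\<close>

abbreviation base :: "'o \<Rightarrow> 'a" where
  "base Y \<equiv> Pr1 M Y R \<cdot> Pr1 M (Prd M Y R) R"

abbreviation azimuth :: "'o \<Rightarrow> 'a" where
  "azimuth Y \<equiv> Pr2 M (Prd M Y R) R"

abbreviation polar :: "'o \<Rightarrow> 'a" where
  "polar Y \<equiv> Pr2 M Y R \<cdot> Pr1 M (Prd M Y R) R"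

lemma double_integral_simps [simp]:
  assumes "Y \<in> Obj M" "k \<in> Arr M" "Src M k = Prd M (Prd M Y R) R" "Tgt M k = R"
  shows "double_integral Y k \<in> Arr M" "Src M (double_integral Y k) = Y" "Tgt M (double_integral Y k) = R"
    "z \<in> Arr M \<Longrightarrow> Tgt M z = Y \<Longrightarrow> double_integral Y k \<cdot> z =
      double_integral (Src M z) (k \<cdot> pair M (pair M (z \<cdot> base (Src M z)) (polar (Src M z))) (azimuth (Src M z)))"
  using assms by (simp_all add: double_integral_def)

lemma double_integral_add:
  assumes "Y \<in> Obj M" "k \<in> Arr M" "Src M k = Prd M (Prd M Y R) R" "Tgt M k = R"
    "l \<in> Arr M" "Src M l = Prd M (Prd M Y R) R" "Tgt M l = R"
  shows "double_integral Y (k \<oplus> l) = double_integral Y k \<oplus> double_integral Y l"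
  using assms by (simp add: double_integral_def integ_add)

lemma double_integral_scale:
  assumes "Y \<in> Obj M" "k \<in> Arr M" "Src M k = Prd M (Prd M Y R) R" "Tgt M k = R"
    "c \<in> Arr M" "Src M c = Y" "Tgt M c = R"
  shows "double_integral Y ((c \<cdot> base Y) \<otimes> k) = c \<otimes> double_integral Y k"
  using assms integ_scale[of "Prd M Y R" "rconst M (Prd M Y R) 0" "rconst M (Prd M Y R) (2 * pi)" k "c \<cdot> Pr1 M Y R"]
    integ_scale[of Y "rconst M Y 0" "rconst M Y pi"
      "integ (Prd M Y R) (rconst M (Prd M Y R) 0) (rconst M (Prd M Y R) (2 * pi)) k" c]
  by (simp add: double_integral_def)

text \<open>An integrand on the sphere: a natural operation on a test function, a radius and the two angles.
  Naturality makes it determined by its value at the generic angles.\<close>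

definition density :: "('a \<Rightarrow> 'a \<Rightarrow> 'a \<Rightarrow> 'a \<Rightarrow> 'a) \<Rightarrow> bool" where
  "density k \<longleftrightarrow> (\<forall>\<psi> r \<theta> \<phi>. test \<psi> \<and> real_at (Src M \<psi>) r \<and> real_at (Src M \<psi>) \<theta> \<and> real_at (Src M \<psi>) \<phi> \<longrightarrow>
     real_at (Src M \<psi>) (k \<psi> r \<theta> \<phi>) \<and>
     (\<forall>z. z \<in> Arr M \<and> Tgt M z = Src M \<psi> \<longrightarrow> k \<psi> r \<theta> \<phi> \<cdot> z = k (\<psi> \<cdot> z) (r \<cdot> z) (\<theta> \<cdot> z) (\<phi> \<cdot> z)))"

lemma densityD:
  assumes "density k" "test \<psi>" "real_at (Src M \<psi>) r" "real_at (Src M \<psi>) \<theta>" "real_at (Src M \<psi>) \<phi>"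
  shows "k \<psi> r \<theta> \<phi> \<in> Arr M" "Src M (k \<psi> r \<theta> \<phi>) = Src M \<psi>" "Tgt M (k \<psi> r \<theta> \<phi>) = R"
    "z \<in> Arr M \<Longrightarrow> Tgt M z = Src M \<psi> \<Longrightarrow> k \<psi> r \<theta> \<phi> \<cdot> z = k (\<psi> \<cdot> z) (r \<cdot> z) (\<theta> \<cdot> z) (\<phi> \<cdot> z)"
  using assms unfolding density_def by blast+

definition sphere_integral :: "('a \<Rightarrow> 'a \<Rightarrow> 'a \<Rightarrow> 'a \<Rightarrow> 'a) \<Rightarrow> 'a \<Rightarrow> 'a \<Rightarrow> 'a" where
  "sphere_integral k \<psi> t = (let Y = Src M \<psi> in double_integral Y (k (\<psi> \<cdot> base Y) (t \<cdot> base Y) (azimuth Y) (polar Y)))"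

lemma sphere_integral_typing:
  assumes "density k" "test \<psi>" "real_at (Src M \<psi>) t"
  shows "sphere_integral k \<psi> t \<in> Arr M" "Src M (sphere_integral k \<psi> t) = Src M \<psi>" "Tgt M (sphere_integral k \<psi> t) = R"
    "z \<in> Arr M \<Longrightarrow> Tgt M z = Src M \<psi> \<Longrightarrow> sphere_integral k \<psi> t \<cdot> z = sphere_integral k (\<psi> \<cdot> z) (t \<cdot> z)"
  using assms(2,3) densityD[OF assms(1)] by (simp_all add: sphere_integral_def Let_def)

text \<open>Equality at all stages includes equality at the generic angles.\<close>

lemma sphere_integral_cong:
  assumes "\<And>\<psi> r \<theta> \<phi>. test \<psi> \<Longrightarrow> real_at (Src M \<psi>) r \<Longrightarrow> real_at (Src M \<psi>) \<theta> \<Longrightarrow> real_at (Src M \<psi>) \<phi> \<Longrightarrow>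
      k \<psi> r \<theta> \<phi> = l \<psi> r \<theta> \<phi>"
    and "test \<psi>" "real_at (Src M \<psi>) t"
  shows "sphere_integral k \<psi> t = sphere_integral l \<psi> t"
  using assms(2,3) assms(1)[of "\<psi> \<cdot> base (Src M \<psi>)"] by (simp add: sphere_integral_def Let_def)

lemma sphere_integral_add:
  assumes "density k" "density l" "test \<psi>" "real_at (Src M \<psi>) t"
  shows "sphere_integral (\<lambda>\<psi> r \<theta> \<phi>. k \<psi> r \<theta> \<phi> \<oplus> l \<psi> r \<theta> \<phi>) \<psi> t = sphere_integral k \<psi> t \<oplus> sphere_integral l \<psi> t"
  using assms(3,4) densityD[OF assms(1)] densityD[OF assms(2)] by (simp add: sphere_integral_def Let_def double_integral_add)

lemma sphere_integral_scale:
  assumes "density k" "test \<psi>" "real_at (Src M \<psi>) t"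
  shows "sphere_integral (\<lambda>\<psi> r \<theta> \<phi>. r \<otimes> k \<psi> r \<theta> \<phi>) \<psi> t = t \<otimes> sphere_integral k \<psi> t"
  using assms(2,3) densityD[OF assms(1)] by (simp add: sphere_integral_def Let_def double_integral_scale)

text \<open>Differentiation under the integral sign. The integrand at radius \<open>t + d\<close> is an exact sum, so only
  linearity of the integral is used.\<close>

lemma sphere_integral_radial_deriv:
  assumes "density k" "density k'"
    and "\<And>\<psi> r \<theta> \<phi> d. test \<psi> \<Longrightarrow> real_at (Src M \<psi>) r \<Longrightarrow> real_at (Src M \<psi>) \<theta> \<Longrightarrow> real_at (Src M \<psi>) \<phi> \<Longrightarrow>
      infinitesimal d \<Longrightarrow> Src M d = Src M \<psi> \<Longrightarrow> k \<psi> (r \<oplus> d) \<theta> \<phi> = k \<psi> r \<theta> \<phi> \<oplus> (d \<otimes> k' \<psi> r \<theta> \<phi>)"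
    and "test \<psi>" "real_at (Src M \<psi>) t" "infinitesimal d" "Src M d = Src M \<psi>"
  shows "sphere_integral k \<psi> (t \<oplus> d) = sphere_integral k \<psi> t \<oplus> (d \<otimes> sphere_integral k' \<psi> t)"
  using assms(4-) densityD[OF assms(1)] densityD[OF assms(2)]
  by (simp add: sphere_integral_def Let_def double_integral_scale double_integral_add assms(3))

lemma sphere_integral_azimuthal_deriv:
  assumes "density g" "density h"
    and deriv: "\<And>\<psi> r \<theta> \<phi> d. test \<psi> \<Longrightarrow> real_at (Src M \<psi>) r \<Longrightarrow> real_at (Src M \<psi>) \<theta> \<Longrightarrow> real_at (Src M \<psi>) \<phi> \<Longrightarrow>
      infinitesimal d \<Longrightarrow> Src M d = Src M \<psi> \<Longrightarrow> g \<psi> r (\<theta> \<oplus> d) \<phi> = g \<psi> r \<theta> \<phi> \<oplus> (d \<otimes> h \<psi> r \<theta> \<phi>)"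
    and periodic: "\<And>\<psi> r \<phi>. test \<psi> \<Longrightarrow> real_at (Src M \<psi>) r \<Longrightarrow> real_at (Src M \<psi>) \<phi> \<Longrightarrow>
      g \<psi> r (rconst M (Src M \<psi>) (2 * pi)) \<phi> = g \<psi> r (rconst M (Src M \<psi>) 0) \<phi>"
    and "test \<psi>" "real_at (Src M \<psi>) t"
  shows "sphere_integral h \<psi> t = rconst M (Src M \<psi>) 0"
proof -
  let ?Y = "Src M \<psi>"
  let ?Z = "Prd M ?Y R"
  note g = densityD[OF assms(1)] and h = densityD[OF assms(2)]
  let ?at = "\<lambda>k. k (\<psi> \<cdot> base ?Y) (t \<cdot> base ?Y) (azimuth ?Y) (polar ?Y)"
  have d: "has_deriv ?Z (?at g) (?at h)"
    by (rule has_derivI) (use assms(5,6) g h deriv in simp_all)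
  have "integ ?Z (rconst M ?Z 0) (rconst M ?Z (2 * pi)) (?at h) = rconst M ?Z 0"
    using integ_eq[OF d, of "rconst M ?Z 0" "rconst M ?Z (2 * pi)"] assms(5,6) g
      periodic[of "\<psi> \<cdot> Pr1 M ?Y R" "t \<cdot> Pr1 M ?Y R" "Pr2 M ?Y R"] by simp
  then show ?thesis using assms(5,6) by (simp add: sphere_integral_def Let_def double_integral_def)
qed

text \<open>The polar angle is the outer variable of integration, so that its derivative is first taken out of
  the integral over \<open>\<theta>\<close>, which spares an exchange of the two integrals.\<close>

lemma sphere_integral_polar_deriv:
  assumes "density g" "density h"
    and deriv: "\<And>\<psi> r \<theta> \<phi> d. test \<psi> \<Longrightarrow> real_at (Src M \<psi>) r \<Longrightarrow> real_at (Src M \<psi>) \<theta> \<Longrightarrow> real_at (Src M \<psi>) \<phi> \<Longrightarrow>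
      infinitesimal d \<Longrightarrow> Src M d = Src M \<psi> \<Longrightarrow> g \<psi> r \<theta> (\<phi> \<oplus> d) = g \<psi> r \<theta> \<phi> \<oplus> (d \<otimes> h \<psi> r \<theta> \<phi>)"
    and poles: "\<And>\<psi> r \<theta>. test \<psi> \<Longrightarrow> real_at (Src M \<psi>) r \<Longrightarrow> real_at (Src M \<psi>) \<theta> \<Longrightarrow>
      g \<psi> r \<theta> (rconst M (Src M \<psi>) 0) = rconst M (Src M \<psi>) 0 \<and>
      g \<psi> r \<theta> (rconst M (Src M \<psi>) pi) = rconst M (Src M \<psi>) 0"
    and "test \<psi>" "real_at (Src M \<psi>) t"
  shows "sphere_integral h \<psi> t = rconst M (Src M \<psi>) 0"
proof -
  let ?Y = "Src M \<psi>"
  let ?Z = "Prd M ?Y R"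
  note g = densityD[OF assms(1)] and h = densityD[OF assms(2)]
  let ?at = "\<lambda>k. k (\<psi> \<cdot> base ?Y) (t \<cdot> base ?Y) (azimuth ?Y) (polar ?Y)"
  let ?int = "integ ?Z (rconst M ?Z 0) (rconst M ?Z (2 * pi))"
  have d: "has_deriv ?Y (?int (?at g)) (?int (?at h))"
    by (rule has_derivI) (use assms(5,6) g h deriv in \<open>simp_all add: integ_add integ_scale\<close>)
  have "integ ?Y (rconst M ?Y 0) (rconst M ?Y pi) (?int (?at h)) = rconst M ?Y 0"
    using integ_eq[OF d, of "rconst M ?Y 0" "rconst M ?Y pi"] assms(5,6) g
      poles[of "\<psi> \<cdot> Pr1 M ?Y R" "t \<cdot> Pr1 M ?Y R" "Pr2 M ?Y R"] by simp
  then show ?thesis using assms(5,6) by (simp add: sphere_integral_def Let_def double_integral_def)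
qed


section \<open>Directional derivatives\<close>

text \<open>The inner product of \<open>(u, v, w)\<close> and \<open>(p, q, s)\<close>. It has a name of its own because both the
  gradient and the Hessian are built from it.\<close>

definition lin3 :: "'a \<Rightarrow> 'a \<Rightarrow> 'a \<Rightarrow> 'a \<Rightarrow> 'a \<Rightarrow> 'a \<Rightarrow> 'a" where
  "lin3 p q s u v w = (u \<otimes> p) \<oplus> ((v \<otimes> q) \<oplus> (w \<otimes> s))"

definition grad :: "'a \<Rightarrow> 'a \<Rightarrow> 'a \<Rightarrow> 'a \<Rightarrow> 'a \<Rightarrow> 'a" where
  "grad \<psi> p u v w = lin3 (tapp M (partial M 0 \<psi>) p) (tapp M (partial M 1 \<psi>) p) (tapp M (partial M 2 \<psi>) p) u v w"

text \<open>The derivative in the direction \<open>(u, v, w)\<close> of the derivative in the direction \<open>(a, b, c)\<close>.\<close>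

definition hess :: "'a \<Rightarrow> 'a \<Rightarrow> 'a \<Rightarrow> 'a \<Rightarrow> 'a \<Rightarrow> 'a \<Rightarrow> 'a \<Rightarrow> 'a \<Rightarrow> 'a" where
  "hess \<psi> p u v w a b c =
    lin3 (grad (partial M 0 \<psi>) p u v w) (grad (partial M 1 \<psi>) p u v w) (grad (partial M 2 \<psi>) p u v w) a b c"

lemma lin3_simps [simp]:
  assumes "real_at X p" "real_at X q" "real_at X s" "real_at X u" "real_at X v" "real_at X w"
  shows "lin3 p q s u v w \<in> Arr M" "Tgt M (lin3 p q s u v w) = R" "Src M (lin3 p q s u v w) = Src M p"
    "z \<in> Arr M \<Longrightarrow> Tgt M z = X \<Longrightarrow>
      lin3 p q s u v w \<cdot> z = lin3 (p \<cdot> z) (q \<cdot> z) (s \<cdot> z) (u \<cdot> z) (v \<cdot> z) (w \<cdot> z)"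
  using assms by (simp_all add: lin3_def)

lemma grad_simps [simp]:
  assumes "test \<psi>" "p \<in> Arr M" "Tgt M p = space3 M" "Src M p = Src M \<psi>"
    "real_at (Src M \<psi>) u" "real_at (Src M \<psi>) v" "real_at (Src M \<psi>) w"
  shows "grad \<psi> p u v w \<in> Arr M" "Tgt M (grad \<psi> p u v w) = R" "Src M (grad \<psi> p u v w) = Src M \<psi>"
    "z \<in> Arr M \<Longrightarrow> Tgt M z = Src M \<psi> \<Longrightarrow>
      grad \<psi> p u v w \<cdot> z = grad (\<psi> \<cdot> z) (p \<cdot> z) (u \<cdot> z) (v \<cdot> z) (w \<cdot> z)"
  using assms by (simp_all add: grad_def)

lemma hess_simps [simp]:
  assumes "test \<psi>" "p \<in> Arr M" "Tgt M p = space3 M" "Src M p = Src M \<psi>"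
    "real_at (Src M \<psi>) u" "real_at (Src M \<psi>) v" "real_at (Src M \<psi>) w"
    "real_at (Src M \<psi>) a" "real_at (Src M \<psi>) b" "real_at (Src M \<psi>) c"
  shows "hess \<psi> p u v w a b c \<in> Arr M" "Tgt M (hess \<psi> p u v w a b c) = R"
    "Src M (hess \<psi> p u v w a b c) = Src M \<psi>"
    "z \<in> Arr M \<Longrightarrow> Tgt M z = Src M \<psi> \<Longrightarrow> hess \<psi> p u v w a b c \<cdot> z =
      hess (\<psi> \<cdot> z) (p \<cdot> z) (u \<cdot> z) (v \<cdot> z) (w \<cdot> z) (a \<cdot> z) (b \<cdot> z) (c \<cdot> z)"
  using assms by (simp_all add: hess_def)

lemma product_rule:
  assumes "real_at X p" "real_at X q" "real_at X p'" "real_at X q'" "infinitesimal d" "Src M d = X"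
  shows "(p \<oplus> (d \<otimes> p')) \<otimes> (q \<oplus> (d \<otimes> q')) = (p \<otimes> q) \<oplus> (d \<otimes> ((p' \<otimes> q) \<oplus> (p \<otimes> q')))"
  using assms by (simp add: rsimps infinitesimal_square)

lemma lin3_deriv:
  assumes "real_at X p" "real_at X q" "real_at X s" "real_at X u" "real_at X v" "real_at X w"
    "real_at X p'" "real_at X q'" "real_at X s'" "real_at X u'" "real_at X v'" "real_at X w'"
    "infinitesimal d" "Src M d = X"
  shows "lin3 (p \<oplus> (d \<otimes> p')) (q \<oplus> (d \<otimes> q')) (s \<oplus> (d \<otimes> s'))
      (u \<oplus> (d \<otimes> u')) (v \<oplus> (d \<otimes> v')) (w \<oplus> (d \<otimes> w')) =
    lin3 p q s u v w \<oplus> (d \<otimes> (lin3 p q s u' v' w' \<oplus> lin3 p' q' s' u v w))"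
proof -
  have sum: "(a \<oplus> (d \<otimes> a')) \<oplus> ((b \<oplus> (d \<otimes> b')) \<oplus> (c \<oplus> (d \<otimes> c'))) =
      (a \<oplus> (b \<oplus> c)) \<oplus> (d \<otimes> (a' \<oplus> (b' \<oplus> c')))"
    if "real_at X a" "real_at X b" "real_at X c" "real_at X a'" "real_at X b'" "real_at X c'" for a b c a' b' c'
    using that assms(13,14) by (simp add: ring_laws(1,2,6))
  show ?thesis
    unfolding lin3_def
    using assms by (simp only: product_rule[where X = X]) (subst sum, (simp; fail)+, simp add: ring_laws(1,2) ring_comm(1))
qed

lemma tapp_deriv:
  assumes "test \<psi>" "real_at (Src M \<psi>) a" "real_at (Src M \<psi>) b" "real_at (Src M \<psi>) c"
    "real_at (Src M \<psi>) u" "real_at (Src M \<psi>) v" "real_at (Src M \<psi>) w" "infinitesimal d" "Src M d = Src M \<psi>"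
  shows "tapp M \<psi> (point3 M (a \<oplus> (d \<otimes> u)) (b \<oplus> (d \<otimes> v)) (c \<oplus> (d \<otimes> w))) =
    tapp M \<psi> (point3 M a b c) \<oplus> (d \<otimes> grad \<psi> (point3 M a b c) u v w)"
  unfolding grad_def lin3_def by (rule chain_rule) (use assms in auto)

text \<open>Both the point and the direction move, as happens along the angles, where the unit vectors turn.\<close>

lemma grad_deriv:
  assumes "test \<psi>" "real_at (Src M \<psi>) a" "real_at (Src M \<psi>) b" "real_at (Src M \<psi>) c"
    "real_at (Src M \<psi>) u" "real_at (Src M \<psi>) v" "real_at (Src M \<psi>) w"
    "real_at (Src M \<psi>) x" "real_at (Src M \<psi>) y" "real_at (Src M \<psi>) z"
    "real_at (Src M \<psi>) x'" "real_at (Src M \<psi>) y'" "real_at (Src M \<psi>) z'" "infinitesimal d" "Src M d = Src M \<psi>"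
  shows "grad \<psi> (point3 M (a \<oplus> (d \<otimes> u)) (b \<oplus> (d \<otimes> v)) (c \<oplus> (d \<otimes> w)))
      (x \<oplus> (d \<otimes> x')) (y \<oplus> (d \<otimes> y')) (z \<oplus> (d \<otimes> z')) =
    grad \<psi> (point3 M a b c) x y z \<oplus>
      (d \<otimes> (grad \<psi> (point3 M a b c) x' y' z' \<oplus> hess \<psi> (point3 M a b c) u v w x y z))"
proof -
  have t: "tapp M (partial M i \<psi>) (point3 M (a \<oplus> (d \<otimes> u)) (b \<oplus> (d \<otimes> v)) (c \<oplus> (d \<otimes> w))) =
      tapp M (partial M i \<psi>) (point3 M a b c) \<oplus> (d \<otimes> grad (partial M i \<psi>) (point3 M a b c) u v w)" for i
    by (rule tapp_deriv) (use assms in simp_all)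
  show ?thesis
    unfolding grad_def[of \<psi>] hess_def t
    by (rule lin3_deriv[where X = "Src M \<psi>"]) (use assms in simp_all)
qed

lemma grad_deriv_point:
  assumes "test \<psi>" "real_at (Src M \<psi>) a" "real_at (Src M \<psi>) b" "real_at (Src M \<psi>) c"
    "real_at (Src M \<psi>) u" "real_at (Src M \<psi>) v" "real_at (Src M \<psi>) w"
    "real_at (Src M \<psi>) x" "real_at (Src M \<psi>) y" "real_at (Src M \<psi>) z" "infinitesimal d" "Src M d = Src M \<psi>"
  shows "grad \<psi> (point3 M (a \<oplus> (d \<otimes> u)) (b \<oplus> (d \<otimes> v)) (c \<oplus> (d \<otimes> w))) x y z =
    grad \<psi> (point3 M a b c) x y z \<oplus> (d \<otimes> hess \<psi> (point3 M a b c) u v w x y z)"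
proof -
  have "grad \<psi> p (rconst M (Src M \<psi>) 0) (rconst M (Src M \<psi>) 0) (rconst M (Src M \<psi>) 0) = rconst M (Src M \<psi>) 0"
    if "p \<in> Arr M" "Tgt M p = space3 M" "Src M p = Src M \<psi>" for p
    using that assms(1) by (simp add: grad_def lin3_def)
  with grad_deriv[of \<psi> a b c u v w x y z "rconst M (Src M \<psi>) 0" "rconst M (Src M \<psi>) 0" "rconst M (Src M \<psi>) 0" d]
    assms show ?thesis by simp
qed


section \<open>The Laplace operator in spherical coordinates\<close>

text \<open>Here \<open>c\<close>, \<open>s\<close> and \<open>C\<close>, \<open>S\<close> stand for cosine and sine of \<open>\<theta>\<close> and \<open>\<phi>\<close>, the letters \<open>p\<close>, \<open>q\<close>, \<open>k\<close> for the
  partial derivatives of \<open>\<psi>\<close>, and \<open>p0\<close> to \<open>k2\<close> for those of second order. The second-order terms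
  match because \<open>u\<close>, \<open>e\<^sub>\<phi>\<close>, \<open>e\<^sub>\<theta>\<close> is an orthonormal basis, so that the sum of the quadratic form over
  it is the trace. The first-order terms match because
  \<open>e\<^sub>\<theta>\<close> has the \<open>\<theta>\<close>-derivative \<open>- (sin \<phi> u + cos \<phi> e\<^sub>\<phi>)\<close>.\<close>

lemma spherical_laplacian_real:
  fixes r :: real
  defines "L \<equiv> \<lambda>p q s u v w :: real. u * p + (v * q + w * s)"
  assumes ct: "c * c + s * s = 1" and CT: "C * C + S * S = 1"
  shows "(C * L p q k (c * C) (s * C) (- S) + S * (L p q k (c * - S) (s * - S) (- C) +
      L (L p0 p1 p2 (r * (c * C)) (r * (s * C)) (r * - S)) (L q0 q1 q2 (r * (c * C)) (r * (s * C)) (r * - S))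
        (L k0 k1 k2 (r * (c * C)) (r * (s * C)) (r * - S)) (c * C) (s * C) (- S))) +
    ((L p q k (- c) (- s) 0 +
      L (L p0 p1 p2 (r * (- s * S)) (r * (c * S)) 0) (L q0 q1 q2 (r * (- s * S)) (r * (c * S)) 0)
        (L k0 k1 k2 (r * (- s * S)) (r * (c * S)) 0) (- s) c 0) +
    ((L p q k (c * S) (s * S) C * S + L p q k (c * S) (s * S) C * S) +
      r * (L (L p0 p1 p2 (c * S) (s * S) C) (L q0 q1 q2 (c * S) (s * S) C) (L k0 k1 k2 (c * S) (s * S) C)
        (c * S) (s * S) C * S))) = r * ((p0 + (q1 + k2)) * S)"
  unfolding L_def using ct CT by algebra

lemma spherical_simps [simp]:
  assumes "real_at X r" "real_at X \<theta>" "real_at X \<phi>"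
  shows "spherical M r \<theta> \<phi> \<in> Arr M" "Src M (spherical M r \<theta> \<phi>) = Src M r" "Tgt M (spherical M r \<theta> \<phi>) = space3 M"
    "z \<in> Arr M \<Longrightarrow> Tgt M z = X \<Longrightarrow> spherical M r \<theta> \<phi> \<cdot> z = spherical M (r \<cdot> z) (\<theta> \<cdot> z) (\<phi> \<cdot> z)"
  using assms by (simp_all add: spherical_def)

text \<open>The integrand of the sphere distribution. Its first and second radial derivatives are \<open>slope_density\<close>
  and \<open>curvature_density\<close>.\<close>

definition value_density :: "'a \<Rightarrow> 'a \<Rightarrow> 'a \<Rightarrow> 'a \<Rightarrow> 'a" where
  "value_density \<psi> r \<theta> \<phi> = tapp M \<psi> (spherical M r \<theta> \<phi>) \<otimes> rsin M \<phi>"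

definition slope_density :: "'a \<Rightarrow> 'a \<Rightarrow> 'a \<Rightarrow> 'a \<Rightarrow> 'a" where
  "slope_density \<psi> r \<theta> \<phi> = grad \<psi> (spherical M r \<theta> \<phi>)
     (rcos M \<theta> \<otimes> rsin M \<phi>) (rsin M \<theta> \<otimes> rsin M \<phi>) (rcos M \<phi>) \<otimes> rsin M \<phi>"

definition curvature_density :: "'a \<Rightarrow> 'a \<Rightarrow> 'a \<Rightarrow> 'a \<Rightarrow> 'a" where
  "curvature_density \<psi> r \<theta> \<phi> = hess \<psi> (spherical M r \<theta> \<phi>)
     (rcos M \<theta> \<otimes> rsin M \<phi>) (rsin M \<theta> \<otimes> rsin M \<phi>) (rcos M \<phi>)
     (rcos M \<theta> \<otimes> rsin M \<phi>) (rsin M \<theta> \<otimes> rsin M \<phi>) (rcos M \<phi>) \<otimes> rsin M \<phi>"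

text \<open>The component of the gradient along \<open>e\<^sub>\<theta> = (- sin \<theta>, cos \<theta>, 0)\<close>.\<close>

definition azimuthal_flux :: "'a \<Rightarrow> 'a \<Rightarrow> 'a \<Rightarrow> 'a \<Rightarrow> 'a" where
  "azimuthal_flux \<psi> r \<theta> \<phi> = grad \<psi> (spherical M r \<theta> \<phi>) (rneg (rsin M \<theta>)) (rcos M \<theta>) (rconst M (Src M r) 0)"

text \<open>The point on the sphere moves with velocity \<open>r sin \<phi> e\<^sub>\<theta>\<close> along \<open>\<theta>\<close>.\<close>

definition azimuthal_flux_deriv :: "'a \<Rightarrow> 'a \<Rightarrow> 'a \<Rightarrow> 'a \<Rightarrow> 'a" where
  "azimuthal_flux_deriv \<psi> r \<theta> \<phi> =
     grad \<psi> (spherical M r \<theta> \<phi>) (rneg (rcos M \<theta>)) (rneg (rsin M \<theta>)) (rconst M (Src M r) 0) \<oplus>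
     hess \<psi> (spherical M r \<theta> \<phi>)
       (r \<otimes> (rneg (rsin M \<theta>) \<otimes> rsin M \<phi>)) (r \<otimes> (rcos M \<theta> \<otimes> rsin M \<phi>)) (rconst M (Src M r) 0)
       (rneg (rsin M \<theta>)) (rcos M \<theta>) (rconst M (Src M r) 0)"

text \<open>\<open>sin \<phi>\<close> times the component of the gradient along
  \<open>e\<^sub>\<phi> = (cos \<theta> cos \<phi>, sin \<theta> cos \<phi>, - sin \<phi>)\<close>.\<close>

definition polar_flux :: "'a \<Rightarrow> 'a \<Rightarrow> 'a \<Rightarrow> 'a \<Rightarrow> 'a" where
  "polar_flux \<psi> r \<theta> \<phi> = rsin M \<phi> \<otimes> grad \<psi> (spherical M r \<theta> \<phi>)
     (rcos M \<theta> \<otimes> rcos M \<phi>) (rsin M \<theta> \<otimes> rcos M \<phi>) (rneg (rsin M \<phi>))"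

text \<open>The point on the sphere moves with velocity \<open>r e\<^sub>\<phi>\<close> along \<open>\<phi>\<close>, and \<open>e\<^sub>\<phi>\<close> turns towards \<open>- u\<close>.\<close>

definition polar_flux_deriv :: "'a \<Rightarrow> 'a \<Rightarrow> 'a \<Rightarrow> 'a \<Rightarrow> 'a" where
  "polar_flux_deriv \<psi> r \<theta> \<phi> =
     (rcos M \<phi> \<otimes> grad \<psi> (spherical M r \<theta> \<phi>)
       (rcos M \<theta> \<otimes> rcos M \<phi>) (rsin M \<theta> \<otimes> rcos M \<phi>) (rneg (rsin M \<phi>))) \<oplus>
     (rsin M \<phi> \<otimes>
       (grad \<psi> (spherical M r \<theta> \<phi>)
          (rcos M \<theta> \<otimes> rneg (rsin M \<phi>)) (rsin M \<theta> \<otimes> rneg (rsin M \<phi>)) (rneg (rcos M \<phi>)) \<oplus>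
        hess \<psi> (spherical M r \<theta> \<phi>)
          (r \<otimes> (rcos M \<theta> \<otimes> rcos M \<phi>)) (r \<otimes> (rsin M \<theta> \<otimes> rcos M \<phi>)) (r \<otimes> rneg (rsin M \<phi>))
          (rcos M \<theta> \<otimes> rcos M \<phi>) (rsin M \<theta> \<otimes> rcos M \<phi>) (rneg (rsin M \<phi>))))"

lemma densities:
  "density value_density" "density slope_density" "density curvature_density"
  "density azimuthal_flux" "density azimuthal_flux_deriv" "density polar_flux" "density polar_flux_deriv"
  by (simp_all add: density_def value_density_def slope_density_def curvature_density_def
      azimuthal_flux_def azimuthal_flux_deriv_def polar_flux_def polar_flux_deriv_def)

lemma density_laplace: "density k \<Longrightarrow> density (\<lambda>\<psi>. k (laplace M \<psi>))"
  by (simp add: density_def)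

lemma density_add: "density k \<Longrightarrow> density l \<Longrightarrow> density (\<lambda>\<psi> r \<theta> \<phi>. k \<psi> r \<theta> \<phi> \<oplus> l \<psi> r \<theta> \<phi>)"
  by (simp add: density_def)

lemma density_scale: "density k \<Longrightarrow> density (\<lambda>\<psi> r \<theta> \<phi>. r \<otimes> k \<psi> r \<theta> \<phi>)"
  by (simp add: density_def)

lemma spherical_deriv:
  assumes "real_at X r" "real_at X \<theta>" "real_at X \<phi>" "infinitesimal d" "Src M d = X"
  shows "spherical M (r \<oplus> d) \<theta> \<phi> = point3 M
      (r \<otimes> rcos M \<theta> \<otimes> rsin M \<phi> \<oplus> (d \<otimes> (rcos M \<theta> \<otimes> rsin M \<phi>)))
      (r \<otimes> rsin M \<theta> \<otimes> rsin M \<phi> \<oplus> (d \<otimes> (rsin M \<theta> \<otimes> rsin M \<phi>))) (r \<otimes> rcos M \<phi> \<oplus> (d \<otimes> rcos M \<phi>))"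
    and "spherical M r (\<theta> \<oplus> d) \<phi> = point3 M
      (r \<otimes> rcos M \<theta> \<otimes> rsin M \<phi> \<oplus> (d \<otimes> (r \<otimes> (rneg (rsin M \<theta>) \<otimes> rsin M \<phi>))))
      (r \<otimes> rsin M \<theta> \<otimes> rsin M \<phi> \<oplus> (d \<otimes> (r \<otimes> (rcos M \<theta> \<otimes> rsin M \<phi>))))
      (r \<otimes> rcos M \<phi> \<oplus> (d \<otimes> rconst M X 0))"
    and "spherical M r \<theta> (\<phi> \<oplus> d) = point3 M
      (r \<otimes> rcos M \<theta> \<otimes> rsin M \<phi> \<oplus> (d \<otimes> (r \<otimes> (rcos M \<theta> \<otimes> rcos M \<phi>))))
      (r \<otimes> rsin M \<theta> \<otimes> rsin M \<phi> \<oplus> (d \<otimes> (r \<otimes> (rsin M \<theta> \<otimes> rcos M \<phi>))))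
      (r \<otimes> rcos M \<phi> \<oplus> (d \<otimes> (r \<otimes> rneg (rsin M \<phi>))))"
  using assms unfolding spherical_def by (simp_all add: trig_infinitesimal rsimps)

lemma value_density_deriv:
  assumes "test \<psi>" "real_at (Src M \<psi>) r" "real_at (Src M \<psi>) \<theta>" "real_at (Src M \<psi>) \<phi>"
    "infinitesimal d" "Src M d = Src M \<psi>"
  shows "value_density \<psi> (r \<oplus> d) \<theta> \<phi> = value_density \<psi> r \<theta> \<phi> \<oplus> (d \<otimes> slope_density \<psi> r \<theta> \<phi>)"
proof -
  have "tapp M \<psi> (spherical M (r \<oplus> d) \<theta> \<phi>) = tapp M \<psi> (spherical M r \<theta> \<phi>) \<oplus>
      (d \<otimes> grad \<psi> (spherical M r \<theta> \<phi>) (rcos M \<theta> \<otimes> rsin M \<phi>) (rsin M \<theta> \<otimes> rsin M \<phi>) (rcos M \<phi>))"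
    unfolding spherical_deriv(1)[OF assms(2-6)] spherical_def[of M r] by (rule tapp_deriv) (use assms in simp_all)
  then show ?thesis
    using assms by (simp add: value_density_def slope_density_def ring_laws)
qed

lemma slope_density_deriv:
  assumes "test \<psi>" "real_at (Src M \<psi>) r" "real_at (Src M \<psi>) \<theta>" "real_at (Src M \<psi>) \<phi>"
    "infinitesimal d" "Src M d = Src M \<psi>"
  shows "slope_density \<psi> (r \<oplus> d) \<theta> \<phi> = slope_density \<psi> r \<theta> \<phi> \<oplus> (d \<otimes> curvature_density \<psi> r \<theta> \<phi>)"
proof -
  have "grad \<psi> (spherical M (r \<oplus> d) \<theta> \<phi>) x y z = grad \<psi> (spherical M r \<theta> \<phi>) x y z \<oplus>
      (d \<otimes> hess \<psi> (spherical M r \<theta> \<phi>) (rcos M \<theta> \<otimes> rsin M \<phi>) (rsin M \<theta> \<otimes> rsin M \<phi>) (rcos M \<phi>) x y z)"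
    if "real_at (Src M \<psi>) x" "real_at (Src M \<psi>) y" "real_at (Src M \<psi>) z" for x y z
    unfolding spherical_deriv(1)[OF assms(2-6)] spherical_def[of M r] by (rule grad_deriv_point) (use assms that in simp_all)
  then show ?thesis
    using assms by (simp add: slope_density_def curvature_density_def ring_laws)
qed

lemma azimuthal_flux_has_deriv:
  assumes "test \<psi>" "real_at (Src M \<psi>) r" "real_at (Src M \<psi>) \<theta>" "real_at (Src M \<psi>) \<phi>"
    "infinitesimal d" "Src M d = Src M \<psi>"
  shows "azimuthal_flux \<psi> r (\<theta> \<oplus> d) \<phi> = azimuthal_flux \<psi> r \<theta> \<phi> \<oplus> (d \<otimes> azimuthal_flux_deriv \<psi> r \<theta> \<phi>)"
proof -
  \<comment> \<open>The constant third component is also given the shape \<open>a + d a'\<close>.\<close>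
  have c: "rneg (rsin M (\<theta> \<oplus> d)) = rneg (rsin M \<theta>) \<oplus> (d \<otimes> rneg (rcos M \<theta>))"
    "rcos M (\<theta> \<oplus> d) = rcos M \<theta> \<oplus> (d \<otimes> rneg (rsin M \<theta>))"
    "rconst M (Src M r) 0 = rconst M (Src M r) 0 \<oplus> (d \<otimes> rconst M (Src M r) 0)"
    using assms by (simp_all add: trig_infinitesimal ring_comm(3-5))
  have "azimuthal_flux \<psi> r (\<theta> \<oplus> d) \<phi> =
    grad \<psi> (spherical M r (\<theta> \<oplus> d) \<phi>) (rneg (rsin M \<theta>) \<oplus> (d \<otimes> rneg (rcos M \<theta>)))
      (rcos M \<theta> \<oplus> (d \<otimes> rneg (rsin M \<theta>))) (rconst M (Src M r) 0 \<oplus> (d \<otimes> rconst M (Src M r) 0))"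
    unfolding azimuthal_flux_def c(1,2) by (subst c(3)) (rule refl)
  also have "\<dots> = azimuthal_flux \<psi> r \<theta> \<phi> \<oplus> (d \<otimes> azimuthal_flux_deriv \<psi> r \<theta> \<phi>)"
    unfolding spherical_deriv(2)[OF assms(2-6)] azimuthal_flux_def azimuthal_flux_deriv_def spherical_def[of M r \<theta>]
    by (subst grad_deriv) (use assms in simp_all)
  finally show ?thesis .
qed

lemma polar_flux_has_deriv:
  assumes "test \<psi>" "real_at (Src M \<psi>) r" "real_at (Src M \<psi>) \<theta>" "real_at (Src M \<psi>) \<phi>"
    "infinitesimal d" "Src M d = Src M \<psi>"
  shows "polar_flux \<psi> r \<theta> (\<phi> \<oplus> d) = polar_flux \<psi> r \<theta> \<phi> \<oplus> (d \<otimes> polar_flux_deriv \<psi> r \<theta> \<phi>)"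
proof -
  have c: "rsin M (\<phi> \<oplus> d) = rsin M \<phi> \<oplus> (d \<otimes> rcos M \<phi>)"
    "rcos M \<theta> \<otimes> rcos M (\<phi> \<oplus> d) = (rcos M \<theta> \<otimes> rcos M \<phi>) \<oplus> (d \<otimes> (rcos M \<theta> \<otimes> rneg (rsin M \<phi>)))"
    "rsin M \<theta> \<otimes> rcos M (\<phi> \<oplus> d) = (rsin M \<theta> \<otimes> rcos M \<phi>) \<oplus> (d \<otimes> (rsin M \<theta> \<otimes> rneg (rsin M \<phi>)))"
    "rneg (rsin M \<phi> \<oplus> (d \<otimes> rcos M \<phi>)) = rneg (rsin M \<phi>) \<oplus> (d \<otimes> rneg (rcos M \<phi>))"
    using assms by (simp_all add: trig_infinitesimal rsimps)
  have g: "grad \<psi> (spherical M r \<theta> (\<phi> \<oplus> d))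
      ((rcos M \<theta> \<otimes> rcos M \<phi>) \<oplus> (d \<otimes> (rcos M \<theta> \<otimes> rneg (rsin M \<phi>))))
      ((rsin M \<theta> \<otimes> rcos M \<phi>) \<oplus> (d \<otimes> (rsin M \<theta> \<otimes> rneg (rsin M \<phi>))))
      (rneg (rsin M \<phi>) \<oplus> (d \<otimes> rneg (rcos M \<phi>))) =
    grad \<psi> (spherical M r \<theta> \<phi>) (rcos M \<theta> \<otimes> rcos M \<phi>) (rsin M \<theta> \<otimes> rcos M \<phi>) (rneg (rsin M \<phi>)) \<oplus>
    (d \<otimes> (grad \<psi> (spherical M r \<theta> \<phi>)
          (rcos M \<theta> \<otimes> rneg (rsin M \<phi>)) (rsin M \<theta> \<otimes> rneg (rsin M \<phi>)) (rneg (rcos M \<phi>)) \<oplus>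
        hess \<psi> (spherical M r \<theta> \<phi>)
          (r \<otimes> (rcos M \<theta> \<otimes> rcos M \<phi>)) (r \<otimes> (rsin M \<theta> \<otimes> rcos M \<phi>)) (r \<otimes> rneg (rsin M \<phi>))
          (rcos M \<theta> \<otimes> rcos M \<phi>) (rsin M \<theta> \<otimes> rcos M \<phi>) (rneg (rsin M \<phi>))))"
    unfolding spherical_deriv(3)[OF assms(2-6)] spherical_def[of M r \<theta> \<phi>]
    by (subst grad_deriv) (use assms in simp_all)
  show ?thesis
    unfolding polar_flux_def polar_flux_deriv_def c g
    by (subst product_rule) (use assms in simp_all)
qed

text \<open>After the radius, the angles and the partial derivatives at the point have been taken as variables,
  this is the real identity above.\<close>

lemma spherical_laplacian:
  assumes "test \<psi>" "real_at (Src M \<psi>) r" "real_at (Src M \<psi>) \<theta>" "real_at (Src M \<psi>) \<phi>"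
  shows "polar_flux_deriv \<psi> r \<theta> \<phi> \<oplus> (azimuthal_flux_deriv \<psi> r \<theta> \<phi> \<oplus>
      ((slope_density \<psi> r \<theta> \<phi> \<oplus> slope_density \<psi> r \<theta> \<phi>) \<oplus> (r \<otimes> curvature_density \<psi> r \<theta> \<phi>))) =
    r \<otimes> value_density (laplace M \<psi>) r \<theta> \<phi>"
proof -
  define X where "X = Src M \<psi>"
  define t where "t i = tapp M (partial M i \<psi>) (spherical M r \<theta> \<phi>)" for i
  define t2 where "t2 i j = tapp M (partial M j (partial M i \<psi>)) (spherical M r \<theta> \<phi>)" for i j
  define xs where "xs = [r, \<theta>, \<phi>, t 0, t 1, t 2, t2 0 0, t2 0 1, t2 0 2, t2 1 0, t2 1 1, t2 1 2,
    t2 2 0, t2 2 1, t2 2 2]"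
  have args: "args X xs" using assms by (auto simp: args_def X_def Hom_iff xs_def t_def t2_def)
  note v = smooth_op_var[OF args, symmetric]
  have vars: "r = smooth_op M X (\<lambda>v. v 0) xs" "\<theta> = smooth_op M X (\<lambda>v. v 1) xs" "\<phi> = smooth_op M X (\<lambda>v. v 2) xs"
    "t 0 = smooth_op M X (\<lambda>v. v 3) xs" "t 1 = smooth_op M X (\<lambda>v. v 4) xs" "t 2 = smooth_op M X (\<lambda>v. v 5) xs"
    "t2 0 0 = smooth_op M X (\<lambda>v. v 6) xs" "t2 0 1 = smooth_op M X (\<lambda>v. v 7) xs" "t2 0 2 = smooth_op M X (\<lambda>v. v 8) xs"
    "t2 1 0 = smooth_op M X (\<lambda>v. v 9) xs" "t2 1 1 = smooth_op M X (\<lambda>v. v 10) xs" "t2 1 2 = smooth_op M X (\<lambda>v. v 11) xs"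
    "t2 2 0 = smooth_op M X (\<lambda>v. v 12) xs" "t2 2 1 = smooth_op M X (\<lambda>v. v 13) xs" "t2 2 2 = smooth_op M X (\<lambda>v. v 14) xs"
    using v[of 0] v[of 1] v[of 2] v[of 3] v[of 4] v[of 5] v[of 6] v[of 7] v[of 8] v[of 9] v[of 10]
      v[of 11] v[of 12] v[of 13] v[of 14] by (simp_all add: xs_def)
  have Xr: "Src M r = X" using assms by (simp add: X_def)
  have lap: "tapp M (laplace M \<psi>) (spherical M r \<theta> \<phi>) = t2 0 0 \<oplus> (t2 1 1 \<oplus> t2 2 2)"
    using assms by (simp add: tapp_laplace t2_def)
  show ?thesis
    unfolding polar_flux_deriv_def azimuthal_flux_deriv_def slope_density_def curvature_density_def
      value_density_def hess_def grad_def lap Xr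
    unfolding lin3_def t_def[symmetric] t2_def[symmetric]
    unfolding vars
    by (simp only: ops[OF args] elementary_intros)
       (rule smooth_op_cong, rule spherical_laplacian_real, simp_all only: sin_cos_squared_add3)
qed


section \<open>Sphere and ball distributions\<close>

lemma sphere_integral_tadd:
  assumes "density k"
    and "\<And>\<psi> \<xi> r \<theta> \<phi>. test \<psi> \<Longrightarrow> test \<xi> \<Longrightarrow> Src M \<xi> = Src M \<psi> \<Longrightarrow> real_at (Src M \<psi>) r \<Longrightarrow>
      real_at (Src M \<psi>) \<theta> \<Longrightarrow> real_at (Src M \<psi>) \<phi> \<Longrightarrow>
      k (tadd M \<psi> \<xi>) r \<theta> \<phi> = k \<psi> r \<theta> \<phi> \<oplus> k \<xi> r \<theta> \<phi>"
    and "test \<psi>" "test \<xi>" "Src M \<xi> = Src M \<psi>" "real_at (Src M \<psi>) t"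
  shows "sphere_integral k (tadd M \<psi> \<xi>) t = sphere_integral k \<psi> t \<oplus> sphere_integral k \<xi> t"
  using assms(3-) densityD[OF assms(1)] by (simp add: sphere_integral_def Let_def double_integral_add assms(2))

lemma sphere_integral_tscale:
  assumes "density k"
    and "\<And>\<psi> a r \<theta> \<phi>. test \<psi> \<Longrightarrow> real_at (Src M \<psi>) a \<Longrightarrow> real_at (Src M \<psi>) r \<Longrightarrow>
      real_at (Src M \<psi>) \<theta> \<Longrightarrow> real_at (Src M \<psi>) \<phi> \<Longrightarrow> k (tscale M a \<psi>) r \<theta> \<phi> = a \<otimes> k \<psi> r \<theta> \<phi>"
    and "test \<psi>" "real_at (Src M \<psi>) a" "real_at (Src M \<psi>) t"
  shows "sphere_integral k (tscale M a \<psi>) t = a \<otimes> sphere_integral k \<psi> t"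
  using assms(3-) densityD[OF assms(1)] by (simp add: sphere_integral_def Let_def double_integral_scale assms(2))

lemma value_density_linear:
  assumes "test \<psi>" "real_at (Src M \<psi>) r" "real_at (Src M \<psi>) \<theta>" "real_at (Src M \<psi>) \<phi>"
  shows "test \<xi> \<Longrightarrow> Src M \<xi> = Src M \<psi> \<Longrightarrow>
      value_density (tadd M \<psi> \<xi>) r \<theta> \<phi> = value_density \<psi> r \<theta> \<phi> \<oplus> value_density \<xi> r \<theta> \<phi>"
    and "real_at (Src M \<psi>) a \<Longrightarrow> value_density (tscale M a \<psi>) r \<theta> \<phi> = a \<otimes> value_density \<psi> r \<theta> \<phi>"
  using assms by (simp_all add: value_density_def ring_laws)

lemma lin3_linear:
  assumes "real_at X p" "real_at X q" "real_at X s" "real_at X u" "real_at X v" "real_at X w"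
  shows "real_at X p' \<Longrightarrow> real_at X q' \<Longrightarrow> real_at X s' \<Longrightarrow>
      lin3 (p \<oplus> p') (q \<oplus> q') (s \<oplus> s') u v w = lin3 p q s u v w \<oplus> lin3 p' q' s' u v w"
    and "real_at X a \<Longrightarrow> lin3 (a \<otimes> p) (a \<otimes> q) (a \<otimes> s) u v w = a \<otimes> lin3 p q s u v w"
  using assms by (simp_all add: lin3_def rsimps)

lemma slope_density_linear:
  assumes "test \<psi>" "real_at (Src M \<psi>) r" "real_at (Src M \<psi>) \<theta>" "real_at (Src M \<psi>) \<phi>"
  shows "test \<xi> \<Longrightarrow> Src M \<xi> = Src M \<psi> \<Longrightarrow>
      slope_density (tadd M \<psi> \<xi>) r \<theta> \<phi> = slope_density \<psi> r \<theta> \<phi> \<oplus> slope_density \<xi> r \<theta> \<phi>"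
    and "real_at (Src M \<psi>) a \<Longrightarrow> slope_density (tscale M a \<psi>) r \<theta> \<phi> = a \<otimes> slope_density \<psi> r \<theta> \<phi>"
  using assms by (simp_all add: slope_density_def grad_def lin3_linear[where X = "Src M \<psi>"] ring_laws(3,5))

definition sphere_value :: "'a \<Rightarrow> 'a \<Rightarrow> 'a" where "sphere_value = sphere_integral value_density"
definition sphere_slope :: "'a \<Rightarrow> 'a \<Rightarrow> 'a" where "sphere_slope = sphere_integral slope_density"
definition sphere_curvature :: "'a \<Rightarrow> 'a \<Rightarrow> 'a" where "sphere_curvature = sphere_integral curvature_density"

lemma sphere_simps [simp]:
  assumes "test \<psi>" "real_at (Src M \<psi>) t"
  shows "sphere_value \<psi> t \<in> Arr M" "Src M (sphere_value \<psi> t) = Src M \<psi>" "Tgt M (sphere_value \<psi> t) = R"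
    "z \<in> Arr M \<Longrightarrow> Tgt M z = Src M \<psi> \<Longrightarrow> sphere_value \<psi> t \<cdot> z = sphere_value (\<psi> \<cdot> z) (t \<cdot> z)"
    "sphere_slope \<psi> t \<in> Arr M" "Src M (sphere_slope \<psi> t) = Src M \<psi>" "Tgt M (sphere_slope \<psi> t) = R"
    "z \<in> Arr M \<Longrightarrow> Tgt M z = Src M \<psi> \<Longrightarrow> sphere_slope \<psi> t \<cdot> z = sphere_slope (\<psi> \<cdot> z) (t \<cdot> z)"
    "sphere_curvature \<psi> t \<in> Arr M" "Src M (sphere_curvature \<psi> t) = Src M \<psi>" "Tgt M (sphere_curvature \<psi> t) = R"
  unfolding sphere_value_def sphere_slope_def sphere_curvature_def
  using assms by (simp_all add: sphere_integral_typing densities)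

lemma sphere_linear:
  assumes "test \<psi>" "real_at (Src M \<psi>) t"
  shows "test \<xi> \<Longrightarrow> Src M \<xi> = Src M \<psi> \<Longrightarrow> sphere_value (tadd M \<psi> \<xi>) t = sphere_value \<psi> t \<oplus> sphere_value \<xi> t"
    and "real_at (Src M \<psi>) a \<Longrightarrow> sphere_value (tscale M a \<psi>) t = a \<otimes> sphere_value \<psi> t"
    and "test \<xi> \<Longrightarrow> Src M \<xi> = Src M \<psi> \<Longrightarrow>
      sphere_slope (tadd M \<psi> \<xi>) t = sphere_slope \<psi> t \<oplus> sphere_slope \<xi> t"
    and "real_at (Src M \<psi>) a \<Longrightarrow> sphere_slope (tscale M a \<psi>) t = a \<otimes> sphere_slope \<psi> t"
  unfolding sphere_value_def sphere_slope_def
  using assms by (auto intro!: sphere_integral_tadd sphere_integral_tscale densities value_density_linear slope_density_linear)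

lemma sphere_deriv:
  assumes "test \<psi>" "real_at (Src M \<psi>) t" "infinitesimal d" "Src M d = Src M \<psi>"
  shows "sphere_value \<psi> (t \<oplus> d) = sphere_value \<psi> t \<oplus> (d \<otimes> sphere_slope \<psi> t)"
    and "sphere_slope \<psi> (t \<oplus> d) = sphere_slope \<psi> t \<oplus> (d \<otimes> sphere_curvature \<psi> t)"
proof -
  show "sphere_value \<psi> (t \<oplus> d) = sphere_value \<psi> t \<oplus> (d \<otimes> sphere_slope \<psi> t)"
    unfolding sphere_value_def sphere_slope_def
    by (rule sphere_integral_radial_deriv[OF densities(1,2) value_density_deriv]) (use assms in simp_all)
  show "sphere_slope \<psi> (t \<oplus> d) = sphere_slope \<psi> t \<oplus> (d \<otimes> sphere_curvature \<psi> t)"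
    unfolding sphere_slope_def sphere_curvature_def
    by (rule sphere_integral_radial_deriv[OF densities(2,3) slope_density_deriv]) (use assms in simp_all)
qed

text \<open>Integrating the Laplace operator in spherical coordinates over the sphere; the two angular
  derivatives contribute nothing.\<close>

lemma sphere_laplace:
  assumes "test \<psi>" "real_at (Src M \<psi>) t"
  shows "(sphere_slope \<psi> t \<oplus> sphere_slope \<psi> t) \<oplus> (t \<otimes> sphere_curvature \<psi> t) = t \<otimes> sphere_value (laplace M \<psi>) t"
proof -
  note op = densities density_add density_scale density_laplace
  have p: "sphere_integral polar_flux_deriv \<psi> t = rconst M (Src M \<psi>) 0"
    by (rule sphere_integral_polar_deriv[OF densities(6,7) polar_flux_has_deriv])
       (use assms in \<open>simp_all add: polar_flux_def\<close>)
  have a: "sphere_integral azimuthal_flux_deriv \<psi> t = rconst M (Src M \<psi>) 0"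
    by (rule sphere_integral_azimuthal_deriv[OF densities(4,5) azimuthal_flux_has_deriv])
       (use assms in \<open>simp_all add: azimuthal_flux_def spherical_def\<close>)
  have "sphere_integral (\<lambda>\<psi> r \<theta> \<phi>. polar_flux_deriv \<psi> r \<theta> \<phi> \<oplus> (azimuthal_flux_deriv \<psi> r \<theta> \<phi> \<oplus>
      ((slope_density \<psi> r \<theta> \<phi> \<oplus> slope_density \<psi> r \<theta> \<phi>) \<oplus> (r \<otimes> curvature_density \<psi> r \<theta> \<phi>)))) \<psi> t =
    sphere_integral (\<lambda>\<psi> r \<theta> \<phi>. r \<otimes> value_density (laplace M \<psi>) r \<theta> \<phi>) \<psi> t"
    by (rule sphere_integral_cong[OF spherical_laplacian]) (use assms in auto)
  moreover have "sphere_integral (\<lambda>\<psi>. value_density (laplace M \<psi>)) \<psi> t = sphere_value (laplace M \<psi>) t"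
    using assms by (simp add: sphere_value_def sphere_integral_def Let_def)
  ultimately show ?thesis
    using assms by (simp add: sphere_integral_add sphere_integral_scale op p a sphere_slope_def sphere_curvature_def
        sphere_integral_typing)
qed

text \<open>The value of the ball distribution, written with the sphere of radius \<open>t s\<close>.\<close>

definition ball_value :: "'a \<Rightarrow> 'a \<Rightarrow> 'a" where
  "ball_value \<psi> t = (let W = Src M \<psi> in integ W (rconst M W 0) (rconst M W 1)
     ((Pr2 M W R \<otimes> Pr2 M W R) \<otimes> sphere_value (\<psi> \<cdot> Pr1 M W R) ((t \<cdot> Pr1 M W R) \<otimes> Pr2 M W R)))"

lemma ball_value_typing:
  assumes "test \<psi>" "real_at (Src M \<psi>) t"
  shows "ball_value \<psi> t \<in> Arr M" "Src M (ball_value \<psi> t) = Src M \<psi>" "Tgt M (ball_value \<psi> t) = R"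
  using assms by (simp_all add: ball_value_def Let_def)

text \<open>The divergence theorem for the ball, obtained from the fundamental theorem of calculus: by
  \<open>sphere_laplace\<close>, \<open>s\<^sup>2\<close> times the slope at radius \<open>t s\<close> is an antiderivative in \<open>s\<close> of \<open>t s\<^sup>2\<close> times the
  sphere value of \<open>\<Delta> \<psi>\<close>, and it vanishes at \<open>s = 0\<close>.\<close>

lemma sphere_slope_ball:
  assumes "test \<psi>" "real_at (Src M \<psi>) t"
  shows "sphere_slope \<psi> t = t \<otimes> ball_value (laplace M \<psi>) t"
proof -
  let ?W = "Src M \<psi>"
  let ?s = "Pr2 M ?W R" and ?w = "Pr1 M ?W R"
  define G where "G = (?s \<otimes> ?s) \<otimes> sphere_slope (\<psi> \<cdot> ?w) ((t \<cdot> ?w) \<otimes> ?s)"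
  define F where "F = (?s \<otimes> ?s) \<otimes> sphere_value (laplace M \<psi> \<cdot> ?w) ((t \<cdot> ?w) \<otimes> ?s)"
  have d: "has_deriv ?W G ((t \<cdot> ?w) \<otimes> F)"
  proof (rule has_derivI)
    fix x s d assume x: "x \<in> Arr M" "Tgt M x = ?W" and s: "s \<in> Arr M" "Tgt M s = R" "Src M s = Src M x"
      and d: "infinitesimal d" "Src M d = Src M x"
    define \<psi>' t' X where "\<psi>' = \<psi> \<cdot> x" and "t' = t \<cdot> x" and "X = Src M x"
    have ty: "test \<psi>'" "Src M \<psi>' = X" "real_at X t'" "real_at X s" "infinitesimal d" "Src M d = X" "X \<in> Obj M"
      using assms x s d by (auto simp: \<psi>'_def t'_def X_def)
    \<comment> \<open>A change of \<open>s\<close> by \<open>d\<close> changes the radius \<open>t s\<close> by the infinitesimal \<open>d t\<close>.\<close>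
    have dt: "infinitesimal (d \<otimes> t')" using infinitesimal_mult[of d t'] ty by simp
    have e: "sphere_slope \<psi>' (t' \<otimes> (s \<oplus> d)) = sphere_slope \<psi>' (t' \<otimes> s) \<oplus>
        (d \<otimes> (t' \<otimes> sphere_curvature \<psi>' (t' \<otimes> s)))"
      using sphere_deriv(2)[of \<psi>' "t' \<otimes> s" "d \<otimes> t'"] ty dt
      by (simp add: ring_laws(3,6) ring_comm(2)[of t' d])
    define A B L where "A = sphere_slope \<psi>' (t' \<otimes> s)" and "B = sphere_curvature \<psi>' (t' \<otimes> s)"
      and "L = sphere_value (laplace M \<psi>') (t' \<otimes> s)"
    have ABL: "real_at X A" "real_at X B" "real_at X L" using ty by (simp_all add: A_def B_def L_def)
    have AB: "(A \<oplus> A) \<oplus> ((t' \<otimes> s) \<otimes> B) = (t' \<otimes> s) \<otimes> L"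
      unfolding A_def B_def L_def by (rule sphere_laplace) (use ty in simp_all)
    have "((s \<oplus> d) \<otimes> (s \<oplus> d)) \<otimes> (A \<oplus> (d \<otimes> (t' \<otimes> B))) =
        ((s \<otimes> s) \<otimes> A) \<oplus> (d \<otimes> (s \<otimes> ((A \<oplus> A) \<oplus> ((t' \<otimes> s) \<otimes> B))))"
      using ty ABL by (simp add: rsimps infinitesimal_square)
    also have "\<dots> = ((s \<otimes> s) \<otimes> A) \<oplus> (d \<otimes> (t' \<otimes> ((s \<otimes> s) \<otimes> L)))"
      unfolding AB using ty ABL by (simp add: ring_laws(3,4))
    finally have "((s \<oplus> d) \<otimes> (s \<oplus> d)) \<otimes> sphere_slope \<psi>' (t' \<otimes> (s \<oplus> d)) =
        ((s \<otimes> s) \<otimes> A) \<oplus> (d \<otimes> (t' \<otimes> ((s \<otimes> s) \<otimes> L)))"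
      unfolding e A_def B_def .
    moreover have "G \<cdot> pair M x (s \<oplus> d) = ((s \<oplus> d) \<otimes> (s \<oplus> d)) \<otimes> sphere_slope \<psi>' (t' \<otimes> (s \<oplus> d))"
      "G \<cdot> pair M x s = (s \<otimes> s) \<otimes> A" "((t \<cdot> ?w) \<otimes> F) \<cdot> pair M x s = t' \<otimes> ((s \<otimes> s) \<otimes> L)"
      using assms x s d by (simp_all add: G_def F_def A_def L_def \<psi>'_def t'_def)
    ultimately show "G \<cdot> pair M x (s \<oplus> d) = (G \<cdot> pair M x s) \<oplus> (d \<otimes> (((t \<cdot> ?w) \<otimes> F) \<cdot> pair M x s))"
      by simp
  qed (use assms in \<open>simp_all add: G_def F_def\<close>)
  have "t \<otimes> ball_value (laplace M \<psi>) t = integ ?W (rconst M ?W 0) (rconst M ?W 1) ((t \<cdot> ?w) \<otimes> F)"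
    using assms by (simp add: integ_scale ball_value_def Let_def F_def)
  also have "\<dots> = sphere_slope \<psi> t"
    unfolding integ_eq[OF d rconst_simps(1-3)[OF Src_Obj_simp[OF conjunct1[OF assms(1)]]] rconst_simps(1-3)[OF Src_Obj_simp[OF conjunct1[OF assms(1)]]]]
    using assms by (simp add: G_def)
  finally show ?thesis ..
qed

lemma solid_angle: "Y \<in> Obj M \<Longrightarrow> double_integral Y (rsin M (polar Y)) = rconst M Y (4 * pi)"
proof -
  assume Y: "Y \<in> Obj M"
  let ?Z = "Prd M Y R"
  \<comment> \<open>The integrals over \<open>\<theta>\<close> and \<open>\<phi>\<close> have the antiderivatives \<open>\<theta> sin \<phi>\<close> and \<open>- 2 \<pi> cos \<phi>\<close>.\<close>
  have d1: "has_deriv ?Z (rsin M (polar Y) \<otimes> Pr2 M ?Z R) (rsin M (polar Y))"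
    by (rule has_derivI) (use Y in \<open>simp_all add: rsimps\<close>)
  have d2: "has_deriv Y (rneg (rcos M (Pr2 M Y R)) \<otimes> rconst M ?Z (2 * pi)) (rsin M (Pr2 M Y R) \<otimes> rconst M ?Z (2 * pi))"
    by (rule has_derivI) (use Y in \<open>simp_all add: rsimps trig_infinitesimal\<close>)
  show ?thesis
    using Y integ_eq[OF d1, of "rconst M ?Z 0" "rconst M ?Z (2 * pi)"] integ_eq[OF d2, of "rconst M Y 0" "rconst M Y pi"]
    by (simp add: double_integral_def)
qed

text \<open>A sphere of radius zero evaluates at the origin, up to the solid angle.\<close>

lemma sphere_zero:
  assumes "test \<psi>" "Src M \<psi> = Y" "o0 = rconst M Y 0"
  shows "sphere_value \<psi> o0 = tapp M \<psi> (point3 M o0 o0 o0) \<otimes> rconst M Y (4 * pi)"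
proof -
  have Y: "Y \<in> Obj M" using assms by auto
  have "sphere_value \<psi> o0 = double_integral Y ((tapp M \<psi> (point3 M o0 o0 o0) \<cdot> base Y) \<otimes> rsin M (polar Y))"
    using assms Y by (simp add: sphere_value_def sphere_integral_def Let_def value_density_def spherical_def)
  also have "\<dots> = tapp M \<psi> (point3 M o0 o0 o0) \<otimes> double_integral Y (rsin M (polar Y))"
    by (rule double_integral_scale) (use assms Y in auto)
  finally show ?thesis by (simp add: solid_angle[OF Y])
qed

section \<open>Functions from the line to distributions\<close>

text \<open>The values at \<open>\<psi>\<close> and \<open>t\<close> of a time-dependent distribution, as a natural operation on elements
  that is linear in \<open>\<psi>\<close>.\<close>

definition distribution_family :: "('a \<Rightarrow> 'a \<Rightarrow> 'a) \<Rightarrow> bool" where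
  "distribution_family q \<longleftrightarrow> (\<forall>\<psi> t. test \<psi> \<and> real_at (Src M \<psi>) t \<longrightarrow> real_at (Src M \<psi>) (q \<psi> t) \<and>
     (\<forall>z. z \<in> Arr M \<and> Tgt M z = Src M \<psi> \<longrightarrow> q \<psi> t \<cdot> z = q (\<psi> \<cdot> z) (t \<cdot> z)) \<and>
     (\<forall>\<xi>. test \<xi> \<and> Src M \<xi> = Src M \<psi> \<longrightarrow> q (tadd M \<psi> \<xi>) t = q \<psi> t \<oplus> q \<xi> t) \<and>
     (\<forall>a. real_at (Src M \<psi>) a \<longrightarrow> q (tscale M a \<psi>) t = a \<otimes> q \<psi> t))"

lemma distribution_familyD:
  assumes "distribution_family q" "test \<psi>" "real_at (Src M \<psi>) t"
  shows "q \<psi> t \<in> Arr M" "Src M (q \<psi> t) = Src M \<psi>" "Tgt M (q \<psi> t) = R"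
    "z \<in> Arr M \<Longrightarrow> Tgt M z = Src M \<psi> \<Longrightarrow> q \<psi> t \<cdot> z = q (\<psi> \<cdot> z) (t \<cdot> z)"
    "test \<xi> \<Longrightarrow> Src M \<xi> = Src M \<psi> \<Longrightarrow> q (tadd M \<psi> \<xi>) t = q \<psi> t \<oplus> q \<xi> t"
    "real_at (Src M \<psi>) a \<Longrightarrow> q (tscale M a \<psi>) t = a \<otimes> q \<psi> t"
  using assms unfolding distribution_family_def by blast+

lemma distribution_family_laplace: "distribution_family q \<Longrightarrow> distribution_family (\<lambda>\<psi>. q (laplace M \<psi>))"
  by (simp add: distribution_family_def laplace_tadd laplace_tscale)

definition distribution_of :: "('a \<Rightarrow> 'a \<Rightarrow> 'a) \<Rightarrow> 'a" where
  "distribution_of q = q (Pr2 M R (testfun M)) (Pr1 M R (testfun M))"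

lemma dapp_distribution_of:
  assumes "distribution_family q" "test \<psi>" "real_at (Src M \<psi>) t"
  shows "dapp M (distribution_of q) t \<psi> = q \<psi> t"
  using assms(2,3) distribution_familyD[OF assms(1)] by (simp add: dapp_def distribution_of_def)

lemma distribution_of_in_distributions:
  assumes "distribution_family q" shows "distribution_of q \<in> distributions M R"
  unfolding distributions_def
  using distribution_familyD[OF assms] dapp_distribution_of[OF assms] by (auto simp: Hom_iff distribution_of_def)

lemma at_time_distribution_of:
  assumes "distribution_family q" "t \<in> Arr M" "Tgt M t = R" "Src M t = X"
  shows "at_time M X (distribution_of q) t = q (Pr2 M X (testfun M)) (t \<cdot> Pr1 M X (testfun M))"
  unfolding at_time_def dabs_def
  by (rule dapp_distribution_of[OF assms(1)]) (use assms in auto)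

lemma time_derivative_distribution_of:
  assumes "distribution_family q" "distribution_family q'"
    and deriv: "\<And>\<psi> t d. test \<psi> \<Longrightarrow> real_at (Src M \<psi>) t \<Longrightarrow> infinitesimal d \<Longrightarrow> Src M d = Src M \<psi> \<Longrightarrow>
      q \<psi> (t \<oplus> d) = q \<psi> t \<oplus> (d \<otimes> q' \<psi> t)"
  shows "time_derivative M (distribution_of q) (distribution_of q')"
  unfolding time_derivative_def
proof (intro conjI ballI distribution_of_in_distributions assms)
  fix X t d assume X: "X \<in> Obj M" "t \<in> Hom M X R" "d \<in> infinitesimals M X"
  then have t: "t \<in> Arr M" "Tgt M t = R" "Src M t = X" "infinitesimal d" "Src M d = X"
    by (auto simp: Hom_iff infinitesimals_iff)
  then have "t \<oplus> d \<in> Arr M" "Tgt M (t \<oplus> d) = R" "Src M (t \<oplus> d) = X" by auto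
  then show "at_time M X (distribution_of q) (t \<oplus> d) =
      dadd M X (at_time M X (distribution_of q) t) (dscale M X d (at_time M X (distribution_of q') t))"
    using t X(1) distribution_familyD[OF assms(1)] distribution_familyD[OF assms(2)]
    by (simp add: at_time_distribution_of assms dadd_def dscale_def dabs_def dapp_def deriv)
qed

text \<open>The wave equation as a first-order system: the derivative of \<open>q\<close> is \<open>q'\<close>, and that of \<open>q'\<close> is \<open>q\<close>
  applied to \<open>\<Delta> \<psi>\<close>.\<close>

lemma wave_equation_distribution_of:
  assumes q: "distribution_family q" "distribution_family q'"
    and d: "\<And>\<psi> t d. test \<psi> \<Longrightarrow> real_at (Src M \<psi>) t \<Longrightarrow> infinitesimal d \<Longrightarrow> Src M d = Src M \<psi> \<Longrightarrow>
      q \<psi> (t \<oplus> d) = q \<psi> t \<oplus> (d \<otimes> q' \<psi> t)"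
    and d': "\<And>\<psi> t d. test \<psi> \<Longrightarrow> real_at (Src M \<psi>) t \<Longrightarrow> infinitesimal d \<Longrightarrow> Src M d = Src M \<psi> \<Longrightarrow>
      q' \<psi> (t \<oplus> d) = q' \<psi> t \<oplus> (d \<otimes> q (laplace M \<psi>) t)"
  shows "solves_wave_equation M (distribution_of q)"
  unfolding solves_wave_equation_def
proof (intro conjI exI ballI)
  show "distribution_of q \<in> distributions M R" by (rule distribution_of_in_distributions[OF q(1)])
  show "time_derivative M (distribution_of q) (distribution_of q')" by (rule time_derivative_distribution_of[OF q d])
  show "time_derivative M (distribution_of q') (distribution_of (\<lambda>\<psi>. q (laplace M \<psi>)))"
    by (rule time_derivative_distribution_of[OF q(2) distribution_family_laplace[OF q(1)] d'])
  fix X t assume "X \<in> Obj M" "t \<in> Hom M X R"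
  then show "at_time M X (distribution_of (\<lambda>\<psi>. q (laplace M \<psi>))) t = dlaplace M X (at_time M X (distribution_of q) t)"
    using distribution_familyD[OF q(1)]
    by (simp add: Hom_iff at_time_distribution_of q distribution_family_laplace dlaplace_def dabs_def dapp_def)
qed

text \<open>Kirchhoff's formula for the solution with vanishing initial value.\<close>

definition kirchhoff :: "'a \<Rightarrow> 'a \<Rightarrow> 'a" where
  "kirchhoff \<psi> t = rconst M (Src M \<psi>) (1 / (4 * pi)) \<otimes> (t \<otimes> sphere_value \<psi> t)"

definition kirchhoff_speed :: "'a \<Rightarrow> 'a \<Rightarrow> 'a" where
  "kirchhoff_speed \<psi> t = rconst M (Src M \<psi>) (1 / (4 * pi)) \<otimes> (sphere_value \<psi> t \<oplus> (t \<otimes> sphere_slope \<psi> t))"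

lemma distribution_family_kirchhoff: "distribution_family kirchhoff"
  by (simp add: distribution_family_def kirchhoff_def sphere_linear ring_laws)

lemma distribution_family_kirchhoff_speed: "distribution_family kirchhoff_speed"
  by (simp add: distribution_family_def kirchhoff_speed_def sphere_linear ring_laws)

lemma kirchhoff_deriv:
  assumes "test \<psi>" "real_at (Src M \<psi>) t" "infinitesimal d" "Src M d = Src M \<psi>"
  shows "kirchhoff \<psi> (t \<oplus> d) = kirchhoff \<psi> t \<oplus> (d \<otimes> kirchhoff_speed \<psi> t)"
  using assms by (simp add: kirchhoff_def kirchhoff_speed_def sphere_deriv ring_laws infinitesimal_square)

text \<open>The derivative of \<open>S + t S'\<close> is \<open>2 S' + t S''\<close>, which \<open>sphere_laplace\<close> identifies.\<close>

lemma kirchhoff_speed_deriv: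
  assumes "test \<psi>" "real_at (Src M \<psi>) t" "infinitesimal d" "Src M d = Src M \<psi>"
  shows "kirchhoff_speed \<psi> (t \<oplus> d) = kirchhoff_speed \<psi> t \<oplus> (d \<otimes> kirchhoff (laplace M \<psi>) t)"
proof -
  have "kirchhoff (laplace M \<psi>) t = rconst M (Src M \<psi>) (1 / (4 * pi)) \<otimes>
      ((sphere_slope \<psi> t \<oplus> sphere_slope \<psi> t) \<oplus> (t \<otimes> sphere_curvature \<psi> t))"
    using assms by (simp add: kirchhoff_def sphere_laplace)
  then show ?thesis
    using assms by (simp add: kirchhoff_speed_def sphere_deriv ring_laws infinitesimal_square)
qed

lemma kirchhoff_zero:
  assumes "test \<psi>" "Src M \<psi> = Y"
  shows "kirchhoff \<psi> (rconst M Y 0) = rconst M Y 0"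
    and "kirchhoff_speed \<psi> (rconst M Y 0) = (let o0 = rconst M Y 0 in tapp M \<psi> (point3 M o0 o0 o0))"
proof -
  have Y: "Y \<in> Obj M" using assms by auto
  show "kirchhoff \<psi> (rconst M Y 0) = rconst M Y 0" using assms Y by (simp add: kirchhoff_def)
  have "rconst M Y (1 / (4 * pi)) \<otimes> (a \<otimes> rconst M Y (4 * pi)) = a" if "real_at Y a" for a
    using that Y by (simp add: ring_laws(4))
  then show "kirchhoff_speed \<psi> (rconst M Y 0) = (let o0 = rconst M Y 0 in tapp M \<psi> (point3 M o0 o0 o0))"
    using assms Y by (simp add: kirchhoff_speed_def sphere_zero[OF assms refl] Let_def)
qed

lemma sphere_dist_eq:
  assumes "t \<in> Arr M" "Src M t = X" "Tgt M t = R"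
  shows "sphere_dist M X t = sphere_value (Pr2 M X (testfun M)) (t \<cdot> Pr1 M X (testfun M))"
proof -
  have "X \<in> Obj M" using assms by auto
  then show ?thesis
    using assms by (simp add: sphere_dist_def dabs_def integral_op_integ sphere_value_def sphere_integral_def double_integral_def
        value_density_def Let_def)
qed

lemma ball_dist_eq:
  assumes "t \<in> Arr M" "Src M t = X" "Tgt M t = R"
  shows "ball_dist M X t = ball_value (Pr2 M X (testfun M)) (t \<cdot> Pr1 M X (testfun M))"
proof -
  have X: "X \<in> Obj M" using assms by auto
  let ?W = "Prd M X (testfun M)"
  let ?Y = "Prd M ?W R"
  let ?s = "Pr2 M ?W R"
  have "(?s \<otimes> ?s) \<otimes> sphere_value \<psi> r = double_integral ?Y (tapp M (\<psi> \<cdot> base ?Y) (spherical M (r \<cdot> base ?Y) (azimuth ?Y) (polar ?Y)) \<otimes>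
      ((?s \<cdot> base ?Y) \<otimes> (?s \<cdot> base ?Y)) \<otimes> rsin M (polar ?Y))"
    if "test \<psi>" "real_at ?Y r" "Src M \<psi> = ?Y" for \<psi> r
  proof -
    have "(?s \<otimes> ?s) \<otimes> sphere_value \<psi> r = double_integral ?Y (((?s \<otimes> ?s) \<cdot> base ?Y) \<otimes>
        (tapp M (\<psi> \<cdot> base ?Y) (spherical M (r \<cdot> base ?Y) (azimuth ?Y) (polar ?Y)) \<otimes> rsin M (polar ?Y)))"
      unfolding sphere_value_def sphere_integral_def Let_def value_density_def that(3)
      by (rule double_integral_scale[symmetric]) (use that X in auto)
    also have "((?s \<otimes> ?s) \<cdot> base ?Y) \<otimes>
        (tapp M (\<psi> \<cdot> base ?Y) (spherical M (r \<cdot> base ?Y) (azimuth ?Y) (polar ?Y)) \<otimes> rsin M (polar ?Y)) =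
      tapp M (\<psi> \<cdot> base ?Y) (spherical M (r \<cdot> base ?Y) (azimuth ?Y) (polar ?Y)) \<otimes>
      ((?s \<cdot> base ?Y) \<otimes> (?s \<cdot> base ?Y)) \<otimes> rsin M (polar ?Y)"
      using that X by (simp add: ring_laws(3,4))
    finally show ?thesis .
  qed
  then show ?thesis
    using X assms by (simp add: ball_dist_def dabs_def integral_op_integ ball_value_def double_integral_def Let_def)
qed

lemma distribution_of_kirchhoff:
  "tfun M (\<lambda>X t. dscale M X (rconst M X (1 / (4 * pi))) (dscale M X t (sphere_dist M X t))) = distribution_of kirchhoff"
  by (simp add: tfun_def dscale_def dabs_def dapp_def sphere_dist_eq distribution_of_def kirchhoff_def)

text \<open>The ball term \<open>t\<^sup>2 B\<^sub>\<Delta>\<close> is \<open>t S'\<close>.\<close>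

lemma distribution_of_kirchhoff_speed:
  "tfun M (\<lambda>X t. dscale M X (rconst M X (1 / (4 * pi)))
     (dadd M X (sphere_dist M X t) (dscale M X (t \<otimes> t) (dlaplace M X (ball_dist M X t))))) =
   distribution_of kirchhoff_speed"
proof -
  let ?P = "Prd M R (testfun M)" let ?t = "Pr1 M R (testfun M)" let ?\<psi> = "Pr2 M R (testfun M)"
  have "ball_value ?\<psi> ?t \<cdot> pair M ?t (laplace M ?\<psi>) = ball_value (laplace M ?\<psi>) ?t"
    by (simp add: ball_value_def Let_def)
  then show ?thesis
    by (simp add: tfun_def dscale_def dadd_def dlaplace_def dabs_def dapp_def sphere_dist_eq ball_dist_eq
        distribution_of_def kirchhoff_speed_def sphere_slope_ball ball_value_typing ring_laws)
qed

lemma initial_kirchhoff: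
  "has_initial_value M (distribution_of kirchhoff) (dzero M (Pt M))"
  "has_initial_value M (distribution_of kirchhoff_speed) (dirac0 M (Pt M))"
  "has_initial_value M (distribution_of (\<lambda>\<psi>. kirchhoff (laplace M \<psi>))) (dzero M (Pt M))"
proof -
  have Pt: "Pt M \<in> Obj M" using Pt_terminal by (simp add: is_terminal_def)
  then show "has_initial_value M (distribution_of kirchhoff) (dzero M (Pt M))"
    "has_initial_value M (distribution_of kirchhoff_speed) (dirac0 M (Pt M))"
    "has_initial_value M (distribution_of (\<lambda>\<psi>. kirchhoff (laplace M \<psi>))) (dzero M (Pt M))"
    by (simp_all add: has_initial_value_def at_time_distribution_of distribution_family_kirchhoff distribution_family_kirchhoff_speed distribution_family_laplace
        kirchhoff_zero dzero_def dirac0_def dabs_def)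
qed

end

theorem theorem17:
  fixes M :: "('o, 'a, 'z) sdg_data_scheme"
  assumes "well_adapted_model M"
  shows
    "(let Q = tfun M (\<lambda>X t.
           dscale M X (rconst M X (1 / (4 * pi))) (dscale M X t (sphere_dist M X t)))
     in solves_wave_equation M Q \<and>
        has_initial_value M Q (dzero M (Pt M)) \<and>
        has_initial_speed M Q (dirac0 M (Pt M))) \<and>
     (let Q = tfun M (\<lambda>X t.
           dscale M X (rconst M X (1 / (4 * pi)))
             (dadd M X (sphere_dist M X t)
                       (dscale M X (t \<otimes>\<^bsub>M\<^esub> t) (dlaplace M X (ball_dist M X t)))))
     in solves_wave_equation M Q \<and>
        has_initial_value M Q (dirac0 M (Pt M)) \<and>
        has_initial_speed M Q (dzero M (Pt M)))"
proof -
  interpret well_adapted_model M by fact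
  let ?q = kirchhoff and ?q' = kirchhoff_speed
  let ?q'' = "\<lambda>\<psi>. kirchhoff (laplace M \<psi>)"
  have d: "time_derivative M (distribution_of ?q) (distribution_of ?q')"
    by (rule time_derivative_distribution_of[OF distribution_family_kirchhoff distribution_family_kirchhoff_speed kirchhoff_deriv])
  have d': "time_derivative M (distribution_of ?q') (distribution_of ?q'')"
    by (rule time_derivative_distribution_of[OF distribution_family_kirchhoff_speed distribution_family_laplace[OF distribution_family_kirchhoff] kirchhoff_speed_deriv])
  have w: "solves_wave_equation M (distribution_of ?q)"
    by (rule wave_equation_distribution_of[OF distribution_family_kirchhoff distribution_family_kirchhoff_speed kirchhoff_deriv kirchhoff_speed_deriv])
  have w': "solves_wave_equation M (distribution_of ?q')"
    by (rule wave_equation_distribution_of[OF distribution_family_kirchhoff_speed distribution_family_laplace[OF distribution_family_kirchhoff] kirchhoff_speed_deriv])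
       (simp_all add: kirchhoff_deriv)
  show ?thesis
    unfolding Let_def distribution_of_kirchhoff distribution_of_kirchhoff_speed has_initial_speed_def
    using d d' w w' initial_kirchhoff unfolding has_initial_value_def by blast
qed

end
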